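(* Suppose that $T\ne\bar\Lambda$, that condition (N) of the context holds, and that, for all $\alpha,\beta\in(0,1)$, the tests $\tilde\chi=(\tilde\tau,\tilde d)$, $\hat\chi=(\hat\tau,\hat d)$, $\check\chi=(\check\tau,\check d)$ are designed as described in the context, with the free parameters selected as the minimizers described there. (i) If $\alpha,\beta\to0$ so that $|\log\alpha|\gtrsim|\log\beta|$, then $$\mathsf E_1[\tilde\tau]\sim\mathsf E_1[\hat\tau]\sim\mathsf E_1[\check\tau]\sim\frac{|\log\alpha|}{\psi_0(J_1)}\sim\frac{I_1}{\psi_0(J_1)}\,\mathcal L_1(\alpha,\beta).$$ (ii) If, in addition, $|\log\alpha|\lesssim|\log\beta|/\beta^r$ for some $r>0$, then $$\mathsf E_0[\hat\tau]\sim\frac{|\log\beta|}{\psi_1(J_0)}\sim\frac{I_0}{\psi_1(J_0)}\,\mathcal L_0(\alpha,\beta).$$ (iii) If $\alpha,\beta\to0$ so that $|\log\alpha|\gtrsim|\log\beta|$ and, in addition, $|\log\alpha|\lesssim|\log\beta|^r$ for some $r\ge1$, then $$\mathsf E_0[\tilde\tau]\sim\mathsf E_0[\check\tau]\sim\frac{|\log\beta|}{\psi_1(J_0)}\sim\frac{I_0}{\psi_1(J_0)}\,\mathcal L_0(\alpha,\beta).$$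
   Context: Setting. Let $X=(X_n)_{n\ge1}$ be a sequence of random elements of a measurable space $(\mathbb S,\mathcal S)$ and $\mathcal F_n=\sigma(X_1,\dots,X_n)$. The distribution of $X$ belongs to a family $\mathcal P$; $\mathcal P_0,\mathcal P_1\subset\mathcal P$ are disjoint, $H_i$ is the hypothesis that this distribution is in $\mathcal P_i$, and $\mathsf P_0\in\mathcal P_0$, $\mathsf P_1\in\mathcal P_1$ are fixed, with expectations $\mathsf E_0,\mathsf E_1$. A test is a pair $(\tau,d)$ where $\tau$ is a stopping time of $(\mathcal F_n)_{n\ge1}$ and $d\in\{0,1\}$ is $\mathcal F_\tau$-measurable ($d=i$ means that $H_i$ is selected). For $\alpha,\beta\in(0,1)$, $\mathcal C(\alpha,\beta)$ is the set of tests with $\mathsf P_0(d=1)\le\alpha$ and $\mathsf P_1(d=0)\le\beta$, and $\mathcal L_i(\alpha,\beta)=\inf\{\mathsf E_i[\tau]:(\tau,d)\in\mathcal C(\alpha,\beta)\}$, $i\in\{0,1\}$. Test statistic. $T=(T_n)_{n\ge1}$ is a sequence of real-valued statistics, $T_n$ being $\mathcal F_n$-measurable, such that for all $\alpha,\beta\in(0,1)$ there are $n\in\mathbb N$ and $\kappa\in\mathbb R$ with $\mathsf P_0(T_n>\kappa)\le\alpha$ and $\mathsf P_1(T_n\le\kappa)\le\beta$. The smallest such $n$ is denoted $n^*(\alpha,\beta)$, and $\kappa^*(\alpha,\beta)$ denotes any $\kappa$ satisfying these two inequalities with $n=n^*(\alpha,\beta)$. Standing assumptions. For every $n$, $\mathsf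 P_0$ and $\mathsf P_1$ are mutually absolutely continuous on $\mathcal F_n$; $\Lambda_n=\log\frac{d\mathsf P_1}{d\mathsf P_0}(\mathcal F_n)$, $\bar\Lambda_n=\Lambda_n/n$, $\bar\Lambda=(\bar\Lambda_n)_{n\ge1}$. There are $I_0,I_1\in(0,\infty)$ with $\mathsf P_0(\bar\Lambda_n\to-I_0)=\mathsf P_1(\bar\Lambda_n\to I_1)=1$ and, for every $\epsilon>0$, $\sum_n\mathsf P_0(\bar\Lambda_n>-I_0+\epsilon)+\sum_n\mathsf P_1(\bar\Lambda_n\le I_1-\epsilon)<\infty$. There are reals $J_0<J_1$ with $\mathsf P_0(T_n\to J_0)=\mathsf P_1(T_n\to J_1)=1$, and convex lower-semicontinuous functions $\psi_0,\psi_1:\mathbb R\to[0,\infty]$, both finite on $[J_0,J_1]$, with $\psi_0(J_0)=0$, $\psi_0$ strictly increasing on $[J_0,J_1]$, $\psi_1(J_1)=0$, $\psi_1$ strictly decreasing on $[J_0,J_1]$, and for every $\kappa\in(J_0,J_1)$: (L0) $\lim_n\frac1n\log\mathsf P_0(T_n>\kappa)=-\psi_0(\kappa)$ and (L1) $\lim_n\frac1n\log\mathsf P_1(T_n\le\kappa)=-\psi_1(\kappa)$. Condition (N): there is a neighborhood of $J_1$ in which $\psi_0$ is finite and (L0) holds, and a neighborhood of $J_0$ in which $\psi_1$ is finite and (L1) holds. Multistage tests. All three have parameters: positive integers $n_0,n_1,N$ with $n_0\vee n_1<N$ and reals $\kappa_0\le\kappa_1$ and $K$. The 4-stage test $\hat\chi$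 has in addition an integer $N_0$ with $n_0<N_0<N$ and a real $K_0\le\kappa_1$; the 4-stage test $\check\chi$ has in addition an integer $N_1$ with $n_1<N_1<N$ and a real $K_1\ge\kappa_0$. The relevant times ($n_0,n_1,N$ for the 3-stage test $\tilde\chi$; $n_0,n_1,N_0,N$ for $\hat\chi$; $n_0,n_1,N_1,N$ for $\check\chi$) are visited in increasing order until a decision is made: at time $n_0$, stop and accept $H_0$ (decision 0) if $T_{n_0}\le\kappa_0$; at time $n_1$, stop and reject $H_0$ (decision 1) if $T_{n_1}>\kappa_1$; for $\hat\chi$, at time $N_0$, stop and accept $H_0$ if $T_{N_0}\le K_0$; for $\check\chi$, at time $N_1$, stop and reject $H_0$ if $T_{N_1}>K_1$; if no decision has been made before, stop at time $N$ and reject $H_0$ iff $T_N>K$. The number of observations used is $\tilde\tau,\hat\tau,\check\tau$, respectively. Design for given $\alpha,\beta\in(0,1)$ (each threshold is the value of $\kappa^*$ at the same arguments as $n^*$ in the corresponding sample size: $\kappa_i$ goes with $n_i$, $K_i$ with $N_i$, $K$ with $N$). - $\tilde\chi$: $n_0=n^*(\gamma,\beta/2)$, $n_1=n^*(\alpha/2,\delta)$, $N=n^*(\alpha/2,\beta/2)$, with free parameters $\gamma\in(\alpha/2,1)$, $\delta\in(\beta/2,1)$. - $\hat\chi$: $n_0=n^*(\gamma,\beta/3)$, $N_0=n^*(\gamma',\beta/3)$, $n_1=n^*(\alpha/2,\delta)$, $N=n^*(\alpha/2,\beta/3)$, with free parameters $\alpha/2<\gamma'<\gamma<1$, $\delta\in(\beta/3,1)$.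 - $\check\chi$: $n_0=n^*(\gamma,\beta/2)$, $n_1=n^*(\alpha/3,\delta)$, $N_1=n^*(\alpha/3,\delta')$, $N=n^*(\alpha/3,\beta/2)$, with free parameters $\gamma\in(\alpha/3,1)$, $\beta/2<\delta'<\delta<1$. Selection of the free parameters (over the ranges just given, for each $\alpha,\beta$). - $\tilde\chi$: $\gamma$ minimizes $n_0+(N-n_0)\gamma$ and $\delta$ minimizes $n_1+(N-n_1)\delta$. - $\hat\chi$: $(\gamma,\gamma')$ minimizes $n_0+(N_0-n_0)\gamma+(N-N_0)\gamma'$ and $\delta$ minimizes $n_1+(N-n_1)\delta$. - $\check\chi$: $\gamma$ minimizes $n_0+(N-n_0)\gamma$ and $(\delta,\delta')$ minimizes $n_1+(N_1-n_1)\delta+(N-N_1)\delta'$. Here $n_0,n_1,N_0,N_1,N$ are the functions of the free parameters given in the design of the respective test. Asymptotic notation. Limits are along arbitrary sequences of $(\alpha,\beta)\in(0,1)^2$ in the stated regime; $x\sim y$ means $x/y\to1$, $x\gtrsim y$ means $\liminf x/y\ge1$, $x\lesssim y$ means $\limsup x/y\le1$. *)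

theory Defs
  imports "HOL-Probability.Probability"
begin

section \<open>Tests\<close>

text \<open>The filtration generated by \<open>X 1, X 2, \<dots>\<close> (\<open>X 0\<close> plays no role). The index set is
  \<^typ>\<open>enat\<close>, with the \<open>\<sigma>\<close>-algebra generated by the whole sequence at index \<open>\<infinity>\<close>, so that
  stopping times may take the value \<open>\<infinity>\<close>.\<close>

definition obs_filt :: "'w set \<Rightarrow> 's measure \<Rightarrow> (nat \<Rightarrow> 'w \<Rightarrow> 's) \<Rightarrow> enat \<Rightarrow> 'w measure" where
  "obs_filt \<Omega> S X n = sigma \<Omega> {X i -` A \<inter> \<Omega> | i A. 1 \<le> i \<and> enat i \<le> n \<and> A \<in> sets S}"

lemma filtration_obs_filt: "filtration \<Omega> (obs_filt \<Omega> S X)"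
proof
  fix i j :: enat
  let ?G = "\<lambda>n. {X i -` A \<inter> \<Omega> | i A. 1 \<le> i \<and> enat i \<le> n \<and> A \<in> sets S}"
  have G: "?G n \<subseteq> Pow \<Omega>" for n by auto
  show "space (obs_filt \<Omega> S X i) = \<Omega>"
    using G by (simp add: obs_filt_def space_measure_of_conv)
  assume "i \<le> j"
  then have "?G i \<subseteq> ?G j" using order_trans by blast
  then show "sets (obs_filt \<Omega> S X i) \<subseteq> sets (obs_filt \<Omega> S X j)"
    unfolding obs_filt_def sets_measure_of[OF G] by (rule sigma_sets_mono')
qed

text \<open>A test is a pair \<open>(\<tau>, d)\<close>: a stopping time with values in \<open>{1, 2, \<dots>, \<infinity>}\<close> and an
  \<open>\<F>\<^sub>\<tau>\<close>-measurable decision with values in \<open>{0, 1}\<close>.\<close>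

type_synonym 'w test = "('w \<Rightarrow> enat) \<times> ('w \<Rightarrow> nat)"

definition is_test :: "'w set \<Rightarrow> 's measure \<Rightarrow> (nat \<Rightarrow> 'w \<Rightarrow> 's) \<Rightarrow> 'w test \<Rightarrow> bool" where
  "is_test \<Omega> S X = (\<lambda>(\<tau>, d).
     stopping_time (obs_filt \<Omega> S X) \<tau> \<and> (\<forall>\<omega>\<in>\<Omega>. 1 \<le> \<tau> \<omega>) \<and>
     d \<in> filtration.pre_sigma \<Omega> (obs_filt \<Omega> S X) \<tau> \<rightarrow>\<^sub>M count_space {0, 1})"

definition test_class ::
  "'w measure \<Rightarrow> 'w measure \<Rightarrow> 's measure \<Rightarrow> (nat \<Rightarrow> 'w \<Rightarrow> 's) \<Rightarrow> real \<Rightarrow> real \<Rightarrow> 'w test set" where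
  "test_class P0 P1 S X \<alpha> \<beta> =
     {(\<tau>, d). is_test (space P0) S X (\<tau>, d) \<and>
        measure P0 {\<omega> \<in> space P0. d \<omega> = 1} \<le> \<alpha> \<and> measure P1 {\<omega> \<in> space P1. d \<omega> = 0} \<le> \<beta>}"

definition expected_time :: "'w measure \<Rightarrow> 'w test \<Rightarrow> ennreal" where
  "expected_time P \<xi> = nn_integral P (\<lambda>\<omega>. ennreal_of_enat (fst \<xi> \<omega>))"

text \<open>\<open>opt_time P \<dots>\<close> is \<open>\<L>\<^sub>i(\<alpha>, \<beta>)\<close> when \<open>P\<close> is \<open>P\<^sub>i\<close>.\<close>

definition opt_time ::
  "'w measure \<Rightarrow> 'w measure \<Rightarrow> 'w measure \<Rightarrow> 's measure \<Rightarrow> (nat \<Rightarrow> 'w \<Rightarrow> 's) \<Rightarrow> real \<Rightarrow> real \<Rightarrow> ennreal"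
where
  "opt_time P P0 P1 S X \<alpha> \<beta> = (INF \<xi>\<in>test_class P0 P1 S X \<alpha> \<beta>. expected_time P \<xi>)"


section \<open>Likelihood ratio, fixed-sample-size design, rate functions\<close>

definition LLR ::
  "'w measure \<Rightarrow> 'w measure \<Rightarrow> 's measure \<Rightarrow> (nat \<Rightarrow> 'w \<Rightarrow> 's) \<Rightarrow> nat \<Rightarrow> 'w \<Rightarrow> real" where
  "LLR P0 P1 S X n \<omega> =
     (let F = obs_filt (space P0) S X (enat n)
      in ln (enn2real (RN_deriv (restr_to_subalg P0 F) (restr_to_subalg P1 F) \<omega>)))"

definition avg_LLR ::
  "'w measure \<Rightarrow> 'w measure \<Rightarrow> 's measure \<Rightarrow> (nat \<Rightarrow> 'w \<Rightarrow> 's) \<Rightarrow> nat \<Rightarrow> 'w \<Rightarrow> real" where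
  "avg_LLR P0 P1 S X n \<omega> = LLR P0 P1 S X n \<omega> / real n"

definition fss_feasible ::
  "'w measure \<Rightarrow> 'w measure \<Rightarrow> (nat \<Rightarrow> 'w \<Rightarrow> real) \<Rightarrow> real \<Rightarrow> real \<Rightarrow> nat \<Rightarrow> real \<Rightarrow> bool" where
  "fss_feasible P0 P1 T \<alpha> \<beta> n \<kappa> \<longleftrightarrow>
     measure P0 {\<omega> \<in> space P0. T n \<omega> > \<kappa>} \<le> \<alpha> \<and> measure P1 {\<omega> \<in> space P1. T n \<omega> \<le> \<kappa>} \<le> \<beta>"

definition nstar ::
  "'w measure \<Rightarrow> 'w measure \<Rightarrow> (nat \<Rightarrow> 'w \<Rightarrow> real) \<Rightarrow> real \<Rightarrow> real \<Rightarrow> nat" where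
  "nstar P0 P1 T \<alpha> \<beta> = (LEAST n. 1 \<le> n \<and> (\<exists>\<kappa>. fss_feasible P0 P1 T \<alpha> \<beta> n \<kappa>))"

text \<open>\<open>\<kappa>\<^sup>*\<close> is an arbitrary selection of feasible thresholds at the sample sizes \<open>n\<^sup>*\<close>.\<close>

definition is_kstar ::
  "'w measure \<Rightarrow> 'w measure \<Rightarrow> (nat \<Rightarrow> 'w \<Rightarrow> real) \<Rightarrow> (real \<Rightarrow> real \<Rightarrow> real) \<Rightarrow> bool" where
  "is_kstar P0 P1 T ks \<longleftrightarrow>
     (\<forall>\<alpha>\<in>{0<..<1}. \<forall>\<beta>\<in>{0<..<1}. fss_feasible P0 P1 T \<alpha> \<beta> (nstar P0 P1 T \<alpha> \<beta>) (ks \<alpha> \<beta>))"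

text \<open>Logarithm with \<open>log 0 = -\<infinity>\<close>, because \<^term>\<open>ln (0::real) = 0\<close>.\<close>

definition elog :: "real \<Rightarrow> ereal" where
  "elog p = (if p = 0 then -\<infinity> else ereal (ln p))"

definition LD0 :: "'w measure \<Rightarrow> (nat \<Rightarrow> 'w \<Rightarrow> real) \<Rightarrow> (real \<Rightarrow> ereal) \<Rightarrow> real \<Rightarrow> bool" where
  "LD0 P0 T \<psi>0 \<kappa> \<longleftrightarrow>
     (\<lambda>n. elog (measure P0 {\<omega> \<in> space P0. T n \<omega> > \<kappa>}) / ereal (real n)) \<longlonglongrightarrow> - \<psi>0 \<kappa>"

definition LD1 :: "'w measure \<Rightarrow> (nat \<Rightarrow> 'w \<Rightarrow> real) \<Rightarrow> (real \<Rightarrow> ereal) \<Rightarrow> real \<Rightarrow> bool" where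
  "LD1 P1 T \<psi>1 \<kappa> \<longleftrightarrow>
     (\<lambda>n. elog (measure P1 {\<omega> \<in> space P1. T n \<omega> \<le> \<kappa>}) / ereal (real n)) \<longlonglongrightarrow> - \<psi>1 \<kappa>"

text \<open>The library's \<open>convex_on\<close> covers real-valued functions only.\<close>

definition ereal_convex :: "(real \<Rightarrow> ereal) \<Rightarrow> bool" where
  "ereal_convex f \<longleftrightarrow>
     (\<forall>x y t. 0 < t \<and> t < 1 \<longrightarrow>
        f ((1 - t) * x + t * y) \<le> ereal (1 - t) * f x + ereal t * f y)"

definition lower_semicont :: "(real \<Rightarrow> ereal) \<Rightarrow> bool" where
  "lower_semicont f \<longleftrightarrow> (\<forall>x. f x \<le> Liminf (at x) f)"


section \<open>Standing assumptions\<close>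

locale multistage_setting =
  P0: prob_space P0 + P1: prob_space P1
  for P0 P1 :: "'w measure" +
  fixes S :: "'s measure" and X :: "nat \<Rightarrow> 'w \<Rightarrow> 's"
    and fam fam0 fam1 :: "(nat \<Rightarrow> 's) measure set"
    and T :: "nat \<Rightarrow> 'w \<Rightarrow> real"
    and I0 I1 J0 J1 :: real
    and \<psi>0 \<psi>1 :: "real \<Rightarrow> ereal"
  assumes sets_eq: "sets P1 = sets P0"
    and X_measurable: "\<And>n. n \<ge> 1 \<Longrightarrow> X n \<in> P0 \<rightarrow>\<^sub>M S"
    and families: "fam0 \<subseteq> fam" "fam1 \<subseteq> fam" "fam0 \<inter> fam1 = {}"
    and law0: "distr P0 (PiM {1..} (\<lambda>_. S)) (\<lambda>\<omega>. \<lambda>n\<in>{1..}. X n \<omega>) \<in> fam0"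
    and law1: "distr P1 (PiM {1..} (\<lambda>_. S)) (\<lambda>\<omega>. \<lambda>n\<in>{1..}. X n \<omega>) \<in> fam1"
    and T_measurable:
      "\<And>n. n \<ge> 1 \<Longrightarrow> T n \<in> borel_measurable (obs_filt (space P0) S X (enat n))"
    and T_feasible: "\<And>\<alpha> \<beta>. \<alpha> \<in> {0<..<1} \<Longrightarrow> \<beta> \<in> {0<..<1} \<Longrightarrow>
      \<exists>n\<ge>1. \<exists>\<kappa>. fss_feasible P0 P1 T \<alpha> \<beta> n \<kappa>"
    and abs_cont: "\<And>n. n \<ge> 1 \<Longrightarrow>
      absolutely_continuous (restr_to_subalg P0 (obs_filt (space P0) S X (enat n)))
                            (restr_to_subalg P1 (obs_filt (space P0) S X (enat n))) \<and>
      absolutely_continuous (restr_to_subalg P1 (obs_filt (space P0) S X (enat n)))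
                            (restr_to_subalg P0 (obs_filt (space P0) S X (enat n)))"
    and I_pos: "0 < I0" "0 < I1"
    and LLR_lim0: "AE \<omega> in P0. (\<lambda>n. avg_LLR P0 P1 S X n \<omega>) \<longlonglongrightarrow> - I0"
    and LLR_lim1: "AE \<omega> in P1. (\<lambda>n. avg_LLR P0 P1 S X n \<omega>) \<longlonglongrightarrow> I1"
    and LLR_summable0: "\<And>\<epsilon>. \<epsilon> > 0 \<Longrightarrow>
      summable (\<lambda>n. measure P0 {\<omega> \<in> space P0. avg_LLR P0 P1 S X (Suc n) \<omega> > - I0 + \<epsilon>})"
    and LLR_summable1: "\<And>\<epsilon>. \<epsilon> > 0 \<Longrightarrow>
      summable (\<lambda>n. measure P1 {\<omega> \<in> space P1. avg_LLR P0 P1 S X (Suc n) \<omega> \<le> I1 - \<epsilon>})"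
    and J_less: "J0 < J1"
    and T_lim0: "AE \<omega> in P0. (\<lambda>n. T n \<omega>) \<longlonglongrightarrow> J0"
    and T_lim1: "AE \<omega> in P1. (\<lambda>n. T n \<omega>) \<longlonglongrightarrow> J1"
    and \<psi>_nonneg: "\<And>\<kappa>. 0 \<le> \<psi>0 \<kappa>" "\<And>\<kappa>. 0 \<le> \<psi>1 \<kappa>"
    and \<psi>_convex: "ereal_convex \<psi>0" "ereal_convex \<psi>1"
    and \<psi>_lsc: "lower_semicont \<psi>0" "lower_semicont \<psi>1"
    and \<psi>_finite: "\<And>\<kappa>. \<kappa> \<in> {J0..J1} \<Longrightarrow> \<psi>0 \<kappa> < \<infinity>" "\<And>\<kappa>. \<kappa> \<in> {J0..J1} \<Longrightarrow> \<psi>1 \<kappa> < \<infinity>"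
    and \<psi>0_mono: "\<psi>0 J0 = 0" "strict_mono_on {J0..J1} \<psi>0"
    and \<psi>1_mono: "\<psi>1 J1 = 0" "strict_antimono_on {J0..J1} \<psi>1"
    and LD0: "\<And>\<kappa>. \<kappa> \<in> {J0<..<J1} \<Longrightarrow> LD0 P0 T \<psi>0 \<kappa>"
    and LD1: "\<And>\<kappa>. \<kappa> \<in> {J0<..<J1} \<Longrightarrow> LD1 P1 T \<psi>1 \<kappa>"

definition condition_N ::
  "'w measure \<Rightarrow> 'w measure \<Rightarrow> (nat \<Rightarrow> 'w \<Rightarrow> real) \<Rightarrow> real \<Rightarrow> real \<Rightarrow>
   (real \<Rightarrow> ereal) \<Rightarrow> (real \<Rightarrow> ereal) \<Rightarrow> bool" where
  "condition_N P0 P1 T J0 J1 \<psi>0 \<psi>1 \<longleftrightarrow>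
     (\<forall>\<^sub>F \<kappa> in nhds J1. \<psi>0 \<kappa> < \<infinity> \<and> LD0 P0 T \<psi>0 \<kappa>) \<and>
     (\<forall>\<^sub>F \<kappa> in nhds J0. \<psi>1 \<kappa> < \<infinity> \<and> LD1 P1 T \<psi>1 \<kappa>)"


section \<open>Multistage tests\<close>

text \<open>\<open>A\<close> contains the pairs (time, threshold) of the stages at which \<open>H\<^sub>0\<close> may be accepted
  (\<open>T n \<le> threshold\<close>), \<open>R\<close> those at which it may be rejected (\<open>T n > threshold\<close>); \<open>N\<close> and \<open>K\<close>
  belong to the final stage.

  The parameters are unrestricted. Under the restrictions on the parameters of a multistage test
  (all earlier times smaller than \<open>N\<close>, no acceptance threshold above a rejection threshold) the
  cases in \<open>ms_decision\<close> are mutually exclusive. For some \<open>\<alpha>, \<beta>\<close> the designed parameters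
  violate them: if \<open>N = 1\<close> then \<open>n\<^sub>0 = n\<^sub>1 = N\<close>. The stopping time is meaningful in any case: the
  first stage at which some decision is made.\<close>

definition accepts :: "(nat \<Rightarrow> 'w \<Rightarrow> real) \<Rightarrow> (nat \<times> real) set \<Rightarrow> nat \<Rightarrow> 'w \<Rightarrow> bool" where
  "accepts T A n \<omega> \<longleftrightarrow> (\<exists>\<kappa>. (n, \<kappa>) \<in> A \<and> T n \<omega> \<le> \<kappa>)"

definition rejects :: "(nat \<Rightarrow> 'w \<Rightarrow> real) \<Rightarrow> (nat \<times> real) set \<Rightarrow> nat \<Rightarrow> 'w \<Rightarrow> bool" where
  "rejects T R n \<omega> \<longleftrightarrow> (\<exists>\<kappa>. (n, \<kappa>) \<in> R \<and> T n \<omega> > \<kappa>)"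

definition ms_time ::
  "(nat \<Rightarrow> 'w \<Rightarrow> real) \<Rightarrow> (nat \<times> real) set \<Rightarrow> (nat \<times> real) set \<Rightarrow> nat \<Rightarrow> 'w \<Rightarrow> nat" where
  "ms_time T A R N \<omega> = (LEAST n. accepts T A n \<omega> \<or> rejects T R n \<omega> \<or> n = N)"

definition ms_decision ::
  "(nat \<Rightarrow> 'w \<Rightarrow> real) \<Rightarrow> (nat \<times> real) set \<Rightarrow> (nat \<times> real) set \<Rightarrow> nat \<Rightarrow> real \<Rightarrow> 'w \<Rightarrow> nat" where
  "ms_decision T A R N K \<omega> =
     (if accepts T A (ms_time T A R N \<omega>) \<omega> then 0
      else if rejects T R (ms_time T A R N \<omega>) \<omega> then 1
      else if T N \<omega> > K then 1 else 0)"

definition ms_test ::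
  "(nat \<Rightarrow> 'w \<Rightarrow> real) \<Rightarrow> (nat \<times> real) set \<Rightarrow> (nat \<times> real) set \<Rightarrow> nat \<Rightarrow> real \<Rightarrow> 'w test" where
  "ms_test T A R N K = (\<lambda>\<omega>. enat (ms_time T A R N \<omega>), ms_decision T A R N K)"

text \<open>The three designed tests, as functions of the maps \<open>ns = n\<^sup>*\<close> and \<open>ks = \<kappa>\<^sup>*\<close> and of the free
  parameters \<open>\<gamma>, \<gamma>', \<delta>, \<delta>'\<close>, written \<open>g, g', d, d'\<close>.\<close>

definition chi_tilde ::
  "(nat \<Rightarrow> 'w \<Rightarrow> real) \<Rightarrow> (real \<Rightarrow> real \<Rightarrow> nat) \<Rightarrow> (real \<Rightarrow> real \<Rightarrow> real) \<Rightarrow>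
   real \<Rightarrow> real \<Rightarrow> real \<Rightarrow> real \<Rightarrow> 'w test" where
  "chi_tilde T ns ks g d \<alpha> \<beta> =
     ms_test T {(ns g (\<beta>/2), ks g (\<beta>/2))} {(ns (\<alpha>/2) d, ks (\<alpha>/2) d)}
       (ns (\<alpha>/2) (\<beta>/2)) (ks (\<alpha>/2) (\<beta>/2))"

definition chi_hat ::
  "(nat \<Rightarrow> 'w \<Rightarrow> real) \<Rightarrow> (real \<Rightarrow> real \<Rightarrow> nat) \<Rightarrow> (real \<Rightarrow> real \<Rightarrow> real) \<Rightarrow>
   real \<Rightarrow> real \<Rightarrow> real \<Rightarrow> real \<Rightarrow> real \<Rightarrow> 'w test" where
  "chi_hat T ns ks g g' d \<alpha> \<beta> =
     ms_test T {(ns g (\<beta>/3), ks g (\<beta>/3)), (ns g' (\<beta>/3), ks g' (\<beta>/3))}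
       {(ns (\<alpha>/2) d, ks (\<alpha>/2) d)}
       (ns (\<alpha>/2) (\<beta>/3)) (ks (\<alpha>/2) (\<beta>/3))"

definition chi_check ::
  "(nat \<Rightarrow> 'w \<Rightarrow> real) \<Rightarrow> (real \<Rightarrow> real \<Rightarrow> nat) \<Rightarrow> (real \<Rightarrow> real \<Rightarrow> real) \<Rightarrow>
   real \<Rightarrow> real \<Rightarrow> real \<Rightarrow> real \<Rightarrow> real \<Rightarrow> 'w test" where
  "chi_check T ns ks g d d' \<alpha> \<beta> =
     ms_test T {(ns g (\<beta>/2), ks g (\<beta>/2))}
       {(ns (\<alpha>/3) d, ks (\<alpha>/3) d), (ns (\<alpha>/3) d', ks (\<alpha>/3) d')}
       (ns (\<alpha>/3) (\<beta>/2)) (ks (\<alpha>/3) (\<beta>/2))"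

definition cost2 :: "nat \<Rightarrow> nat \<Rightarrow> real \<Rightarrow> real" where
  "cost2 n N g = real n + (real N - real n) * g"

definition cost3 :: "nat \<Rightarrow> nat \<Rightarrow> nat \<Rightarrow> real \<Rightarrow> real \<Rightarrow> real" where
  "cost3 n m N g g' = real n + (real m - real n) * g + (real N - real m) * g'"

definition selected_tilde ::
  "(real \<Rightarrow> real \<Rightarrow> nat) \<Rightarrow> real \<Rightarrow> real \<Rightarrow> real \<Rightarrow> real \<Rightarrow> bool" where
  "selected_tilde ns g d \<alpha> \<beta> \<longleftrightarrow>
     is_arg_min (\<lambda>g. cost2 (ns g (\<beta>/2)) (ns (\<alpha>/2) (\<beta>/2)) g) (\<lambda>g. \<alpha>/2 < g \<and> g < 1) g \<and>
     is_arg_min (\<lambda>d. cost2 (ns (\<alpha>/2) d) (ns (\<alpha>/2) (\<beta>/2)) d) (\<lambda>d. \<beta>/2 < d \<and> d < 1) d"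

definition selected_hat ::
  "(real \<Rightarrow> real \<Rightarrow> nat) \<Rightarrow> real \<Rightarrow> real \<Rightarrow> real \<Rightarrow> real \<Rightarrow> real \<Rightarrow> bool" where
  "selected_hat ns g g' d \<alpha> \<beta> \<longleftrightarrow>
     is_arg_min (\<lambda>(g, g'). cost3 (ns g (\<beta>/3)) (ns g' (\<beta>/3)) (ns (\<alpha>/2) (\<beta>/3)) g g')
       (\<lambda>(g, g'). \<alpha>/2 < g' \<and> g' < g \<and> g < 1) (g, g') \<and>
     is_arg_min (\<lambda>d. cost2 (ns (\<alpha>/2) d) (ns (\<alpha>/2) (\<beta>/3)) d) (\<lambda>d. \<beta>/3 < d \<and> d < 1) d"

definition selected_check ::
  "(real \<Rightarrow> real \<Rightarrow> nat) \<Rightarrow> real \<Rightarrow> real \<Rightarrow> real \<Rightarrow> real \<Rightarrow> real \<Rightarrow> bool" where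
  "selected_check ns g d d' \<alpha> \<beta> \<longleftrightarrow>
     is_arg_min (\<lambda>g. cost2 (ns g (\<beta>/2)) (ns (\<alpha>/3) (\<beta>/2)) g) (\<lambda>g. \<alpha>/3 < g \<and> g < 1) g \<and>
     is_arg_min (\<lambda>(d, d'). cost3 (ns (\<alpha>/3) d) (ns (\<alpha>/3) d') (ns (\<alpha>/3) (\<beta>/2)) d d')
       (\<lambda>(d, d'). \<beta>/2 < d' \<and> d' < d \<and> d < 1) (d, d')"


section \<open>Asymptotic comparison along sequences\<close>

definition asymp_gtrsim :: "(nat \<Rightarrow> real) \<Rightarrow> (nat \<Rightarrow> real) \<Rightarrow> bool" (infix "\<greatersim>" 50) where
  "x \<greatersim> y \<longleftrightarrow> 1 \<le> Liminf sequentially (\<lambda>k. ereal (x k / y k))"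

definition asymp_lesssim :: "(nat \<Rightarrow> real) \<Rightarrow> (nat \<Rightarrow> real) \<Rightarrow> bool" (infix "\<lesssim>" 50) where
  "x \<lesssim> y \<longleftrightarrow> Limsup sequentially (\<lambda>k. ereal (x k / y k)) \<le> 1"

end

theory Submission
  imports Defs
begin

text \<open>The two expected sample sizes are mirror images of each other: exchanging \<open>P0\<close> with \<open>P1\<close>,
  the event \<open>T n > \<kappa>\<close> with \<open>T n \<le> \<kappa>\<close> and the log-likelihood ratio with its negative exchanges them.
  The argument is therefore given once, for a measure \<open>P\<close> under which the time is averaged and a rival
  measure \<open>Q\<close>. A decision is called right if it is the correct one under \<open>P\<close>, wrong otherwise; \<open>a\<close> bounds
  the probability under \<open>Q\<close> of a right decision (an error if \<open>Q\<close> is true), \<open>b\<close> the probability under \<open>P\<close>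
  of a wrong one. The claim becomes that the mean time is \<open>\<bar>ln a\<bar> / p\<close>, where \<open>p\<close> is the rate at
  which \<open>Q\<close> of the right event decays when the threshold sits at the limit of the statistic under \<open>P\<close>.

  Lower bound. If \<open>Q (G n \<kappa>) \<le> a\<close> and \<open>n\<close> is below \<open>(1 - \<epsilon>) \<bar>ln a\<bar> / p\<close>, then \<open>P (G n \<kappa>)\<close> is
  negligible (\<open>early_right_decision_unlikely\<close>): for large \<open>n\<close> the threshold would have to lie so close to
  the limit of the statistic that \<open>Q\<close> could not be as small as \<open>a\<close>; this is where condition (N) enters.
  For each of the remaining finitely many \<open>n\<close>, absolute continuity suffices.
  Since wrong decisions are rare as well, every staged test with these error levels runs
  until about \<open>\<bar>ln a\<bar> / p\<close>, whatever its free levels are (\<open>staged_mean_lower\<close>).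

  Upper bound. The mean time is at most the cost that the free levels minimize
  (\<open>staged_mean_le_cost3\<close>), so one good choice of the free levels is enough. By
  \<open>min_size_bound\<close> a fixed-sample-size test with levels \<open>a\<close> and \<open>d\<close> needs about \<open>\<bar>ln a\<bar> / p\<close> observations
  as long as \<open>\<bar>ln d\<bar> = o(\<bar>ln a\<bar>)\<close>, and the last stage adds \<open>d\<close> times \<open>O(\<bar>ln a\<bar> + \<bar>ln b\<bar>)\<close>. With one
  free stage, \<open>d\<close> of order \<open>b + \<bar>ln a\<bar> powr -r\<close> works if \<open>\<bar>ln b\<bar>\<close> is at most of order
  \<open>\<bar>ln a\<bar> powr r\<close> (\<open>min_cost2_le\<close>). With two free stages, the first gets a small constant level, and
  the second one may be as small as \<open>b + a powr (r + 1)\<close>, because its size only has to be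
  \<open>O(\<bar>ln a\<bar>)\<close>; this allows \<open>\<bar>ln b\<bar>\<close> up to order \<open>\<bar>ln a\<bar> / a powr r\<close> (\<open>min_cost3_le\<close>). Under
  \<open>P1\<close> both conditions hold with \<open>r = 1\<close> in the regime \<open>\<bar>ln \<alpha>\<bar> \<greatersim> \<bar>ln \<beta>\<bar>\<close>; under \<open>P0\<close> they are the
  additional assumptions of the last two parts.

  Optimal time. The mean of every test is asymptotically at least \<open>\<bar>ln a\<bar> / I\<close>: before that time the
  likelihood ratio is too small for the right decision to be unlikely under \<open>Q\<close>
  (\<open>early_stop_unlikely\<close>). The first passage of the log-likelihood ratio over \<open>\<bar>ln a\<bar>\<close> attains this,
  its mean being controlled by the summability assumption (\<open>first_passage_mean\<close>).\<close>

section \<open>Limits\<close>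

text \<open>Dominated convergence for indicators; it turns almost sure statements about \<open>T n\<close> and the
  log-likelihood ratio into statements about probabilities.\<close>

lemma (in prob_space) prob_tendsto_zero_if_AE_escape:
  assumes B: "\<And>n. B n \<in> events"
    and esc: "AE \<omega> in M. \<forall>\<^sub>F n in sequentially. \<omega> \<notin> B n"
  shows "(\<lambda>n. prob (B n)) \<longlonglongrightarrow> 0"
proof -
  have "(\<lambda>n. \<integral>\<omega>. indicator (B n) \<omega> \<partial>M) \<longlonglongrightarrow> (\<integral>\<omega>. 0 \<partial>M :: real)"
  proof (rule integral_dominated_convergence[where w = "\<lambda>_. 1"])
    show "AE \<omega> in M. (\<lambda>n. indicator (B n) \<omega> :: real) \<longlonglongrightarrow> 0"
      using esc
    proof eventually_elim
      case (elim \<omega>)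
      then show ?case
        by (intro tendsto_eventually) (auto elim: eventually_mono simp: indicator_def)
    qed
  qed (use B in \<open>auto simp: indicator_def\<close>)
  then show ?thesis
    using B by simp
qed

text \<open>Large indices are controlled by the limit, and the finitely many small ones by the growth of the
  line.\<close>

lemma running_max_eventually_below_line:
  fixes y :: "nat \<Rightarrow> real"
  assumes lim: "(\<lambda>n. y n / real n) \<longlonglongrightarrow> I" and "I < c" "0 < c"
  shows "\<forall>\<^sub>F m in sequentially. \<forall>n\<in>{1..m}. y n \<le> c * real m"
proof -
  have "\<forall>\<^sub>F n in sequentially. y n / real n < c"
    using lim \<open>I < c\<close> by (rule order_tendstoD(2))
  then obtain n0 where n0: "\<And>n. n \<ge> n0 \<Longrightarrow> y n / real n < c"
    by (auto simp: eventually_sequentially)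
  define b where "b = Max (insert 0 (y ` {..n0}))"
  have b: "y n \<le> b" if "n \<le> n0" for n
    unfolding b_def using that by (intro Max_ge) auto
  have "\<forall>\<^sub>F m in sequentially. b / c \<le> real m"
    using filterlim_real_sequentially by (simp add: filterlim_at_top)
  then show ?thesis
  proof eventually_elim
    case (elim m)
    show ?case
    proof
      fix n assume n: "n \<in> {1..m}"
      show "y n \<le> c * real m"
      proof (cases "n \<le> n0")
        case True
        then show ?thesis
          using b[OF True] elim \<open>0 < c\<close> by (simp add: field_simps)
      next
        case False
        then have "y n < c * real n"
          using n0[of n] n by (simp add: field_simps)
        also have "\<dots> \<le> c * real m"
          using n \<open>0 < c\<close> by simp
        finally show ?thesis by simp
      qed
    qed
  qed
qed

lemma filterlim_abs_ln_at_right_0: "filterlim (\<lambda>x::real. \<bar>ln x\<bar>) at_top (at_right 0)"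
proof -
  have "filterlim (\<lambda>x::real. - ln x) at_top (at_right 0)"
    using ln_at_0 by (simp add: filterlim_uminus_at_top)
  moreover have "\<forall>\<^sub>F x::real in at_right 0. - ln x = \<bar>ln x\<bar>"
    using eventually_at_right_real[of 0 1, simplified] by eventually_elim simp
  ultimately show ?thesis
    by (rule filterlim_mono_eventually[OF _ order_refl order_refl])
qed

lemma asymp_equiv_if_squeezed:
  fixes f g :: "nat \<Rightarrow> real"
  assumes pos: "\<forall>\<^sub>F k in sequentially. 0 < g k"
    and lower: "\<And>\<epsilon>. 0 < \<epsilon> \<Longrightarrow> \<epsilon> < 1 \<Longrightarrow> \<forall>\<^sub>F k in sequentially. (1 - \<epsilon>) * g k \<le> f k"
    and upper: "\<And>\<epsilon>. 0 < \<epsilon> \<Longrightarrow> \<epsilon> < 1 \<Longrightarrow> \<forall>\<^sub>F k in sequentially. f k \<le> (1 + \<epsilon>) * g k"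
  shows "f \<sim>[sequentially] g"
proof (rule asymp_equivI', rule tendstoI)
  fix e :: real assume "0 < e"
  define \<epsilon> where "\<epsilon> = min (e / 2) (1 / 2)"
  have \<epsilon>: "0 < \<epsilon>" "\<epsilon> < 1" "\<epsilon> < e"
    using \<open>0 < e\<close> by (auto simp: \<epsilon>_def)
  show "\<forall>\<^sub>F k in sequentially. dist (f k / g k) 1 < e"
    using pos lower[OF \<epsilon>(1,2)] upper[OF \<epsilon>(1,2)]
  proof eventually_elim
    case (elim k)
    then have "1 - \<epsilon> \<le> f k / g k" "f k / g k \<le> 1 + \<epsilon>"
      by (simp_all add: pos_le_divide_eq pos_divide_le_eq)
    then show ?case
      using \<epsilon>(3) by (simp add: dist_real_def abs_less_iff)
  qed
qed

lemma mult_abs_ln_le_1: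
  fixes b :: real
  assumes "0 < b" "b < 1"
  shows "\<bar>ln b\<bar> * b \<le> 1"
proof -
  have "ln (1 / b) \<le> 1 / b - 1"
    using assms by (intro ln_le_minus_one) simp
  then have "\<bar>ln b\<bar> \<le> 1 / b"
    using assms by (simp add: ln_div)
  then show ?thesis
    using assms by (simp add: field_simps)
qed

section \<open>Likelihood ratios and the optimal mean time\<close>

text \<open>The two change-of-measure inequalities characterize \<open>l n\<close> as a log-likelihood ratio of
  \<open>P\<close> against \<open>Q\<close> on \<open>F n\<close>. Stated as inequalities over
  events they hold for \<open>LLR\<close> in one direction and for its negative in the other, whatever
  value the logarithm takes where the density vanishes.\<close>

locale likelihood_side =
  P: prob_space P + Q: prob_space Q
  for P Q :: "'w measure" +
  fixes F :: "enat \<Rightarrow> 'w measure" and l :: "nat \<Rightarrow> 'w \<Rightarrow> real" and I :: real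
  assumes sets_Q: "sets Q = sets P"
    and filt: "filtration (space P) F"
    and F_sub: "\<And>t. sets (F t) \<subseteq> sets P"
    and l_meas: "\<And>n. n \<ge> 1 \<Longrightarrow> l n \<in> borel_measurable (F (enat n))"
    and change_le: "\<And>n A x. n \<ge> 1 \<Longrightarrow> A \<in> sets (F (enat n)) \<Longrightarrow> (\<And>\<omega>. \<omega> \<in> A \<Longrightarrow> l n \<omega> \<le> x) \<Longrightarrow>
        measure P A \<le> exp x * measure Q A"
    and change_ge: "\<And>n A x. n \<ge> 1 \<Longrightarrow> A \<in> sets (F (enat n)) \<Longrightarrow> (\<And>\<omega>. \<omega> \<in> A \<Longrightarrow> x \<le> l n \<omega>) \<Longrightarrow>
        measure Q A \<le> exp (- x) * measure P A"
    and I_pos: "0 < I"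
    and l_lim: "AE \<omega> in P. (\<lambda>n. l n \<omega> / real n) \<longlonglongrightarrow> I"
    and l_summable: "\<And>\<epsilon>. \<epsilon> > 0 \<Longrightarrow>
        summable (\<lambda>n. measure P {\<omega> \<in> space P. l (Suc n) \<omega> / real (Suc n) < I - \<epsilon>})"
begin

sublocale filtration "space P" F by (rule filt)

lemma F_setsP: "A \<in> sets (F t) \<Longrightarrow> A \<in> sets P"
  using F_sub by blast

lemma F_setsQ: "A \<in> sets (F t) \<Longrightarrow> A \<in> sets Q"
  using F_sub sets_Q by blast

lemma l_le_sets: "n \<ge> 1 \<Longrightarrow> {\<omega> \<in> space P. l n \<omega> \<le> x} \<in> sets (F (enat n))"
  using borel_measurable_le[OF l_meas borel_measurable_const, of n x] by (simp add: space_F)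

lemma l_less_sets: "n \<ge> 1 \<Longrightarrow> {\<omega> \<in> space P. l n \<omega> < x} \<in> sets (F (enat n))"
  using borel_measurable_less[OF l_meas borel_measurable_const, of n x] by (simp add: space_F)

lemma l_gt_sets: "n \<ge> 1 \<Longrightarrow> {\<omega> \<in> space P. x < l n \<omega>} \<in> sets (F (enat n))"
  using borel_measurable_less[OF borel_measurable_const l_meas, of n x] by (simp add: space_F)

lemma l_ge_sets: "n \<ge> 1 \<Longrightarrow> {\<omega> \<in> space P. x \<le> l n \<omega>} \<in> sets (F (enat n))"
  using borel_measurable_le[OF borel_measurable_const l_meas, of n x] by (simp add: space_F)

lemma stopping_time_eq_sets:
  assumes \<tau>: "stopping_time F \<tau>" and "1 \<le> n"
  shows "{\<omega> \<in> space P. \<tau> \<omega> = enat n} \<in> sets (F (enat n))"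
proof -
  have "{\<omega> \<in> space P. \<tau> \<omega> \<le> enat k} \<in> sets (F (enat n))" if "k \<le> n" for k
    using stopping_time_le_const[OF \<tau>, of "enat k" "enat n"] that by (simp add: pred_def space_F)
  from this[of n] this[of "n - 1"]
  have "{\<omega> \<in> space P. \<tau> \<omega> \<le> enat n} - {\<omega> \<in> space P. \<tau> \<omega> \<le> enat (n - 1)} \<in> sets (F (enat n))"
    by simp
  also have "{\<omega> \<in> space P. \<tau> \<omega> \<le> enat n} - {\<omega> \<in> space P. \<tau> \<omega> \<le> enat (n - 1)} =
      {\<omega> \<in> space P. \<tau> \<omega> = enat n}"
  proof (intro set_eqI iffI)
    fix \<omega> assume "\<omega> \<in> {\<omega> \<in> space P. \<tau> \<omega> \<le> enat n} - {\<omega> \<in> space P. \<tau> \<omega> \<le> enat (n - 1)}"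
    then show "\<omega> \<in> {\<omega> \<in> space P. \<tau> \<omega> = enat n}"
      by (cases "\<tau> \<omega>") auto
  qed (use assms in auto)
  finally show ?thesis .
qed

text \<open>Wald's argument. On the part of \<open>D\<close> where the log-likelihood ratio at the stopping time is at most
  \<open>x\<close>, the change of measure applies on each event \<open>\<tau> = n\<close> separately; the rest is covered by an
  exceedance of the level \<open>x\<close> before time \<open>m\<close>.\<close>

lemma prob_stop_le_split:
  assumes \<tau>: "stopping_time F \<tau>" and \<tau>1: "\<And>\<omega>. \<omega> \<in> space P \<Longrightarrow> 1 \<le> \<tau> \<omega>"
    and D: "D \<in> sets (pre_sigma \<tau>)"
  shows "measure P {\<omega> \<in> D. \<tau> \<omega> \<le> enat m} \<le>
    exp x * measure Q D + measure P {\<omega> \<in> space P. \<exists>n\<in>{1..m}. x < l n \<omega>}"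
proof -
  have Dt: "{\<omega> \<in> D. \<tau> \<omega> \<le> t} \<in> sets (F t)" for t
    using sets_pre_sigmaD[OF \<tau> D] .
  have DP: "D \<in> sets P"
    using F_setsP[OF Dt[of \<infinity>]] by simp
  then have Dsub: "D \<subseteq> space P"
    by (rule sets.sets_into_space)
  define B where "B n = {\<omega> \<in> D. \<tau> \<omega> = enat n} \<inter> {\<omega> \<in> space P. l n \<omega> \<le> x}" for n
  have B: "B n \<in> sets (F (enat n))" if "n \<ge> 1" for n
  proof -
    have "B n = {\<omega> \<in> D. \<tau> \<omega> \<le> enat n} \<inter> {\<omega> \<in> space P. \<tau> \<omega> = enat n} \<inter> {\<omega> \<in> space P. l n \<omega> \<le> x}"
      using Dsub by (auto simp: B_def)
    then show ?thesis
      using Dt[of "enat n"] stopping_time_eq_sets[OF \<tau> that] l_le_sets[OF that, of x] by auto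
  qed
  define U where "U = {\<omega> \<in> space P. \<exists>n\<in>{1..m}. x < l n \<omega>}"
  have "U = (\<Union>n\<in>{1..m}. {\<omega> \<in> space P. x < l n \<omega>})"
    by (auto simp: U_def)
  then have UP: "U \<in> sets P"
    by (auto intro!: sets.finite_UN F_setsP[OF l_gt_sets])
  have BP: "B ` {1..m} \<subseteq> sets P" and BQ: "B ` {1..m} \<subseteq> sets Q"
    by (auto intro: F_setsP[OF B] F_setsQ[OF B])
  have disj: "disjoint_family_on B {1..m}"
    by (auto simp: disjoint_family_on_def B_def)
  have "{\<omega> \<in> D. \<tau> \<omega> \<le> enat m} \<subseteq> (\<Union>n\<in>{1..m}. B n) \<union> U"
  proof
    fix \<omega> assume \<omega>: "\<omega> \<in> {\<omega> \<in> D. \<tau> \<omega> \<le> enat m}"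
    then obtain n where n: "\<tau> \<omega> = enat n" "n \<le> m"
      by (cases "\<tau> \<omega>") auto
    moreover have "1 \<le> n"
      using \<tau>1[of \<omega>] \<omega> Dsub n by (auto simp: one_enat_def)
    ultimately show "\<omega> \<in> (\<Union>n\<in>{1..m}. B n) \<union> U"
      using \<omega> Dsub by (cases "l n \<omega> \<le> x") (auto simp: B_def U_def not_le)
  qed
  then have "measure P {\<omega> \<in> D. \<tau> \<omega> \<le> enat m} \<le> measure P ((\<Union>n\<in>{1..m}. B n) \<union> U)"
    using BP UP by (intro P.finite_measure_mono) auto
  also have "\<dots> \<le> measure P (\<Union>n\<in>{1..m}. B n) + measure P U"
    using BP UP by (intro measure_Un_le) auto
  also have "measure P (\<Union>n\<in>{1..m}. B n) \<le> (\<Sum>n\<in>{1..m}. measure P (B n))"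
    using BP by (intro P.finite_measure_subadditive_finite) auto
  also have "\<dots> \<le> (\<Sum>n\<in>{1..m}. exp x * measure Q (B n))"
    using B by (intro sum_mono change_le) (auto simp: B_def)
  also have "\<dots> = exp x * measure Q (\<Union>n\<in>{1..m}. B n)"
    using Q.finite_measure_finite_Union[OF _ BQ disj] by (simp add: sum_distrib_left)
  also have "\<dots> \<le> exp x * measure Q D"
    using DP by (intro mult_left_mono Q.finite_measure_mono) (auto simp: B_def sets_Q)
  finally show ?thesis
    by (simp add: U_def)
qed

lemma prob_early_exceedance:
  assumes "I < c"
  shows "(\<lambda>m. measure P {\<omega> \<in> space P. \<exists>n\<in>{1..m}. c * real m < l n \<omega>}) \<longlonglongrightarrow> 0"
proof (rule P.prob_tendsto_zero_if_AE_escape)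
  fix m
  have "{\<omega> \<in> space P. \<exists>n\<in>{1..m}. c * real m < l n \<omega>} = (\<Union>n\<in>{1..m}. {\<omega> \<in> space P. c * real m < l n \<omega>})"
    by auto
  also have "\<dots> \<in> P.events"
    by (auto intro!: sets.finite_UN F_setsP[OF l_gt_sets])
  finally show "{\<omega> \<in> space P. \<exists>n\<in>{1..m}. c * real m < l n \<omega>} \<in> P.events" .
next
  show "AE \<omega> in P. \<forall>\<^sub>F m in sequentially. \<omega> \<notin> {\<omega> \<in> space P. \<exists>n\<in>{1..m}. c * real m < l n \<omega>}"
    using l_lim
  proof eventually_elim
    case (elim \<omega>)
    have "0 < c" using assms I_pos by simp
    from running_max_eventually_below_line[OF elim assms this]
    show ?case by eventually_elim (auto simp: not_less)
  qed
qed

text \<open>The level \<open>x\<close> in \<open>prob_stop_le_split\<close> is taken to be \<open>(1 - \<epsilon> / 2) \<bar>ln a\<bar>\<close>: it is small enough to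
  make \<open>exp x * a\<close> vanish, and exceeds what the log-likelihood ratio, with drift \<open>I\<close>, reaches within
  \<open>(1 - \<epsilon>) \<bar>ln a\<bar> / I\<close> steps. The estimate is uniform over all stopping times.\<close>

lemma early_stop_unlikely:
  assumes \<epsilon>: "0 < \<epsilon>" "\<epsilon> < 1" and "0 < \<eta>"
  shows "\<forall>\<^sub>F a in at_right 0. \<forall>\<tau> D. stopping_time F \<tau> \<and> (\<forall>\<omega>\<in>space P. 1 \<le> \<tau> \<omega>) \<and>
      D \<in> sets (pre_sigma \<tau>) \<and> measure Q D \<le> a \<longrightarrow>
      measure P {\<omega> \<in> D. \<tau> \<omega> \<le> enat (nat \<lfloor>(1 - \<epsilon>) * \<bar>ln a\<bar> / I\<rfloor>)} \<le> \<eta>"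
proof -
  \<comment> \<open>A slope above the drift \<open>I\<close> such that \<open>c * ((1 - \<epsilon>) * \<bar>ln a\<bar> / I) = (1 - \<epsilon> / 2) * \<bar>ln a\<bar>\<close>.\<close>
  define c where "c = I * (1 - \<epsilon> / 2) / (1 - \<epsilon>)"
  define m where "m a = nat \<lfloor>(1 - \<epsilon>) * \<bar>ln a\<bar> / I\<rfloor>" for a
  define f where "f m = measure P {\<omega> \<in> space P. \<exists>n\<in>{1..m}. c * real m < l n \<omega>}" for m
  have "I < c"
    using \<epsilon> I_pos by (simp add: c_def field_simps)
  have "filterlim (\<lambda>a. (1 - \<epsilon>) / I * \<bar>ln a\<bar>) at_top (at_right 0)"
    using \<epsilon> I_pos by (intro filterlim_tendsto_pos_mult_at_top[OF tendsto_const _ filterlim_abs_ln_at_right_0]) simp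
  then have "filterlim m sequentially (at_right 0)"
    unfolding m_def
    by (intro filterlim_compose[OF filterlim_nat_sequentially] filterlim_compose[OF filterlim_floor_sequentially]) simp
  then have "((\<lambda>a. f (m a)) \<longlongrightarrow> 0) (at_right 0)"
    unfolding f_def using prob_early_exceedance[OF \<open>I < c\<close>] by (rule filterlim_compose[rotated])
  then have 1: "\<forall>\<^sub>F a in at_right 0. f (m a) < \<eta> / 2"
    by (rule order_tendstoD) (use \<open>0 < \<eta>\<close> in simp)
  have "((\<lambda>a::real. exp (- (\<epsilon> / 2) * \<bar>ln a\<bar>)) \<longlongrightarrow> 0) (at_right 0)"
    using \<epsilon> by (intro filterlim_compose[OF exp_at_bot] filterlim_tendsto_neg_mult_at_bot[OF tendsto_const _ filterlim_abs_ln_at_right_0]) simp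
  then have 2: "\<forall>\<^sub>F a::real in at_right 0. exp (- (\<epsilon> / 2) * \<bar>ln a\<bar>) < \<eta> / 2"
    by (rule order_tendstoD) (use \<open>0 < \<eta>\<close> in simp)
  have 3: "\<forall>\<^sub>F a::real in at_right 0. 0 < a \<and> a < 1"
    using eventually_at_right_real[of 0 1, simplified] by eventually_elim simp
  from 1 2 3 show ?thesis
  proof eventually_elim
    case (elim a)
    define x where "x = (1 - \<epsilon> / 2) * \<bar>ln a\<bar>"
    have "real (m a) \<le> (1 - \<epsilon>) * \<bar>ln a\<bar> / I"
      using \<epsilon> I_pos by (simp add: m_def)
    then have "c * real (m a) \<le> c * ((1 - \<epsilon>) * \<bar>ln a\<bar> / I)"
      using \<open>I < c\<close> I_pos by (intro mult_left_mono) auto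
    also have "\<dots> = x"
      using \<epsilon> I_pos by (simp add: c_def x_def)
    finally have cx: "c * real (m a) \<le> x" .
    show ?case
    proof (intro allI impI, elim conjE)
      fix \<tau> D assume \<tau>: "stopping_time F \<tau>" "\<forall>\<omega>\<in>space P. 1 \<le> \<tau> \<omega>" "D \<in> sets (pre_sigma \<tau>)" "measure Q D \<le> a"
      have "measure P {\<omega> \<in> D. \<tau> \<omega> \<le> enat (m a)} \<le>
          exp x * measure Q D + measure P {\<omega> \<in> space P. \<exists>n\<in>{1..m a}. x < l n \<omega>}"
        using \<tau> by (intro prob_stop_le_split) auto
      also have "exp x * measure Q D \<le> exp x * a"
        using \<tau> by (intro mult_left_mono) auto
      also have "\<dots> = exp x * exp (- \<bar>ln a\<bar>)"
        using elim by simp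
      also have "\<dots> = exp (- (\<epsilon> / 2) * \<bar>ln a\<bar>)"
        unfolding mult_exp_exp by (simp add: x_def algebra_simps)
      also have "measure P {\<omega> \<in> space P. \<exists>n\<in>{1..m a}. x < l n \<omega>} \<le> f (m a)"
        unfolding f_def
      proof (intro P.finite_measure_mono)
        have "{\<omega> \<in> space P. \<exists>n\<in>{1..m a}. c * real (m a) < l n \<omega>} =
            (\<Union>n\<in>{1..m a}. {\<omega> \<in> space P. c * real (m a) < l n \<omega>})"
          by auto
        also have "\<dots> \<in> P.events"
          by (auto intro!: sets.finite_UN F_setsP[OF l_gt_sets])
        finally show "{\<omega> \<in> space P. \<exists>n\<in>{1..m a}. c * real (m a) < l n \<omega>} \<in> P.events" .
      qed (use cx in force)
      finally show "measure P {\<omega> \<in> D. \<tau> \<omega> \<le> enat (nat \<lfloor>(1 - \<epsilon>) * \<bar>ln a\<bar> / I\<rfloor>)} \<le> \<eta>"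
        using elim by (simp add: m_def)
    qed
  qed
qed

lemma stopping_time_le_sets: "stopping_time F \<tau> \<Longrightarrow> {\<omega> \<in> space P. \<tau> \<omega> \<le> t} \<in> sets (F t)"
  using stopping_timeD[of F \<tau> t] by (simp add: pred_def space_F)

lemma pre_sigma_in_events:
  assumes "stopping_time F \<tau>" "D \<in> sets (pre_sigma \<tau>)"
  shows "D \<in> sets P"
  using F_setsP[OF sets_pre_sigmaD[OF assms, of \<infinity>]] by simp

text \<open>Markov's inequality: except on an event of probability at most \<open>\<eta> + b\<close> the test is still running
  at the time considered in \<open>early_stop_unlikely\<close>.\<close>

lemma mean_time_lower:
  assumes \<epsilon>: "0 < \<epsilon>" "\<epsilon> < 1" and "0 < \<eta>"
  shows "\<forall>\<^sub>F a in at_right 0. \<forall>\<tau> D b. stopping_time F \<tau> \<and> (\<forall>\<omega>\<in>space P. 1 \<le> \<tau> \<omega>) \<and>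
      D \<in> sets (pre_sigma \<tau>) \<and> measure Q D \<le> a \<and> measure P (space P - D) \<le> b \<longrightarrow>
      ennreal ((1 - \<epsilon>) * \<bar>ln a\<bar> / I * (1 - \<eta> - b)) \<le> (\<integral>\<^sup>+\<omega>. ennreal_of_enat (\<tau> \<omega>) \<partial>P)"
  using early_stop_unlikely[OF assms]
proof eventually_elim
  case (elim a)
  define y where "y = (1 - \<epsilon>) * \<bar>ln a\<bar> / I"
  define m where "m = nat \<lfloor>y\<rfloor>"
  have "0 \<le> y" using \<epsilon> I_pos by (simp add: y_def)
  have ym: "y \<le> real (Suc m)"
    unfolding m_def using \<open>0 \<le> y\<close> by linarith
  show ?case
  proof (intro allI impI, elim conjE)
    fix \<tau> D b
    assume \<tau>: "stopping_time F \<tau>" "\<forall>\<omega>\<in>space P. 1 \<le> \<tau> \<omega>" and D: "D \<in> sets (pre_sigma \<tau>)" "measure Q D \<le> a"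
      and b: "measure P (space P - D) \<le> b"
    have DP: "D \<in> sets P"
      using \<tau> D by (intro pre_sigma_in_events)
    define B where "B = {\<omega> \<in> space P. \<tau> \<omega> \<le> enat m}"
    have BP: "B \<in> sets P"
      unfolding B_def by (rule F_setsP[OF stopping_time_le_sets[OF \<tau>(1)]])
    have early: "{\<omega> \<in> D. \<tau> \<omega> \<le> enat m} \<in> sets P"
      by (rule F_setsP[OF sets_pre_sigmaD[OF \<tau>(1) D(1)]])
    have "measure P B \<le> measure P ({\<omega> \<in> D. \<tau> \<omega> \<le> enat m} \<union> (space P - D))"
      using early DP by (intro P.finite_measure_mono) (auto simp: B_def)
    also have "\<dots> \<le> measure P {\<omega> \<in> D. \<tau> \<omega> \<le> enat m} + measure P (space P - D)"
      using early DP by (intro measure_Un_le) auto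
    also have "\<dots> \<le> \<eta> + b"
      using elim \<tau> D b by (intro add_mono) (auto simp: m_def y_def)
    finally have B: "1 - \<eta> - b \<le> measure P (space P - B)"
      using P.prob_compl[OF BP] by simp
    have "ennreal (y * (1 - \<eta> - b)) \<le> ennreal (y * measure P (space P - B))"
      using B \<open>0 \<le> y\<close> by (intro ennreal_leI mult_left_mono)
    also have "\<dots> = ennreal y * emeasure P (space P - B)"
      using \<open>0 \<le> y\<close> by (simp add: ennreal_mult P.emeasure_eq_measure)
    also have "\<dots> = (\<integral>\<^sup>+\<omega>. ennreal y * indicator (space P - B) \<omega> \<partial>P)"
      using BP by (subst nn_integral_cmult_indicator) auto
    also have "\<dots> \<le> (\<integral>\<^sup>+\<omega>. ennreal_of_enat (\<tau> \<omega>) \<partial>P)"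
    proof (rule nn_integral_mono)
      fix \<omega> assume "\<omega> \<in> space P"
      have "ennreal y \<le> ennreal_of_enat (\<tau> \<omega>)" if "enat m < \<tau> \<omega>"
      proof (cases "\<tau> \<omega>")
        case (enat n)
        then have "y \<le> real n"
          using that ym by auto
        then show ?thesis
          using enat by (simp add: ennreal_of_nat_eq_real_of_nat ennreal_leI)
      qed simp
      then show "ennreal y * indicator (space P - B) \<omega> \<le> ennreal_of_enat (\<tau> \<omega>)"
        using \<open>\<omega> \<in> space P\<close> by (auto simp: B_def indicator_def not_le)
    qed
    finally show "ennreal ((1 - \<epsilon>) * \<bar>ln a\<bar> / I * (1 - \<eta> - b)) \<le> (\<integral>\<^sup>+\<omega>. ennreal_of_enat (\<tau> \<omega>) \<partial>P)"
      by (simp add: y_def)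
  qed
qed

text \<open>The stopping time of the one-sided sequential probability ratio test.\<close>

definition first_passage :: "real \<Rightarrow> 'w \<Rightarrow> enat" where
  "first_passage A \<omega> =
     (if \<exists>n\<ge>1. A \<le> l n \<omega> then enat (LEAST n. 1 \<le> n \<and> A \<le> l n \<omega>) else \<infinity>)"

lemma first_passage_le_iff: "first_passage A \<omega> \<le> enat m \<longleftrightarrow> (\<exists>n\<in>{1..m}. A \<le> l n \<omega>)"
proof
  assume *: "first_passage A \<omega> \<le> enat m"
  then have ex: "\<exists>n. 1 \<le> n \<and> A \<le> l n \<omega>"
    by (auto simp: first_passage_def split: if_splits)
  from LeastI_ex[OF ex] show "\<exists>n\<in>{1..m}. A \<le> l n \<omega>"
    using * ex by (auto simp: first_passage_def)
next
  assume "\<exists>n\<in>{1..m}. A \<le> l n \<omega>"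
  then obtain n where n: "1 \<le> n \<and> A \<le> l n \<omega>" "n \<le> m" by auto
  from Least_le[of "\<lambda>n. 1 \<le> n \<and> A \<le> l n \<omega>", OF n(1)] n show "first_passage A \<omega> \<le> enat m"
    by (auto simp: first_passage_def)
qed

lemma first_passage_eqD: "first_passage A \<omega> = enat n \<Longrightarrow> 1 \<le> n \<and> A \<le> l n \<omega>"
  using LeastI_ex[of "\<lambda>n. 1 \<le> n \<and> A \<le> l n \<omega>"]
  unfolding first_passage_def by (metis enat.distinct(1) enat.inject)

lemma stopping_time_first_passage: "stopping_time F (first_passage A)"
  unfolding stopping_time_def
proof
  fix t show "Measurable.pred (F t) (\<lambda>\<omega>. first_passage A \<omega> \<le> t)"
  proof (cases t)
    case (enat m)
    have "{\<omega> \<in> space P. first_passage A \<omega> \<le> t} = (\<Union>n\<in>{1..m}. {\<omega> \<in> space P. A \<le> l n \<omega>})"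
      unfolding enat first_passage_le_iff by auto
    also have "\<dots> \<in> sets (F t)"
    proof (rule sets.finite_UN)
      fix n assume n: "n \<in> {1..m}"
      then have "sets (F (enat n)) \<subseteq> sets (F t)"
        by (intro sets_F_mono) (simp add: enat)
      then show "{\<omega> \<in> space P. A \<le> l n \<omega>} \<in> sets (F t)"
        using l_ge_sets[of n A] n by auto
    qed simp
    finally show ?thesis
      by (simp add: pred_def space_F)
  qed simp
qed

text \<open>On \<open>first_passage A = n\<close> the log-likelihood ratio is at least \<open>A\<close>, so the change of measure costs
  a factor \<open>exp (- A)\<close>; the events are disjoint in \<open>n\<close>.\<close>

lemma first_passage_prob:
  "measure Q {\<omega> \<in> space P. first_passage A \<omega> < \<infinity>} \<le> exp (- A)"
proof -
  define B where "B n = {\<omega> \<in> space P. first_passage A \<omega> = enat n}" for n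
  have B0: "B 0 = {}"
    by (auto simp: B_def dest: first_passage_eqD)
  have B: "B n \<in> sets (F (enat n))" for n
    by (cases "n = 0") (simp_all add: B0, simp add: B_def stopping_time_eq_sets[OF stopping_time_first_passage])
  have disj: "disjoint_family B"
    by (auto simp: disjoint_family_on_def B_def)
  have un: "{\<omega> \<in> space P. first_passage A \<omega> < \<infinity>} = (\<Union>n. B n)"
    by (auto simp: B_def)
  have BP: "range B \<subseteq> sets P" and BQ: "range B \<subseteq> sets Q"
    by (auto intro: F_setsP[OF B] F_setsQ[OF B])
  have "measure Q (\<Union>n. B n) \<le> exp (- A) * measure P (\<Union>n. B n)"
  proof (rule sums_le)
    show "(\<lambda>n. measure Q (B n)) sums measure Q (\<Union>n. B n)"
      by (rule Q.finite_measure_UNION[OF BQ disj])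
    show "(\<lambda>n. exp (- A) * measure P (B n)) sums (exp (- A) * measure P (\<Union>n. B n))"
      by (intro sums_mult P.finite_measure_UNION[OF BP disj])
    show "measure Q (B n) \<le> exp (- A) * measure P (B n)" for n
    proof (cases "n = 0")
      case False
      then show ?thesis
        using B[of n] by (intro change_ge[of n]) (auto simp: B_def dest: first_passage_eqD)
    qed (simp add: B0)
  qed
  also have "\<dots> \<le> exp (- A) * 1"
    by (intro mult_left_mono) auto
  finally show ?thesis
    unfolding un by simp
qed

lemma stopping_time_measurable:
  assumes \<tau>: "stopping_time F \<tau>"
  shows "\<tau> \<in> P \<rightarrow>\<^sub>M count_space UNIV"
proof (subst measurable_count_space_eq2_countable, intro conjI ballI)
  have le: "{\<omega> \<in> space P. \<tau> \<omega> \<le> t} \<in> sets P" for t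
    by (rule F_setsP[OF stopping_time_le_sets[OF \<tau>]])
  fix t :: enat
  have gt: "(\<Union>s\<in>{..<t}. {\<omega> \<in> space P. \<tau> \<omega> \<le> s}) \<in> sets P"
    using le by (intro sets.countable_UN'') auto
  have "\<tau> -` {t} \<inter> space P = {\<omega> \<in> space P. \<tau> \<omega> \<le> t} - (\<Union>s\<in>{..<t}. {\<omega> \<in> space P. \<tau> \<omega> \<le> s})"
    by force
  then show "\<tau> -` {t} \<inter> space P \<in> sets P"
    using le[of t] gt by auto
qed simp

text \<open>The mean is the sum of the probabilities that the passage has not occurred by time \<open>n\<close>. These are
  at most 1 up to \<open>(1 + \<epsilon>) A / I\<close>; beyond it they are at most the probability that the
  average is below \<open>I / (1 + \<epsilon>)\<close>, which is summable.\<close>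

lemma first_passage_mean:
  assumes "0 < \<epsilon>"
  shows "\<exists>C\<ge>0. \<forall>A>0. (\<integral>\<^sup>+\<omega>. ennreal_of_enat (first_passage A \<omega>) \<partial>P) \<le> ennreal ((1 + \<epsilon>) * A / I + C)"
proof -
  define e where "e = I * \<epsilon> / (1 + \<epsilon>)"
  have e: "0 < e" "I - e = I / (1 + \<epsilon>)"
    using assms I_pos by (simp_all add: e_def field_simps)
  define s where "s n = measure P {\<omega> \<in> space P. l (Suc n) \<omega> / real (Suc n) < I - e}" for n
  have "summable s"
    unfolding s_def by (rule l_summable[OF e(1)])
  have s0: "0 \<le> s n" for n
    by (simp add: s_def)
  define C where "C = 1 + suminf s"
  have "0 \<le> suminf s"
    using \<open>summable s\<close> s0 by (rule suminf_nonneg)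
  show ?thesis
  proof (intro exI[of _ C] conjI allI impI)
    show "0 \<le> C" using \<open>0 \<le> suminf s\<close> by (simp add: C_def)
    fix A :: real assume "0 < A"
    define M where "M = nat \<lceil>(1 + \<epsilon>) * A / I\<rceil>"
    have "0 < (1 + \<epsilon>) * A / I"
      using assms I_pos \<open>0 < A\<close> by simp
    moreover from this have M: "real M \<le> (1 + \<epsilon>) * A / I + 1" "(1 + \<epsilon>) * A / I \<le> real M"
      unfolding M_def by linarith+
    ultimately have "M \<noteq> 0"
      by auto
    \<comment> \<open>The shift accounts for the index \<open>Suc n\<close> in the summability assumption.\<close>
    define w where "w n = (if n < M then 1 else 0) + (if n = 0 then 0 else s (n - 1))" for n
    have w0: "0 \<le> w n" for n
      using s0 by (simp add: w_def)
    have w: "emeasure P {\<omega> \<in> space P. enat n < first_passage A \<omega>} \<le> ennreal (w n)" for n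
    proof (cases "n < M")
      case True
      then have "measure P {\<omega> \<in> space P. enat n < first_passage A \<omega>} \<le> w n"
        using s0[of "n - 1"] by (auto simp: w_def intro: order_trans[OF P.prob_le_1])
      then show ?thesis by (simp add: P.emeasure_eq_measure ennreal_leI)
    next
      case False
      with \<open>M \<noteq> 0\<close> obtain j where j: "n = Suc j" by (cases n) auto
      have "A \<le> (I - e) * real n"
      proof -
        have "(1 + \<epsilon>) * A / I \<le> real n" using False M(2) by linarith
        then show ?thesis
          unfolding e(2) using assms I_pos by (simp add: field_simps)
      qed
      then have "{\<omega> \<in> space P. enat n < first_passage A \<omega>} \<subseteq> {\<omega> \<in> space P. l (Suc j) \<omega> / real (Suc j) < I - e}"
        using first_passage_le_iff[of A _ n] by (force simp: not_le[symmetric] j pos_le_divide_eq)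
      moreover have "{\<omega> \<in> space P. l (Suc j) \<omega> / real (Suc j) < I - e} \<in> sets P"
        using F_setsP[OF l_less_sets[of "Suc j" "(I - e) * real (Suc j)"]] by (simp add: pos_divide_less_eq)
      ultimately have "measure P {\<omega> \<in> space P. enat n < first_passage A \<omega>} \<le> w n"
        using False by (simp add: w_def j s_def P.finite_measure_mono)
      then show ?thesis by (simp add: P.emeasure_eq_measure ennreal_leI)
    qed
    have "(\<lambda>n. if n < M then 1 else 0 :: real) sums (\<Sum>n<M. 1)"
      using sums_If_finite_set[of "{..<M}" "\<lambda>_. 1::real"] by simp
    moreover have "(\<lambda>n. if n = 0 then 0 else s (n - 1)) sums (suminf s)"
      using summable_sums[OF \<open>summable s\<close>] sums_Suc_iff[of "\<lambda>n. if n = 0 then 0 else s (n - 1)" "suminf s"] by simp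
    ultimately have sums: "w sums (real M + suminf s)"
      unfolding w_def using sums_add by fastforce
    have "(\<integral>\<^sup>+\<omega>. ennreal_of_enat (first_passage A \<omega>) \<partial>P) =
        (\<Sum>n. emeasure P {\<omega> \<in> space P. enat n < first_passage A \<omega>})"
      using stopping_time_measurable[OF stopping_time_first_passage[of A]] by (rule nn_integral_enat_function)
    also have "\<dots> \<le> (\<Sum>n. ennreal (w n))"
      using w by (intro suminf_le) auto
    also have "\<dots> = ennreal (real M + suminf s)"
      using sums w0 by (metis suminf_ennreal2 sums_iff)
    also have "\<dots> \<le> ennreal ((1 + \<epsilon>) * A / I + C)"
      using M(1) by (intro ennreal_leI) (simp add: C_def)
    finally show "(\<integral>\<^sup>+\<omega>. ennreal_of_enat (first_passage A \<omega>) \<partial>P) \<le> ennreal ((1 + \<epsilon>) * A / I + C)" .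
  qed
qed

text \<open>The infimum over all tests, a test being represented by its stopping time and the event \<open>D\<close> of the
  right decision.\<close>

definition opt_mean :: "real \<Rightarrow> real \<Rightarrow> ennreal" where
  "opt_mean a b = (INF \<tau>\<in>{\<tau>. stopping_time F \<tau> \<and> (\<forall>\<omega>\<in>space P. 1 \<le> \<tau> \<omega>) \<and>
      (\<exists>D\<in>sets (pre_sigma \<tau>). measure Q D \<le> a \<and> measure P (space P - D) \<le> b)}.
      \<integral>\<^sup>+\<omega>. ennreal_of_enat (\<tau> \<omega>) \<partial>P)"

text \<open>The witness decides rightly as soon as the passage occurs and never stops otherwise. Under \<open>P\<close>
  the passage is almost surely finite, because its mean is, so the wrong decision has probability zero.\<close>

lemma opt_mean_upper:
  assumes "0 < \<epsilon>"
  shows "\<exists>C\<ge>0. \<forall>a b. 0 < a \<and> a < 1 \<and> 0 < b \<longrightarrow> opt_mean a b \<le> ennreal ((1 + \<epsilon>) * \<bar>ln a\<bar> / I + C)"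
proof -
  obtain C where C: "C \<ge> 0"
      "\<And>A. A > 0 \<Longrightarrow> (\<integral>\<^sup>+\<omega>. ennreal_of_enat (first_passage A \<omega>) \<partial>P) \<le> ennreal ((1 + \<epsilon>) * A / I + C)"
    using first_passage_mean[OF assms] by blast
  have "opt_mean a b \<le> ennreal ((1 + \<epsilon>) * \<bar>ln a\<bar> / I + C)" if ab: "0 < a" "a < 1" "0 < b" for a b
  proof -
    define A where "A = \<bar>ln a\<bar>"
    have "0 < A" and A: "exp (- A) = a"
      using ab by (simp_all add: A_def)
    note fp = stopping_time_first_passage[of A]
    note mean = C(2)[OF \<open>0 < A\<close>]
    define D where "D = {\<omega> \<in> space P. first_passage A \<omega> < \<infinity>}"
    have "{\<omega> \<in> D. first_passage A \<omega> \<le> t} \<in> sets (F t)" for t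
    proof (cases t)
      case (enat m)
      then have "{\<omega> \<in> D. first_passage A \<omega> \<le> t} = {\<omega> \<in> space P. first_passage A \<omega> \<le> t}"
        by (auto simp: D_def) (use enat_ord_simps(4) order_le_less_trans in blast)
      then show ?thesis using stopping_time_le_sets[OF fp] by simp
    next
      case infinity
      have "{\<omega> \<in> D. first_passage A \<omega> \<le> t} = (\<Union>m. {\<omega> \<in> space P. first_passage A \<omega> \<le> enat m})"
        by (auto simp: D_def infinity)
          (use enat_ord_simps(4) order_le_less_trans in blast)
      also have "\<dots> \<in> sets (F t)"
        using stopping_time_le_sets[OF fp] sets_F_mono[of _ t] by (intro sets.countable_UN) (auto simp: infinity)
      finally show ?thesis .
    qed
    then have D: "D \<in> sets (pre_sigma (first_passage A))"
      by (rule sets_pre_sigmaI[OF fp])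
    have "AE \<omega> in P. ennreal_of_enat (first_passage A \<omega>) \<noteq> \<infinity>"
    proof (rule nn_integral_PInf_AE)
      show "(\<lambda>\<omega>. ennreal_of_enat (first_passage A \<omega>)) \<in> borel_measurable P"
        using stopping_time_measurable[OF fp] by measurable
      show "(\<integral>\<^sup>+\<omega>. ennreal_of_enat (first_passage A \<omega>) \<partial>P) \<noteq> \<infinity>"
        using mean by (metis ennreal_less_top infinity_ennreal_def leD)
    qed
    then have "AE \<omega> in P. \<omega> \<notin> space P - D"
    proof eventually_elim
      case (elim \<omega>)
      then show ?case by (cases "first_passage A \<omega>") (auto simp: D_def)
    qed
    then have "measure P (space P - D) = 0"
      using pre_sigma_in_events[OF fp D] by (intro measure_eq_0_null_sets) (simp add: AE_iff_null_sets)
    moreover have "measure Q D \<le> a"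
      unfolding D_def using first_passage_prob[of A] A by simp
    moreover have "1 \<le> first_passage A \<omega>" for \<omega>
      by (cases "first_passage A \<omega>") (auto simp: one_enat_def dest: first_passage_eqD)
    ultimately have "opt_mean a b \<le> (\<integral>\<^sup>+\<omega>. ennreal_of_enat (first_passage A \<omega>) \<partial>P)"
      unfolding opt_mean_def using fp D ab by (intro INF_lower) (auto intro!: bexI[of _ D])
    also note mean
    finally show ?thesis by (simp add: A_def)
  qed
  then show ?thesis using C(1) by blast
qed

theorem opt_mean_asymp:
  assumes a: "\<And>k. a k \<in> {0<..<1}" "a \<longlonglongrightarrow> 0" and b: "\<And>k. b k \<in> {0<..<1}" "b \<longlonglongrightarrow> 0"
  shows "(\<lambda>k. enn2real (opt_mean (a k) (b k))) \<sim>[sequentially] (\<lambda>k. \<bar>ln (a k)\<bar> / I)"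
proof (rule asymp_equiv_if_squeezed)
  have a_at: "filterlim a (at_right 0) sequentially"
    using a(2) a(1) by (intro tendsto_imp_filterlim_at_right always_eventually) auto
  have fin: "opt_mean (a k) (b k) < \<top>" for k
  proof -
    obtain C where "\<forall>a b. 0 < a \<and> a < 1 \<and> 0 < b \<longrightarrow> opt_mean a b \<le> ennreal ((1 + 1) * \<bar>ln a\<bar> / I + C)"
      using opt_mean_upper[of 1] by auto
    then show ?thesis
      using a(1)[of k] b(1)[of k] by (metis ennreal_less_top greaterThanLessThan_iff order_le_less_trans)
  qed
  show "\<forall>\<^sub>F k in sequentially. 0 < \<bar>ln (a k)\<bar> / I"
    using a I_pos by (intro always_eventually) (auto simp: less_imp_neq)
  fix \<epsilon> :: real assume \<epsilon>: "0 < \<epsilon>" "\<epsilon> < 1"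
  have e3: "0 < \<epsilon> / 3" "\<epsilon> / 3 < 1"
    using \<epsilon> by auto
  have "\<forall>\<^sub>F k in sequentially. b k < \<epsilon> / 3"
    using b(2) by (rule order_tendstoD) (use \<epsilon> in simp)
  with eventually_compose_filterlim[OF mean_time_lower[OF e3 e3(1)] a_at]
  have "\<forall>\<^sub>F k in sequentially. (1 - \<epsilon> / 3) * \<bar>ln (a k)\<bar> / I * (1 - \<epsilon> / 3 - b k) \<le> enn2real (opt_mean (a k) (b k)) \<and> b k < \<epsilon> / 3"
  proof (eventually_elim)
    case (elim k)
    then have "ennreal ((1 - \<epsilon> / 3) * \<bar>ln (a k)\<bar> / I * (1 - \<epsilon> / 3 - b k)) \<le> opt_mean (a k) (b k)"
      unfolding opt_mean_def by (intro INF_greatest) auto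
    then show ?case
      using elim fin[of k] by (metis ennreal_enn2real ennreal_le_iff enn2real_nonneg)
  qed
  then show "\<forall>\<^sub>F k in sequentially. (1 - \<epsilon>) * (\<bar>ln (a k)\<bar> / I) \<le> enn2real (opt_mean (a k) (b k))"
  proof eventually_elim
    case (elim k)
    have "(1 - \<epsilon>) \<le> (1 - \<epsilon>/3) * (1 - \<epsilon>/3 - \<epsilon>/3)"
      using \<epsilon> by (simp add: algebra_simps)
    also have "\<dots> \<le> (1 - \<epsilon>/3) * (1 - \<epsilon>/3 - b k)"
      using \<epsilon> elim by (intro mult_left_mono) auto
    finally have "(1 - \<epsilon>) * (\<bar>ln (a k)\<bar> / I) \<le> (1 - \<epsilon>/3) * (1 - \<epsilon>/3 - b k) * (\<bar>ln (a k)\<bar> / I)"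
      using I_pos by (intro mult_right_mono) auto
    also have "\<dots> = (1 - \<epsilon>/3) * \<bar>ln (a k)\<bar> / I * (1 - \<epsilon>/3 - b k)"
      by (simp add: mult_ac)
    finally show ?case
      using elim by linarith
  qed
  obtain C where C: "C \<ge> 0" "\<And>a b. 0 < a \<Longrightarrow> a < 1 \<Longrightarrow> 0 < b \<Longrightarrow>
      opt_mean a b \<le> ennreal ((1 + \<epsilon> / 2) * \<bar>ln a\<bar> / I + C)"
    using opt_mean_upper[of "\<epsilon>/2"] \<epsilon> by auto
  have "\<forall>\<^sub>F k in sequentially. 2 * C * I / \<epsilon> \<le> \<bar>ln (a k)\<bar>"
    using filterlim_compose[OF filterlim_abs_ln_at_right_0 a_at] by (simp add: filterlim_at_top)
  then show "\<forall>\<^sub>F k in sequentially. enn2real (opt_mean (a k) (b k)) \<le> (1 + \<epsilon>) * (\<bar>ln (a k)\<bar> / I)"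
  proof eventually_elim
    case (elim k)
    have "enn2real (opt_mean (a k) (b k)) \<le> (1 + \<epsilon> / 2) * \<bar>ln (a k)\<bar> / I + C"
    proof (rule enn2real_leI)
      show "opt_mean (a k) (b k) \<le> ennreal ((1 + \<epsilon> / 2) * \<bar>ln (a k)\<bar> / I + C)"
        using a(1)[of k] b(1)[of k] by (intro C(2)) auto
      show "0 \<le> (1 + \<epsilon> / 2) * \<bar>ln (a k)\<bar> / I + C"
        using \<epsilon> I_pos C(1) by (intro add_nonneg_nonneg divide_nonneg_nonneg mult_nonneg_nonneg) auto
    qed
    also have "C \<le> \<epsilon> / 2 * (\<bar>ln (a k)\<bar> / I)"
      using elim \<epsilon> I_pos by (simp add: field_simps)
    finally show ?case
      by (simp add: algebra_simps add_divide_distrib)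
  qed
qed

end

text \<open>Quantitative absolute continuity at one fixed time, obtained by truncating the log-likelihood ratio
  at a level that it exceeds with small probability.\<close>

lemma (in likelihood_side) Q_small_imp_P_small:
  assumes "1 \<le> n" "0 < \<eta>"
  shows "\<exists>c>0. \<forall>A\<in>sets (F (enat n)). measure Q A \<le> c \<longrightarrow> measure P A \<le> \<eta>"
proof -
  have "(\<lambda>j. measure P {\<omega> \<in> space P. real j < l n \<omega>}) \<longlonglongrightarrow> 0"
  proof (rule P.prob_tendsto_zero_if_AE_escape)
    show "{\<omega> \<in> space P. real j < l n \<omega>} \<in> P.events" for j
      by (rule F_setsP[OF l_gt_sets[OF assms(1)]])
    have "\<forall>\<^sub>F j in sequentially. \<omega> \<notin> {\<omega> \<in> space P. real j < l n \<omega>}" for \<omega>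
    proof -
      have "\<forall>\<^sub>F j in sequentially. l n \<omega> \<le> real j"
        using filterlim_real_sequentially by (simp add: filterlim_at_top)
      then show ?thesis by eventually_elim simp
    qed
    then show "AE \<omega> in P. \<forall>\<^sub>F j in sequentially. \<omega> \<notin> {\<omega> \<in> space P. real j < l n \<omega>}"
      by simp
  qed
  then have "\<forall>\<^sub>F j in sequentially. measure P {\<omega> \<in> space P. real j < l n \<omega>} < \<eta> / 2"
    by (rule order_tendstoD) (use assms in simp)
  then obtain j where j: "measure P {\<omega> \<in> space P. real j < l n \<omega>} < \<eta> / 2"
    using eventually_happens'[OF sequentially_bot] by blast
  show ?thesis
  proof (intro exI[of _ "exp (- real j) * (\<eta> / 2)"] conjI ballI impI)
    fix A assume A: "A \<in> sets (F (enat n))" "measure Q A \<le> exp (- real j) * (\<eta> / 2)"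
    define B where "B = A \<inter> {\<omega> \<in> space P. l n \<omega> \<le> real j}"
    have B: "B \<in> sets (F (enat n))"
      unfolding B_def using A l_le_sets[OF assms(1)] by auto
    have "measure P A \<le> measure P (B \<union> {\<omega> \<in> space P. real j < l n \<omega>})"
      using sets.sets_into_space[OF F_setsP[OF A(1)]] F_setsP[OF B] F_setsP[OF l_gt_sets[OF assms(1)]]
      by (intro P.finite_measure_mono) (auto simp: B_def)
    also have "\<dots> \<le> measure P B + measure P {\<omega> \<in> space P. real j < l n \<omega>}"
      using F_setsP[OF B] F_setsP[OF l_gt_sets[OF assms(1)]] by (intro measure_Un_le)
    also have "measure P B \<le> exp (real j) * measure Q B"
      using assms(1) B by (rule change_le) (simp add: B_def)
    also have "\<dots> \<le> exp (real j) * measure Q A"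
      using F_setsQ[OF A(1)] by (intro mult_left_mono Q.finite_measure_mono) (auto simp: B_def)
    also have "\<dots> \<le> exp (real j) * (exp (- real j) * (\<eta> / 2))"
      using A(2) by (intro mult_left_mono) auto
    also have "\<dots> = \<eta> / 2"
      by (simp add: exp_minus)
    finally show "measure P A \<le> \<eta>"
      using j by simp
  qed (use assms in simp)
qed

section \<open>Staged tests under exponential error rates\<close>

text \<open>\<open>C\<close> holds the stages of right decisions, \<open>D\<close> those of wrong ones, and \<open>G n \<kappa>\<close> is the event
  that favours the right decision. Up to the order of the first two alternatives this is \<open>ms_time\<close>.\<close>

definition staged_time ::
  "(nat \<Rightarrow> real \<Rightarrow> 'w set) \<Rightarrow> (nat \<times> real) set \<Rightarrow> (nat \<times> real) set \<Rightarrow> nat \<Rightarrow> 'w \<Rightarrow> nat" where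
  "staged_time G C D N \<omega> =
     (LEAST n. (\<exists>\<kappa>. (n, \<kappa>) \<in> C \<and> \<omega> \<in> G n \<kappa>) \<or> (\<exists>\<kappa>. (n, \<kappa>) \<in> D \<and> \<omega> \<notin> G n \<kappa>) \<or> n = N)"

lemma staged_time_le_final: "staged_time G C D N \<omega> \<le> N"
  unfolding staged_time_def by (rule Least_le) simp

lemma staged_time_le: "(n, \<kappa>) \<in> C \<Longrightarrow> \<omega> \<in> G n \<kappa> \<Longrightarrow> staged_time G C D N \<omega> \<le> n"
  unfolding staged_time_def by (rule Least_le) auto

lemma staged_time_cases:
  obtains (right) \<kappa> where "(staged_time G C D N \<omega>, \<kappa>) \<in> C" "\<omega> \<in> G (staged_time G C D N \<omega>) \<kappa>"
  | (wrong) \<kappa> where "(staged_time G C D N \<omega>, \<kappa>) \<in> D" "\<omega> \<notin> G (staged_time G C D N \<omega>) \<kappa>"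
  | (final) "staged_time G C D N \<omega> = N"
  using LeastI[of "\<lambda>n. (\<exists>\<kappa>. (n, \<kappa>) \<in> C \<and> \<omega> \<in> G n \<kappa>) \<or> (\<exists>\<kappa>. (n, \<kappa>) \<in> D \<and> \<omega> \<notin> G n \<kappa>) \<or> n = N" N]
  unfolding staged_time_def[symmetric] by blast

text \<open>\<open>exp_upper\<close> follows from the large deviation limits between \<open>J0\<close> and \<open>J1\<close>; \<open>exp_lower\<close> needs them
  beyond the limit of the statistic under \<open>P\<close>. The second one says that an event \<open>G n \<kappa>\<close> that is not negligible under \<open>P\<close>
  cannot decay under \<open>Q\<close> faster than the rate \<open>p\<close>, uniformly in the threshold.\<close>

locale design_side = likelihood_side P Q F l I
  for P Q :: "'w measure" and F l I +
  fixes G :: "nat \<Rightarrow> real \<Rightarrow> 'w set" and p :: real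
  assumes G_sets: "\<And>n \<kappa>. 1 \<le> n \<Longrightarrow> G n \<kappa> \<in> sets (F (enat n))"
    and p_pos: "0 < p"
    and exp_upper: "\<And>r. r < p \<Longrightarrow> \<exists>\<kappa> s. 0 < s \<and> (\<forall>\<^sub>F n in sequentially.
        measure Q (G n \<kappa>) \<le> exp (- (r * real n)) \<and> measure P (space P - G n \<kappa>) \<le> exp (- (s * real n)))"
    and exp_lower: "\<And>q \<eta>. p < q \<Longrightarrow> 0 < \<eta> \<Longrightarrow> \<forall>\<^sub>F n in sequentially.
        \<forall>\<kappa>. \<eta> < measure P (G n \<kappa>) \<longrightarrow> exp (- (q * real n)) \<le> measure Q (G n \<kappa>)"
begin

definition feasible :: "real \<Rightarrow> real \<Rightarrow> nat \<Rightarrow> real \<Rightarrow> bool" where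
  "feasible a b n \<kappa> \<longleftrightarrow> measure Q (G n \<kappa>) \<le> a \<and> measure P (space P - G n \<kappa>) \<le> b"

definition min_size :: "real \<Rightarrow> real \<Rightarrow> nat" where
  "min_size a b = (LEAST n. 1 \<le> n \<and> (\<exists>\<kappa>. feasible a b n \<kappa>))"

text \<open>A single threshold \<open>\<kappa>\<close>, chosen for the rate \<open>r = p / (1 + \<epsilon>)\<close>, serves all levels: it is feasible as soon
  as \<open>n\<close> exceeds both \<open>\<bar>ln a\<bar> / r\<close> and \<open>\<bar>ln b\<bar> / s\<close>.\<close>

lemma ex_feasible_bounded:
  assumes "0 < \<epsilon>"
  shows "\<exists>C\<ge>0. \<forall>a\<in>{0<..<1}. \<forall>b\<in>{0<..<1}. \<exists>n\<ge>1. (\<exists>\<kappa>. feasible a b n \<kappa>) \<and>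
    real n \<le> (1 + \<epsilon>) * \<bar>ln a\<bar> / p + C * (\<bar>ln b\<bar> + 1)"
proof -
  define r where "r = p / (1 + \<epsilon>)"
  have r: "0 < r" "r < p" "1 / r = (1 + \<epsilon>) / p"
    using assms p_pos by (simp_all add: r_def field_simps)
  obtain \<kappa> s where s: "0 < s" and ev: "\<forall>\<^sub>F n in sequentially.
        measure Q (G n \<kappa>) \<le> exp (- (r * real n)) \<and> measure P (space P - G n \<kappa>) \<le> exp (- (s * real n))"
    using exp_upper[OF r(2)] by blast
  then obtain M0 where M0: "\<And>n. n \<ge> M0 \<Longrightarrow>
      measure Q (G n \<kappa>) \<le> exp (- (r * real n)) \<and> measure P (space P - G n \<kappa>) \<le> exp (- (s * real n))"
    by (auto simp: eventually_sequentially)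
  define M where "M = Suc M0"
  show ?thesis
  proof (intro exI[of _ "real M + 2 + 1 / s"] conjI ballI)
    fix a b :: real assume a: "a \<in> {0<..<1}" and b: "b \<in> {0<..<1}"
    define n where "n = M + nat \<lceil>\<bar>ln a\<bar> / r\<rceil> + nat \<lceil>\<bar>ln b\<bar> / s\<rceil>"
    have na: "\<bar>ln a\<bar> / r \<le> real n" and nb: "\<bar>ln b\<bar> / s \<le> real n"
      unfolding n_def by linarith+
    have "0 \<le> \<bar>ln a\<bar> / r" "0 \<le> \<bar>ln b\<bar> / s"
      using r s by auto
    then have nn: "real n \<le> real M + \<bar>ln a\<bar> / r + \<bar>ln b\<bar> / s + 2"
      unfolding n_def by linarith
    have "exp (- (r * real n)) \<le> exp (- \<bar>ln a\<bar>)" "exp (- (s * real n)) \<le> exp (- \<bar>ln b\<bar>)"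
      using na nb r s by (auto simp: field_simps)
    moreover have "exp (- \<bar>ln a\<bar>) = a" "exp (- \<bar>ln b\<bar>) = b"
      using a b by simp_all
    moreover have "M0 \<le> n"
      by (simp add: n_def M_def)
    note M0[OF this]
    ultimately have "feasible a b n \<kappa>"
      by (simp add: feasible_def)
    moreover have "real n \<le> (1 + \<epsilon>) * \<bar>ln a\<bar> / p + (real M + 2 + 1 / s) * (\<bar>ln b\<bar> + 1)"
    proof -
      have "\<bar>ln a\<bar> / r = (1 + \<epsilon>) * \<bar>ln a\<bar> / p"
        using r(3) by (metis mult.commute mult.right_neutral times_divide_eq_right)
      moreover have "real M + \<bar>ln b\<bar> / s + 2 \<le> (real M + 2 + 1 / s) * (\<bar>ln b\<bar> + 1)"
        using s by (simp add: algebra_simps)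
      ultimately show ?thesis using nn by linarith
    qed
    moreover have "1 \<le> n" by (simp add: n_def M_def)
    ultimately show "\<exists>n\<ge>1. (\<exists>\<kappa>. feasible a b n \<kappa>) \<and> real n \<le> (1 + \<epsilon>) * \<bar>ln a\<bar> / p + (real M + 2 + 1 / s) * (\<bar>ln b\<bar> + 1)"
      by blast
  qed (use s in simp)
qed

lemma min_size_feasible:
  assumes "a \<in> {0<..<1}" "b \<in> {0<..<1}"
  shows "1 \<le> min_size a b" "\<exists>\<kappa>. feasible a b (min_size a b) \<kappa>"
proof -
  have "\<exists>n. 1 \<le> n \<and> (\<exists>\<kappa>. feasible a b n \<kappa>)"
    using ex_feasible_bounded[of 1] assms by (meson zero_less_one)
  from LeastI_ex[OF this] show "1 \<le> min_size a b" "\<exists>\<kappa>. feasible a b (min_size a b) \<kappa>"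
    unfolding min_size_def by auto
qed

text \<open>The constant \<open>C\<close> multiplies only \<open>\<bar>ln b\<bar>\<close>, so that a level \<open>b\<close> with \<open>\<bar>ln b\<bar> = o(\<bar>ln a\<bar>)\<close> costs nothing to
  first order.\<close>

lemma min_size_bound:
  assumes "0 < \<epsilon>"
  shows "\<exists>C\<ge>0. \<forall>a\<in>{0<..<1}. \<forall>b\<in>{0<..<1}.
    real (min_size a b) \<le> (1 + \<epsilon>) * \<bar>ln a\<bar> / p + C * (\<bar>ln b\<bar> + 1)"
proof -
  obtain C where C: "C \<ge> 0" "\<forall>a\<in>{0<..<1}. \<forall>b\<in>{0<..<1}. \<exists>n\<ge>1. (\<exists>\<kappa>. feasible a b n \<kappa>) \<and>
    real n \<le> (1 + \<epsilon>) * \<bar>ln a\<bar> / p + C * (\<bar>ln b\<bar> + 1)"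
    using ex_feasible_bounded[OF assms] by blast
  have "real (min_size a b) \<le> (1 + \<epsilon>) * \<bar>ln a\<bar> / p + C * (\<bar>ln b\<bar> + 1)"
    if ab: "a \<in> {0<..<1}" "b \<in> {0<..<1}" for a b
  proof -
    obtain n where n: "1 \<le> n \<and> (\<exists>\<kappa>. feasible a b n \<kappa>)" "real n \<le> (1 + \<epsilon>) * \<bar>ln a\<bar> / p + C * (\<bar>ln b\<bar> + 1)"
      using C(2)[THEN bspec, THEN bspec, OF ab] by blast
    have "min_size a b \<le> n"
      unfolding min_size_def using n(1) by (rule Least_le)
    then show ?thesis using n(2) by linarith
  qed
  then show ?thesis using C(1) by blast
qed

lemma min_size_antimono:
  assumes "a \<in> {0<..<1}" "b \<in> {0<..<1}" "a \<le> a'" "b \<le> b'"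
  shows "min_size a' b' \<le> min_size a b"
proof -
  obtain \<kappa> where "feasible a b (min_size a b) \<kappa>"
    using min_size_feasible(2)[OF assms(1,2)] by blast
  then have "feasible a' b' (min_size a b) \<kappa>"
    using assms(3,4) by (simp add: feasible_def)
  then show ?thesis
    unfolding min_size_def[of a' b'] using min_size_feasible(1)[OF assms(1,2)] by (intro Least_le) blast
qed

text \<open>If \<open>P (G n \<kappa>) > \<eta>\<close> for a large \<open>n\<close>, then \<open>a \<ge> Q (G n \<kappa>) \<ge> exp (- q n)\<close> with \<open>q = p / (1 - \<epsilon>)\<close>, which
  forces \<open>n\<close> to be at least \<open>(1 - \<epsilon>) \<bar>ln a\<bar> / p\<close>. Each of the remaining finitely many \<open>n\<close> is excluded once
  \<open>a\<close> is small enough.\<close>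

lemma early_right_decision_unlikely:
  assumes \<epsilon>: "0 < \<epsilon>" "\<epsilon> < 1" and "0 < \<eta>"
  shows "\<forall>\<^sub>F a in at_right 0. \<forall>n\<ge>1. \<forall>\<kappa>. measure Q (G n \<kappa>) \<le> a \<and> real n < (1 - \<epsilon>) * \<bar>ln a\<bar> / p \<longrightarrow>
    measure P (G n \<kappa>) \<le> \<eta>"
proof -
  define q where "q = p / (1 - \<epsilon>)"
  have q: "p < q"
    using \<epsilon> p_pos by (simp add: q_def field_simps)
  obtain M where M: "\<And>n \<kappa>. n \<ge> M \<Longrightarrow> \<eta> < measure P (G n \<kappa>) \<Longrightarrow> exp (- (q * real n)) \<le> measure Q (G n \<kappa>)"
    using exp_lower[OF q \<open>0 < \<eta>\<close>] by (auto simp: eventually_sequentially)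
  have "\<forall>\<^sub>F a in at_right 0. \<forall>\<kappa>. measure Q (G n \<kappa>) \<le> a \<longrightarrow> measure P (G n \<kappa>) \<le> \<eta>" if n: "n \<in> {1..M}" for n
  proof -
    obtain c where c: "0 < c" "\<forall>A\<in>sets (F (enat n)). measure Q A \<le> c \<longrightarrow> measure P A \<le> \<eta>"
      using Q_small_imp_P_small[of n \<eta>] n \<open>0 < \<eta>\<close> by auto
    have "\<forall>\<^sub>F a in at_right 0. a \<in> {0<..<c}"
      using c(1) by (rule eventually_at_right_real)
    then show ?thesis
      by eventually_elim (use c(2) G_sets[of n] n in force)
  qed
  then have "\<forall>\<^sub>F a in at_right 0. \<forall>n\<in>{1..M}. \<forall>\<kappa>. measure Q (G n \<kappa>) \<le> a \<longrightarrow> measure P (G n \<kappa>) \<le> \<eta>"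
    by (intro eventually_ball_finite) auto
  moreover have "\<forall>\<^sub>F a::real in at_right 0. a \<in> {0<..<1}"
    by (rule eventually_at_right_real) simp
  ultimately show ?thesis
  proof eventually_elim
    case (elim a)
    show ?case
    proof (intro allI impI, elim conjE)
      fix n :: nat and \<kappa>
      assume n: "1 \<le> n" and Q: "measure Q (G n \<kappa>) \<le> a" and less: "real n < (1 - \<epsilon>) * \<bar>ln a\<bar> / p"
      show "measure P (G n \<kappa>) \<le> \<eta>"
      proof (cases "n \<le> M")
        case True
        then show ?thesis using elim n Q by auto
      next
        case False
        show ?thesis
        proof (rule ccontr)
          assume "\<not> measure P (G n \<kappa>) \<le> \<eta>"
          then have "exp (- (q * real n)) \<le> measure Q (G n \<kappa>)"
            using M[of n \<kappa>] False by simp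
          also have "\<dots> \<le> exp (- \<bar>ln a\<bar>)"
            using Q elim by simp
          finally have "\<bar>ln a\<bar> \<le> q * real n"
            by simp
          then show False
            using less \<epsilon> p_pos by (simp add: q_def field_simps)
        qed
      qed
    qed
  qed
qed

text \<open>A test that stops before \<open>(1 - \<epsilon>) \<bar>ln a\<bar> / p\<close> decides rightly too early, decides wrongly, or has
  reached its final stage; the last is impossible because \<open>P (G N K) \<ge> 1 - b > \<eta>\<close>, so that
  \<open>N\<close> cannot be that early. The bound is uniform over the levels of the stages in \<open>C\<close>
  under \<open>P\<close>, hence over all possible selections of the free levels.\<close>

lemma staged_mean_lower:
  assumes \<epsilon>: "0 < \<epsilon>" "\<epsilon> < 1" and "0 < \<eta>"
  shows "\<forall>\<^sub>F a in at_right 0. \<forall>C D N K b.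
      finite C \<and> card C \<le> 2 \<and> (\<forall>(n, \<kappa>)\<in>C. 1 \<le> n \<and> measure Q (G n \<kappa>) \<le> a) \<and>
      finite D \<and> card D \<le> 2 \<and> (\<forall>(n, \<kappa>)\<in>D. 1 \<le> n \<and> measure P (space P - G n \<kappa>) \<le> b) \<and>
      1 \<le> N \<and> feasible a b N K \<and> \<eta> + b < 1 \<longrightarrow>
      ennreal ((1 - \<epsilon>) * \<bar>ln a\<bar> / p * (1 - 2 * \<eta> - 2 * b)) \<le>
        (\<integral>\<^sup>+\<omega>. ennreal (real (staged_time G C D N \<omega>)) \<partial>P)"
  using early_right_decision_unlikely[OF assms]
proof eventually_elim
  case (elim a)
  define y where "y = (1 - \<epsilon>) * \<bar>ln a\<bar> / p"
  have "0 \<le> y" using \<epsilon> p_pos by (simp add: y_def)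
  have early: "measure P (G n \<kappa>) \<le> \<eta>" if "1 \<le> n" "measure Q (G n \<kappa>) \<le> a" "real n < y" for n \<kappa>
    using elim that by (simp add: y_def)
  show ?case
  proof (intro allI impI, elim conjE)
    fix C D N K b
    assume C: "finite C" "card C \<le> 2" "\<forall>(n, \<kappa>)\<in>C. 1 \<le> n \<and> measure Q (G n \<kappa>) \<le> a"
      and D: "finite D" "card D \<le> 2" "\<forall>(n, \<kappa>)\<in>D. 1 \<le> n \<and> measure P (space P - G n \<kappa>) \<le> b"
      and N: "1 \<le> N" "feasible a b N K" and \<eta>b: "\<eta> + b < 1"
    have GP: "G n \<kappa> \<in> sets P" if "1 \<le> n" for n \<kappa>
      by (rule F_setsP[OF G_sets[OF that]])
    have "0 \<le> b"
      using N(2) measure_nonneg order_trans unfolding feasible_def by blast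
    have "1 - b \<le> measure P (G N K)"
      using P.prob_compl[OF GP[OF N(1)], of K] N(2) by (simp add: feasible_def)
    then have yN: "y \<le> real N"
      using early[of N K] N \<eta>b by (fastforce simp: feasible_def)
    define E where "E = {c\<in>C. real (fst c) < y}"
    have E: "finite E" "card E \<le> 2"
      using C card_mono[of C E] by (auto simp: E_def)
    define B1 where "B1 = (\<Union>c\<in>E. G (fst c) (snd c))"
    define B2 where "B2 = (\<Union>c\<in>D. space P - G (fst c) (snd c))"
    have GE: "(\<lambda>c. G (fst c) (snd c)) ` E \<subseteq> sets P"
      by (auto simp: E_def intro!: GP dest!: bspec[OF C(3)])
    have GD: "(\<lambda>c. space P - G (fst c) (snd c)) ` D \<subseteq> sets P"
      by (auto intro!: GP dest!: bspec[OF D(3)])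
    have B: "B1 \<in> sets P" "B2 \<in> sets P"
      unfolding B1_def B2_def using GE GD E(1) D(1) by (blast intro: sets.finite_UN)+
    have "measure P B1 \<le> (\<Sum>c\<in>E. measure P (G (fst c) (snd c)))"
      unfolding B1_def using E(1) GE by (intro P.finite_measure_subadditive_finite)
    also have "\<dots> \<le> (\<Sum>c\<in>E. \<eta>)"
      using C(3) by (intro sum_mono early) (auto simp: E_def)
    also have "\<dots> \<le> 2 * \<eta>"
      using E(2) \<open>0 < \<eta>\<close> by simp
    finally have PB1: "measure P B1 \<le> 2 * \<eta>" .
    have "measure P B2 \<le> (\<Sum>c\<in>D. measure P (space P - G (fst c) (snd c)))"
      unfolding B2_def using D(1) GD by (intro P.finite_measure_subadditive_finite)
    also have "\<dots> \<le> (\<Sum>c\<in>D. b)"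
      using D(3) by (intro sum_mono) auto
    also have "\<dots> \<le> 2 * b"
      using D(2) \<open>0 \<le> b\<close> by (simp add: mult_right_mono)
    finally have PB2: "measure P B2 \<le> 2 * b" .
    have "measure P (B1 \<union> B2) \<le> measure P B1 + measure P B2"
      using B by (rule measure_Un_le)
    then have good: "1 - 2 * \<eta> - 2 * b \<le> measure P (space P - (B1 \<union> B2))"
      using P.prob_compl[of "B1 \<union> B2"] B PB1 PB2 by simp
    have "ennreal (y * (1 - 2 * \<eta> - 2 * b)) \<le> ennreal (y * measure P (space P - (B1 \<union> B2)))"
      using good \<open>0 \<le> y\<close> by (intro ennreal_leI mult_left_mono)
    also have "\<dots> = ennreal y * emeasure P (space P - (B1 \<union> B2))"
      using \<open>0 \<le> y\<close> by (simp add: ennreal_mult P.emeasure_eq_measure)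
    also have "\<dots> = (\<integral>\<^sup>+\<omega>. ennreal y * indicator (space P - (B1 \<union> B2)) \<omega> \<partial>P)"
      using B by (subst nn_integral_cmult_indicator) auto
    also have "\<dots> \<le> (\<integral>\<^sup>+\<omega>. ennreal (real (staged_time G C D N \<omega>)) \<partial>P)"
    proof (rule nn_integral_mono)
      fix \<omega> assume "\<omega> \<in> space P"
      have "y \<le> real (staged_time G C D N \<omega>)" if \<omega>: "\<omega> \<notin> B1" "\<omega> \<notin> B2"
      proof (cases rule: staged_time_cases[of G C D N \<omega>])
        case (right \<kappa>)
        then show ?thesis
          using \<omega>(1) unfolding B1_def E_def by force
      next
        case (wrong \<kappa>)
        then show ?thesis
          using \<omega>(2) \<open>\<omega> \<in> space P\<close> unfolding B2_def by force
      qed (use yN in simp)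
      then show "ennreal y * indicator (space P - (B1 \<union> B2)) \<omega> \<le> ennreal (real (staged_time G C D N \<omega>))"
        using \<open>\<omega> \<in> space P\<close> by (auto simp: indicator_def intro: ennreal_leI)
    qed
    finally show "ennreal ((1 - \<epsilon>) * \<bar>ln a\<bar> / p * (1 - 2 * \<eta> - 2 * b)) \<le>
        (\<integral>\<^sup>+\<omega>. ennreal (real (staged_time G C D N \<omega>)) \<partial>P)"
      by (simp add: y_def)
  qed
qed

text \<open>Only the right stages are used: the test runs past \<open>n1\<close> only if the first one fails to decide, and past
  \<open>n2\<close> only if the second one fails as well. A single right stage is the case \<open>n1 = n2\<close>.\<close>

lemma staged_mean_le_cost3:
  assumes n: "1 \<le> n1" "n1 \<le> n2" "n2 \<le> N"
    and \<delta>: "measure P (space P - G n1 \<kappa>1) \<le> d1" "measure P (space P - G n2 \<kappa>2) \<le> d2"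
    and C: "(n1, \<kappa>1) \<in> C" "(n2, \<kappa>2) \<in> C"
  shows "(\<integral>\<^sup>+\<omega>. ennreal (real (staged_time G C D N \<omega>)) \<partial>P) \<le> ennreal (cost3 n1 n2 N d1 d2)"
proof -
  define W1 where "W1 = space P - G n1 \<kappa>1"
  define W2 where "W2 = space P - G n2 \<kappa>2"
  have W: "W1 \<in> sets P" "W2 \<in> sets P"
    unfolding W1_def W2_def using F_setsP[OF G_sets[of n1 \<kappa>1]] F_setsP[OF G_sets[of n2 \<kappa>2]] n by auto
  have int: "integrable P (indicator W1 :: _ \<Rightarrow> real)" "integrable P (indicator W2 :: _ \<Rightarrow> real)"
      "integrable P (\<lambda>_. real n1)"
    using W by (simp_all add: P.emeasure_eq_measure)
  let ?u = "\<lambda>\<omega>. real n1 + (real n2 - real n1) * indicator W1 \<omega> + (real N - real n2) * indicator W2 \<omega>"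
  have "real (staged_time G C D N \<omega>) \<le> ?u \<omega>"
    if "\<omega> \<in> space P" for \<omega>
  proof (cases "\<omega> \<in> W1")
    case False
    then have "staged_time G C D N \<omega> \<le> n1"
      using staged_time_le[OF C(1), of \<omega> G D N] that by (auto simp: W1_def)
    then show ?thesis using n False by (simp add: indicator_def)
  next
    case True
    show ?thesis
    proof (cases "\<omega> \<in> W2")
      case False
      then have "staged_time G C D N \<omega> \<le> n2"
        using staged_time_le[OF C(2), of \<omega> G D N] that by (auto simp: W2_def)
      then show ?thesis using True False by simp
    qed (use True staged_time_le_final[of G C D N \<omega>] in simp)
  qed
  then have "(\<integral>\<^sup>+\<omega>. ennreal (real (staged_time G C D N \<omega>)) \<partial>P) \<le>
      (\<integral>\<^sup>+\<omega>. ennreal (?u \<omega>) \<partial>P)"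
    by (intro nn_integral_mono ennreal_leI)
  also have "\<dots> = ennreal (\<integral>\<omega>. ?u \<omega> \<partial>P)"
    using n by (intro nn_integral_eq_integral Bochner_Integration.integrable_add integrable_mult_right int)
      (auto simp: indicator_def)
  also have "(\<integral>\<omega>. ?u \<omega> \<partial>P) =
      real n1 + (real n2 - real n1) * measure P W1 + (real N - real n2) * measure P W2"
    using W int by (simp add: P.prob_space)
  also have "\<dots> \<le> cost3 n1 n2 N d1 d2"
    unfolding cost3_def using n \<delta> by (intro add_mono mult_left_mono) (auto simp: W1_def W2_def)
  finally show ?thesis
    by (simp add: ennreal_leI)
qed

section \<open>Selection of the free levels\<close>

text \<open>The competitor is \<open>d = b + \<bar>ln a\<bar> powr -r\<close>. It exceeds the lower end \<open>b\<close> of the admissible range, it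
  is large enough for \<open>\<bar>ln d\<bar>\<close> to be only logarithmic in \<open>\<bar>ln a\<bar>\<close>, and small enough for the final stage,
  entered with probability at most \<open>d\<close>, to contribute \<open>o(\<bar>ln a\<bar>)\<close>: its size is of order
  \<open>\<bar>ln a\<bar> + \<bar>ln b\<bar>\<close>, and \<open>\<bar>ln b\<bar> * b\<close> as well as \<open>\<bar>ln b\<bar> * \<bar>ln a\<bar> powr -r\<close> are bounded.\<close>

lemma min_cost2_le:
  fixes a b \<delta> :: "nat \<Rightarrow> real"
  assumes a: "\<And>k. a k \<in> {0<..<1}" "a \<longlonglongrightarrow> 0" and b: "\<And>k. b k \<in> {0<..<1}" "b \<longlonglongrightarrow> 0"
    and r: "1 \<le> r" and ab: "\<forall>\<^sub>F k in sequentially. \<bar>ln (b k)\<bar> \<le> c * \<bar>ln (a k)\<bar> powr r"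
    and sel: "\<And>k. is_arg_min (\<lambda>d. cost2 (min_size (a k) d) (min_size (a k) (b k)) d) (\<lambda>d. b k < d \<and> d < 1) (\<delta> k)"
    and "0 < \<epsilon>"
  shows "\<forall>\<^sub>F k in sequentially.
    cost2 (min_size (a k) (\<delta> k)) (min_size (a k) (b k)) (\<delta> k) \<le> (1 + \<epsilon>) * (\<bar>ln (a k)\<bar> / p)"
proof -
  define L where "L k = \<bar>ln (a k)\<bar>" for k
  have L_lim: "filterlim L at_top sequentially"
    unfolding L_def
    by (rule filterlim_compose[OF filterlim_abs_ln_at_right_0])
      (use a in \<open>intro tendsto_imp_filterlim_at_right always_eventually, auto\<close>)
  define d where "d k = b k + L k powr (- r)" for k
  have Lr: "(\<lambda>k. L k powr (- r)) \<longlonglongrightarrow> 0"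
    using r by (intro tendsto_neg_powr L_lim) simp
  have d_lim: "d \<longlonglongrightarrow> 0"
    unfolding d_def using tendsto_add[OF b(2) Lr] by simp
  obtain C where C: "0 \<le> C" "\<And>a b. a\<in>{0<..<1} \<Longrightarrow> b\<in>{0<..<1} \<Longrightarrow>
      real (min_size a b) \<le> (1 + \<epsilon> / 2) * \<bar>ln a\<bar> / p + C * (\<bar>ln b\<bar> + 1)"
    using min_size_bound[of "\<epsilon>/2"] \<open>0 < \<epsilon>\<close> by auto
  \<comment> \<open>\<open>R k * L k\<close> collects all terms of the cost beyond \<open>(1 + \<epsilon> / 2) * L k / p\<close>.\<close>
  define R where "R k = C * (r * (ln (L k) / L k) + 1 / L k) + (1 + \<epsilon> / 2) / p * d k +
      C * ((1 + c + d k) / L k)" for k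
  have lnL: "(\<lambda>k. ln (L k) / L k) \<longlonglongrightarrow> 0"
    by (rule filterlim_compose[OF ln_x_over_x_tendsto_0 L_lim])
  have L1: "(\<lambda>k. 1 / L k) \<longlonglongrightarrow> 0"
    by (rule tendsto_divide_0[OF tendsto_const]) (rule filterlim_at_top_imp_at_infinity[OF L_lim])
  have Ld: "(\<lambda>k. (1 + c + d k) / L k) \<longlonglongrightarrow> 0"
    by (rule tendsto_divide_0[OF tendsto_add[OF tendsto_const d_lim]])
      (rule filterlim_at_top_imp_at_infinity[OF L_lim])
  have "R \<longlonglongrightarrow> C * (r * 0 + 0) + (1 + \<epsilon> / 2) / p * 0 + C * 0"
    unfolding R_def by (intro tendsto_intros lnL L1 Ld d_lim)
  then have "R \<longlonglongrightarrow> 0" by simp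
  then have "\<forall>\<^sub>F k in sequentially. R k < \<epsilon> / 2 / p"
    by (rule order_tendstoD) (use \<open>0 < \<epsilon>\<close> p_pos in simp)
  moreover have "\<forall>\<^sub>F k in sequentially. 1 \<le> L k"
    using L_lim by (simp add: filterlim_at_top)
  moreover have "\<forall>\<^sub>F k in sequentially. d k < 1"
    using d_lim by (rule order_tendstoD) simp
  ultimately show ?thesis
    using ab
  proof eventually_elim
    case (elim k)
    have "0 < L k" using elim by simp
    have Lpos: "0 < L k powr (- r)" using \<open>0 < L k\<close> by simp
    have d01: "d k \<in> {0<..<1}" "b k < d k"
      using b(1)[of k] Lpos elim unfolding d_def by (auto intro: add_pos_pos)
    have "ln (L k powr (- r)) \<le> ln (d k)"
      using b(1)[of k] Lpos d01 by (subst ln_le_cancel_iff) (auto simp: d_def)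
    then have lnd: "\<bar>ln (d k)\<bar> \<le> r * ln (L k)"
      using d01 \<open>0 < L k\<close> by (simp add: ln_powr)
    have n: "real (min_size (a k) (d k)) \<le> (1 + \<epsilon> / 2) * L k / p + C * (r * ln (L k) + 1)"
      using C(2)[OF a(1)[of k] d01(1)] mult_left_mono[OF lnd C(1)] by (simp add: L_def algebra_simps)
    have "real (min_size (a k) (b k)) * d k \<le> ((1 + \<epsilon> / 2) * L k / p + C * (\<bar>ln (b k)\<bar> + 1)) * d k"
      using C(2)[OF a(1)[of k] b(1)[of k]] d01 by (intro mult_right_mono) (auto simp: L_def)
    also have "\<dots> = (1 + \<epsilon> / 2) / p * d k * L k + C * (\<bar>ln (b k)\<bar> * d k + d k)"
      by (simp add: algebra_simps)
    also have "\<bar>ln (b k)\<bar> * d k = \<bar>ln (b k)\<bar> * b k + \<bar>ln (b k)\<bar> * L k powr (- r)"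
      by (simp add: d_def algebra_simps)
    also have "\<bar>ln (b k)\<bar> * b k \<le> 1"
      using b(1)[of k] by (intro mult_abs_ln_le_1) auto
    also have "\<bar>ln (b k)\<bar> * L k powr (- r) \<le> (c * L k powr r) * L k powr (- r)"
      using elim by (intro mult_right_mono) (auto simp: L_def)
    also have "\<dots> = c"
      using \<open>0 < L k\<close> by (simp add: powr_minus)
    finally have N: "real (min_size (a k) (b k)) * d k \<le> (1 + \<epsilon> / 2) / p * d k * L k + C * (1 + c + d k)"
      using C(1) by (simp add: mult_left_mono)
    have "cost2 (min_size (a k) (\<delta> k)) (min_size (a k) (b k)) (\<delta> k) \<le> cost2 (min_size (a k) (d k)) (min_size (a k) (b k)) (d k)"
      using sel[of k] d01 unfolding is_arg_min_def by (metis (no_types, lifting) greaterThanLessThan_iff not_le)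
    also have "\<dots> \<le> real (min_size (a k) (d k)) + real (min_size (a k) (b k)) * d k"
      using d01 by (simp add: cost2_def algebra_simps)
    also have "\<dots> \<le> (1 + \<epsilon> / 2) * L k / p + R k * L k"
    proof -
      have "R k * L k = C * (r * ln (L k) + 1) + (1 + \<epsilon> / 2) / p * d k * L k + C * (1 + c + d k)"
        using \<open>0 < L k\<close> by (simp add: R_def distrib_right distrib_left add_divide_distrib)
      then show ?thesis using n N by linarith
    qed
    also have "R k * L k \<le> \<epsilon> / 2 / p * L k"
      using elim \<open>0 < L k\<close> by (intro mult_right_mono) auto
    finally show ?case
      by (simp add: L_def algebra_simps add_divide_distrib)
  qed
qed

text \<open>The competitor has a small constant first level \<open>\<eta>\<close> and second level \<open>d' = b + a powr (r + 1)\<close>. The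
  second stage has size \<open>O(\<bar>ln a\<bar>)\<close> and is reached with probability at most \<open>\<eta>\<close>, which is negligible
  as \<open>\<eta>\<close> tends to 0; the final stage is so rarely reached that its size may be of order \<open>\<bar>ln a\<bar> / a powr r\<close>.\<close>

lemma min_cost3_le:
  fixes a b \<delta> \<delta>' :: "nat \<Rightarrow> real"
  assumes a: "\<And>k. a k \<in> {0<..<1}" "a \<longlonglongrightarrow> 0" and b: "\<And>k. b k \<in> {0<..<1}" "b \<longlonglongrightarrow> 0"
    and r: "0 < r" and ab: "\<forall>\<^sub>F k in sequentially. \<bar>ln (b k)\<bar> \<le> c * (\<bar>ln (a k)\<bar> / a k powr r)"
    and sel: "\<And>k. is_arg_min (\<lambda>(d, d'). cost3 (min_size (a k) d) (min_size (a k) d') (min_size (a k) (b k)) d d')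
        (\<lambda>(d, d'). b k < d' \<and> d' < d \<and> d < 1) (\<delta> k, \<delta>' k)"
    and \<epsilon>: "0 < \<epsilon>" and c: "0 \<le> c"
  shows "\<forall>\<^sub>F k in sequentially.
    cost3 (min_size (a k) (\<delta> k)) (min_size (a k) (\<delta>' k)) (min_size (a k) (b k)) (\<delta> k) (\<delta>' k) \<le> (1 + \<epsilon>) * (\<bar>ln (a k)\<bar> / p)"
proof -
  define L where "L k = \<bar>ln (a k)\<bar>" for k
  have L_lim: "filterlim L at_top sequentially"
    unfolding L_def
    by (rule filterlim_compose[OF filterlim_abs_ln_at_right_0])
      (use a in \<open>intro tendsto_imp_filterlim_at_right always_eventually, auto\<close>)
  define d' where "d' k = b k + a k powr (r + 1)" for k
  have ar: "(\<lambda>k. a k powr (r + 1)) \<longlonglongrightarrow> 0"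
    using a r by (intro tendsto_zero_powrI[OF a(2) tendsto_const]) (auto intro!: always_eventually simp: less_imp_le)
  have d'_lim: "d' \<longlonglongrightarrow> 0"
    unfolding d'_def using tendsto_add[OF b(2) ar] by simp
  obtain C where C: "0 \<le> C" "\<And>a b. a\<in>{0<..<1} \<Longrightarrow> b\<in>{0<..<1} \<Longrightarrow>
      real (min_size a b) \<le> (1 + \<epsilon> / 3) * \<bar>ln a\<bar> / p + C * (\<bar>ln b\<bar> + 1)"
    using min_size_bound[of "\<epsilon>/3"] \<open>0 < \<epsilon>\<close> by auto
  define S where "S = (1 + \<epsilon> / 3) / p + C * (r + 1)"
  have "0 < S"
    using \<epsilon> p_pos C(1) r by (simp add: S_def add_pos_nonneg)
  \<comment> \<open>\<open>S * \<bar>ln a\<bar>\<close> bounds the size of the second stage up to an additive constant, so this \<open>\<eta>\<close> makes its contribution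
     at most \<open>\<epsilon> / (3 p) * \<bar>ln a\<bar>\<close>.\<close>
  define \<eta> where "\<eta> = min (1 / 2) (\<epsilon> / (3 * p * S))"
  have \<eta>: "0 < \<eta>" "\<eta> < 1" "\<eta> * S \<le> \<epsilon> / (3 * p)"
    using \<epsilon> p_pos \<open>0 < S\<close> by (auto simp: \<eta>_def min_def field_simps)
  \<comment> \<open>\<open>R k * L k\<close> collects all terms of lower order.\<close>
  define R where "R k = C * (\<bar>ln \<eta>\<bar> + 1) * (1 / L k) + \<eta> * C * (1 / L k) +
      (1 + \<epsilon> / 3) / p * d' k + C * ((1 + c + d' k) / L k)" for k
  have L1: "(\<lambda>k. 1 / L k) \<longlonglongrightarrow> 0"
    by (rule tendsto_divide_0[OF tendsto_const]) (rule filterlim_at_top_imp_at_infinity[OF L_lim])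
  have Ld: "(\<lambda>k. (1 + c + d' k) / L k) \<longlonglongrightarrow> 0"
    by (rule tendsto_divide_0[OF tendsto_add[OF tendsto_const d'_lim]])
      (rule filterlim_at_top_imp_at_infinity[OF L_lim])
  have "R \<longlonglongrightarrow> C * (\<bar>ln \<eta>\<bar> + 1) * 0 + \<eta> * C * 0 + (1 + \<epsilon> / 3) / p * 0 + C * 0"
    unfolding R_def by (intro tendsto_intros L1 Ld d'_lim)
  then have "R \<longlonglongrightarrow> 0" by simp
  then have "\<forall>\<^sub>F k in sequentially. R k < \<epsilon> / 3 / p"
    by (rule order_tendstoD) (use \<open>0 < \<epsilon>\<close> p_pos in simp)
  moreover have "\<forall>\<^sub>F k in sequentially. 1 \<le> L k"
    using L_lim by (simp add: filterlim_at_top)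
  moreover have "\<forall>\<^sub>F k in sequentially. d' k < \<eta>"
    using d'_lim by (rule order_tendstoD) (use \<eta> in simp)
  ultimately show ?thesis
    using ab
  proof eventually_elim
    case (elim k)
    have "0 < L k" using elim by simp
    have a01: "0 < a k" "a k < 1" using a(1)[of k] by auto
    have apos: "0 < a k powr (r + 1)" using a01 by simp
    have d01: "d' k \<in> {0<..<1}" "b k < d' k"
      using b(1)[of k] apos elim \<eta> unfolding d'_def by (auto intro: add_pos_pos)
    have "ln (a k powr (r + 1)) \<le> ln (d' k)"
      using b(1)[of k] apos d01 by (subst ln_le_cancel_iff) (auto simp: d'_def)
    then have lnd: "\<bar>ln (d' k)\<bar> \<le> (r + 1) * L k"
      using d01 a01 by (simp add: ln_powr L_def)
    have n1: "real (min_size (a k) \<eta>) \<le> (1 + \<epsilon> / 3) * L k / p + C * (\<bar>ln \<eta>\<bar> + 1)"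
      using C(2)[OF a(1)[of k], of \<eta>] \<eta> by (simp add: L_def)
    have "real (min_size (a k) (d' k)) \<le> (1 + \<epsilon> / 3) * L k / p + C * ((r + 1) * L k + 1)"
      using C(2)[OF a(1)[of k] d01(1)] mult_left_mono[OF lnd C(1)] by (simp add: L_def algebra_simps)
    also have "\<dots> = S * L k + C"
      by (simp add: S_def algebra_simps)
    finally have "real (min_size (a k) (d' k)) * \<eta> \<le> (S * L k + C) * \<eta>"
      using \<eta> by (intro mult_right_mono) auto
    also have "\<dots> = \<eta> * S * L k + \<eta> * C"
      by (simp add: algebra_simps)
    also have "\<eta> * S * L k \<le> \<epsilon> / (3 * p) * L k"
      using \<eta>(3) \<open>0 < L k\<close> by (intro mult_right_mono) auto
    finally have n2: "real (min_size (a k) (d' k)) * \<eta> \<le> \<epsilon> / (3 * p) * L k + \<eta> * C"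
      by simp
    have "real (min_size (a k) (b k)) * d' k \<le> ((1 + \<epsilon> / 3) * L k / p + C * (\<bar>ln (b k)\<bar> + 1)) * d' k"
      using C(2)[OF a(1)[of k] b(1)[of k]] d01 by (intro mult_right_mono) (auto simp: L_def)
    also have "\<dots> = (1 + \<epsilon> / 3) / p * d' k * L k + C * (\<bar>ln (b k)\<bar> * d' k + d' k)"
      by (simp add: algebra_simps)
    also have "\<bar>ln (b k)\<bar> * d' k = \<bar>ln (b k)\<bar> * b k + \<bar>ln (b k)\<bar> * a k powr (r + 1)"
      by (simp add: d'_def algebra_simps)
    also have "\<bar>ln (b k)\<bar> * b k \<le> 1"
      using b(1)[of k] by (intro mult_abs_ln_le_1) auto
    also have "\<bar>ln (b k)\<bar> * a k powr (r + 1) \<le> c * (L k / a k powr r) * a k powr (r + 1)"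
      using elim by (intro mult_right_mono) (auto simp: L_def)
    also have "\<dots> = c * (L k * a k)"
      using a01 by (simp add: powr_add)
    also have "\<dots> \<le> c * 1"
      unfolding L_def using a01 c by (intro mult_left_mono mult_abs_ln_le_1) auto
    finally have N: "real (min_size (a k) (b k)) * d' k \<le> (1 + \<epsilon> / 3) / p * d' k * L k + C * (1 + c + d' k)"
      using C(1) by (simp add: mult_left_mono)
    have "cost3 (min_size (a k) (\<delta> k)) (min_size (a k) (\<delta>' k)) (min_size (a k) (b k)) (\<delta> k) (\<delta>' k) \<le>
        cost3 (min_size (a k) \<eta>) (min_size (a k) (d' k)) (min_size (a k) (b k)) \<eta> (d' k)"
    proof -
      have "b k < d' k \<and> d' k < \<eta> \<and> \<eta> < 1"
        using d01 elim \<eta> by simp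
      then show ?thesis
        using sel[of k] unfolding is_arg_min_linorder by (elim conjE allE[of _ "(\<eta>, d' k)"]) simp
    qed
    also have "\<dots> \<le> real (min_size (a k) \<eta>) + real (min_size (a k) (d' k)) * \<eta> + real (min_size (a k) (b k)) * d' k"
      using d01 \<eta> by (simp add: cost3_def algebra_simps)
    also have "\<dots> \<le> (1 + \<epsilon> / 3) * L k / p + \<epsilon> / (3 * p) * L k + R k * L k"
    proof -
      have "R k * L k = C * (\<bar>ln \<eta>\<bar> + 1) + \<eta> * C + (1 + \<epsilon> / 3) / p * d' k * L k + C * (1 + c + d' k)"
        using \<open>0 < L k\<close> by (simp add: R_def distrib_right distrib_left add_divide_distrib)
      then show ?thesis using n1 n2 N by linarith
    qed
    also have "R k * L k \<le> \<epsilon> / 3 / p * L k"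
      using elim \<open>0 < L k\<close> by (intro mult_right_mono) auto
    finally show ?case
      by (simp add: L_def algebra_simps add_divide_distrib)
  qed
qed

text \<open>The two bounds on the mean time meet as soon as the cost is at most \<open>(1 + \<epsilon>) \<bar>ln a\<bar> / p\<close>.\<close>

theorem staged_mean_asymp:
  fixes a b \<delta> \<delta>' :: "nat \<Rightarrow> real"
  assumes a: "\<And>k. a k \<in> {0<..<1}" "a \<longlonglongrightarrow> 0" and b: "\<And>k. b k \<in> {0<..<1}" "b \<longlonglongrightarrow> 0"
    and n: "\<And>k. 1 \<le> n1 k" "\<And>k. n1 k \<le> n2 k" "\<And>k. n2 k \<le> N k"
    and f: "\<And>k. feasible (a k) (\<delta> k) (n1 k) (\<kappa>1 k)" "\<And>k. feasible (a k) (\<delta>' k) (n2 k) (\<kappa>2 k)"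
      "\<And>k. feasible (a k) (b k) (N k) (K k)"
    and C: "\<And>k. C k = {(n1 k, \<kappa>1 k), (n2 k, \<kappa>2 k)}"
    and D: "\<And>k. finite (D k)" "\<And>k. card (D k) \<le> 2"
      "\<And>k n \<kappa>. (n, \<kappa>) \<in> D k \<Longrightarrow> 1 \<le> n \<and> measure P (space P - G n \<kappa>) \<le> b k"
    and cost: "\<And>\<epsilon>. 0 < \<epsilon> \<Longrightarrow> \<forall>\<^sub>F k in sequentially.
        cost3 (n1 k) (n2 k) (N k) (\<delta> k) (\<delta>' k) \<le> (1 + \<epsilon>) * (\<bar>ln (a k)\<bar> / p)"
  shows "(\<lambda>k. enn2real (\<integral>\<^sup>+\<omega>. ennreal (real (staged_time G (C k) (D k) (N k) \<omega>)) \<partial>P))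
    \<sim>[sequentially] (\<lambda>k. \<bar>ln (a k)\<bar> / p)"
proof (rule asymp_equiv_if_squeezed)
  have a_at: "filterlim a (at_right 0) sequentially"
    using a by (intro tendsto_imp_filterlim_at_right always_eventually) auto
  define E where "E k = (\<integral>\<^sup>+\<omega>. ennreal (real (staged_time G (C k) (D k) (N k) \<omega>)) \<partial>P)" for k
  have E: "E k \<le> ennreal (cost3 (n1 k) (n2 k) (N k) (\<delta> k) (\<delta>' k))" for k
    unfolding E_def using n[of k] f[of k] by (intro staged_mean_le_cost3) (auto simp: feasible_def C)
  then have fin: "E k < \<top>" for k
    by (rule order_le_less_trans) simp
  show "\<forall>\<^sub>F k in sequentially. 0 < \<bar>ln (a k)\<bar> / p"
    using a p_pos by (intro always_eventually) (auto simp: less_imp_neq)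
  fix \<epsilon> :: real assume \<epsilon>: "0 < \<epsilon>" "\<epsilon> < 1"
  have e5: "0 < \<epsilon> / 5" "\<epsilon> / 5 < 1"
    using \<epsilon> by auto
  have "\<forall>\<^sub>F k in sequentially. b k < \<epsilon> / 5"
    using b(2) by (rule order_tendstoD) (use \<epsilon> in simp)
  with eventually_compose_filterlim[OF staged_mean_lower[OF e5 e5(1)] a_at]
  have "\<forall>\<^sub>F k in sequentially. (1 - \<epsilon>) * (\<bar>ln (a k)\<bar> / p) \<le> enn2real (E k)"
  proof eventually_elim
    case (elim k)
    have "finite (C k)" "card (C k) \<le> 2" "\<forall>(n, \<kappa>)\<in>C k. 1 \<le> n \<and> measure Q (G n \<kappa>) \<le> a k"
      using n[of k] f[of k] card_insert_le_m1[of 2 "{(n2 k, \<kappa>2 k)}" "(n1 k, \<kappa>1 k)"]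
      by (auto simp: C feasible_def)
    moreover have "1 \<le> N k" using n[of k] by simp
    moreover have "\<forall>(n, \<kappa>)\<in>D k. 1 \<le> n \<and> measure P (space P - G n \<kappa>) \<le> b k"
      using D(3) by blast
    ultimately have "ennreal ((1 - \<epsilon> / 5) * \<bar>ln (a k)\<bar> / p * (1 - 2 * (\<epsilon> / 5) - 2 * b k)) \<le> E k"
      unfolding E_def using D(1,2)[of k] f(3)[of k] \<epsilon> elim by auto
    then have 1: "(1 - \<epsilon> / 5) * \<bar>ln (a k)\<bar> / p * (1 - 2 * (\<epsilon> / 5) - 2 * b k) \<le> enn2real (E k)"
      using fin[of k] by (metis ennreal_enn2real ennreal_le_iff enn2real_nonneg)
    have "(1 - \<epsilon>) \<le> (1 - \<epsilon>/5) * (1 - 2 * (\<epsilon>/5) - 2 * (\<epsilon>/5))"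
      using \<epsilon> by (simp add: algebra_simps)
    also have "\<dots> \<le> (1 - \<epsilon>/5) * (1 - 2 * (\<epsilon>/5) - 2 * b k)"
      using \<epsilon> elim by (intro mult_left_mono) auto
    finally have "(1 - \<epsilon>) * (\<bar>ln (a k)\<bar> / p) \<le> (1 - \<epsilon>/5) * (1 - 2 * (\<epsilon>/5) - 2 * b k) * (\<bar>ln (a k)\<bar> / p)"
      using p_pos by (intro mult_right_mono) auto
    also have "\<dots> = (1 - \<epsilon>/5) * \<bar>ln (a k)\<bar> / p * (1 - 2 * (\<epsilon>/5) - 2 * b k)"
      by (simp add: mult_ac)
    finally show ?case
      using 1 by linarith
  qed
  then show "\<forall>\<^sub>F k in sequentially. (1 - \<epsilon>) * (\<bar>ln (a k)\<bar> / p) \<le>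
      enn2real (\<integral>\<^sup>+\<omega>. ennreal (real (staged_time G (C k) (D k) (N k) \<omega>)) \<partial>P)"
    by (simp add: E_def)
  have "\<forall>\<^sub>F k in sequentially. enn2real (E k) \<le> (1 + \<epsilon>) * (\<bar>ln (a k)\<bar> / p)"
    using cost[OF \<epsilon>(1)]
  proof eventually_elim
    case (elim k)
    show ?case
    proof (rule enn2real_leI)
      show "E k \<le> ennreal ((1 + \<epsilon>) * (\<bar>ln (a k)\<bar> / p))"
        using E[of k] ennreal_leI[OF elim] by (rule order_trans)
    qed (use \<epsilon> p_pos in simp)
  qed
  then show "\<forall>\<^sub>F k in sequentially.
      enn2real (\<integral>\<^sup>+\<omega>. ennreal (real (staged_time G (C k) (D k) (N k) \<omega>)) \<partial>P) \<le> (1 + \<epsilon>) * (\<bar>ln (a k)\<bar> / p)"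
    by (simp add: E_def)
qed

theorem one_right_stage_asymp:
  fixes a b \<delta> :: "nat \<Rightarrow> real"
  assumes a: "\<And>k. a k \<in> {0<..<1}" "a \<longlonglongrightarrow> 0" and b: "\<And>k. b k \<in> {0<..<1}" "b \<longlonglongrightarrow> 0"
    and r: "1 \<le> r" and ab: "\<forall>\<^sub>F k in sequentially. \<bar>ln (b k)\<bar> \<le> c * \<bar>ln (a k)\<bar> powr r"
    and sel: "\<And>k. is_arg_min (\<lambda>d. cost2 (min_size (a k) d) (min_size (a k) (b k)) d) (\<lambda>d. b k < d \<and> d < 1) (\<delta> k)"
    and \<kappa>: "\<And>x y. x \<in> {0<..<1} \<Longrightarrow> y \<in> {0<..<1} \<Longrightarrow> feasible x y (min_size x y) (\<kappa> x y)"
    and D: "\<And>k. finite (D k)" "\<And>k. card (D k) \<le> 2"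
      "\<And>k n \<rho>. (n, \<rho>) \<in> D k \<Longrightarrow> 1 \<le> n \<and> measure P (space P - G n \<rho>) \<le> b k"
  shows "(\<lambda>k. enn2real (\<integral>\<^sup>+\<omega>. ennreal (real (staged_time G {(min_size (a k) (\<delta> k), \<kappa> (a k) (\<delta> k))} (D k)
      (min_size (a k) (b k)) \<omega>)) \<partial>P)) \<sim>[sequentially] (\<lambda>k. \<bar>ln (a k)\<bar> / p)"
proof -
  have \<delta>: "\<delta> k \<in> {0<..<1}" "b k < \<delta> k" for k
    using sel[of k] b(1)[of k] by (auto simp: is_arg_min_def)
  \<comment> \<open>The single right stage counts as two coinciding ones.\<close>
  show ?thesis
  proof (rule staged_mean_asymp[OF a b, where \<delta> = \<delta> and \<delta>' = \<delta> and ?n1.0 = "\<lambda>k. min_size (a k) (\<delta> k)" and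
        ?n2.0 = "\<lambda>k. min_size (a k) (\<delta> k)" and ?\<kappa>1.0 = "\<lambda>k. \<kappa> (a k) (\<delta> k)" and ?\<kappa>2.0 = "\<lambda>k. \<kappa> (a k) (\<delta> k)"
        and K = "\<lambda>k. \<kappa> (a k) (b k)"])
    show "\<forall>\<^sub>F k in sequentially. cost3 (min_size (a k) (\<delta> k)) (min_size (a k) (\<delta> k)) (min_size (a k) (b k)) (\<delta> k) (\<delta> k)
        \<le> (1 + \<epsilon>) * (\<bar>ln (a k)\<bar> / p)" if "0 < \<epsilon>" for \<epsilon>
      using min_cost2_le[OF a b r ab sel that] by (simp add: cost3_def cost2_def)
  qed (use D \<delta> a b \<kappa> min_size_feasible(1) in \<open>auto simp: less_imp_le intro!: min_size_antimono\<close>)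
qed

theorem two_right_stages_asymp:
  fixes a b \<delta> \<delta>' :: "nat \<Rightarrow> real"
  assumes a: "\<And>k. a k \<in> {0<..<1}" "a \<longlonglongrightarrow> 0" and b: "\<And>k. b k \<in> {0<..<1}" "b \<longlonglongrightarrow> 0"
    and r: "0 < r" and ab: "\<forall>\<^sub>F k in sequentially. \<bar>ln (b k)\<bar> \<le> c * (\<bar>ln (a k)\<bar> / a k powr r)"
    and c: "0 \<le> c"
    and sel: "\<And>k. is_arg_min (\<lambda>(d, d'). cost3 (min_size (a k) d) (min_size (a k) d') (min_size (a k) (b k)) d d')
        (\<lambda>(d, d'). b k < d' \<and> d' < d \<and> d < 1) (\<delta> k, \<delta>' k)"
    and \<kappa>: "\<And>x y. x \<in> {0<..<1} \<Longrightarrow> y \<in> {0<..<1} \<Longrightarrow> feasible x y (min_size x y) (\<kappa> x y)"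
    and D: "\<And>k. finite (D k)" "\<And>k. card (D k) \<le> 2"
      "\<And>k n \<rho>. (n, \<rho>) \<in> D k \<Longrightarrow> 1 \<le> n \<and> measure P (space P - G n \<rho>) \<le> b k"
  shows "(\<lambda>k. enn2real (\<integral>\<^sup>+\<omega>. ennreal (real (staged_time G
      {(min_size (a k) (\<delta> k), \<kappa> (a k) (\<delta> k)), (min_size (a k) (\<delta>' k), \<kappa> (a k) (\<delta>' k))} (D k)
      (min_size (a k) (b k)) \<omega>)) \<partial>P)) \<sim>[sequentially] (\<lambda>k. \<bar>ln (a k)\<bar> / p)"
proof -
  have \<delta>: "\<delta> k \<in> {0<..<1}" "\<delta>' k \<in> {0<..<1}" "b k < \<delta>' k" "\<delta>' k < \<delta> k" for k
    using sel[of k] b(1)[of k] by (auto simp: is_arg_min_def)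
  show ?thesis
    by (rule staged_mean_asymp[OF a b, where \<delta> = \<delta> and \<delta>' = \<delta>' and ?n1.0 = "\<lambda>k. min_size (a k) (\<delta> k)" and
        ?n2.0 = "\<lambda>k. min_size (a k) (\<delta>' k)" and ?\<kappa>1.0 = "\<lambda>k. \<kappa> (a k) (\<delta> k)" and ?\<kappa>2.0 = "\<lambda>k. \<kappa> (a k) (\<delta>' k)"
        and K = "\<lambda>k. \<kappa> (a k) (b k)"])
      (use D \<delta> a b \<kappa> min_size_feasible(1) min_cost3_le[OF a b r ab sel _ c] in
        \<open>auto simp: less_imp_le intro!: min_size_antimono\<close>)
qed

end

section \<open>Rate functions\<close>

lemma elog_rate_upper:
  assumes lim: "(\<lambda>n. elog (m n) / ereal (real n)) \<longlonglongrightarrow> - \<psi>" and r: "ereal r < \<psi>" and m: "\<And>n. 0 \<le> m n"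
  shows "\<forall>\<^sub>F n in sequentially. m n \<le> exp (- (r * real n))"
proof -
  have "- \<psi> < ereal (- r)"
    using r by (cases \<psi>) auto
  with lim have "\<forall>\<^sub>F n in sequentially. elog (m n) / ereal (real n) < ereal (- r)"
    by (rule order_tendstoD(2))
  then show ?thesis
    using eventually_gt_at_top[of 0]
  proof eventually_elim
    case (elim n)
    show ?case
    proof (cases "m n = 0")
      case False
      then have "ln (m n) / real n < - r"
        using elim by (simp add: elog_def)
      then have "ln (m n) < - (r * real n)"
        using elim by (simp add: field_simps)
      then have "exp (ln (m n)) < exp (- (r * real n))"
        by simp
      then show ?thesis
        using False m[of n] by simp
    qed simp
  qed
qed

lemma elog_rate_lower:
  assumes lim: "(\<lambda>n. elog (m n) / ereal (real n)) \<longlonglongrightarrow> - \<psi>" and q: "\<psi> < ereal q" and m: "\<And>n. 0 \<le> m n"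
  shows "\<forall>\<^sub>F n in sequentially. exp (- (q * real n)) \<le> m n"
proof -
  have "ereal (- q) < - \<psi>"
    using q by (simp add: ereal_less_uminus_reorder)
  with lim have "\<forall>\<^sub>F n in sequentially. ereal (- q) < elog (m n) / ereal (real n)"
    by (rule order_tendstoD(1))
  then show ?thesis
    using eventually_gt_at_top[of 0]
  proof eventually_elim
    case (elim n)
    have "m n \<noteq> 0"
      using elim by (auto simp: elog_def)
    then have "- q < ln (m n) / real n"
      using elim by (simp add: elog_def)
    then have "- (q * real n) < ln (m n)"
      using elim by (simp add: field_simps)
    then have "exp (- (q * real n)) < exp (ln (m n))"
      by simp
    then show ?case
      using \<open>m n \<noteq> 0\<close> m[of n] by simp
  qed
qed

text \<open>Along the segment from \<open>x\<close> to \<open>z\<close>, convexity keeps \<open>f\<close> below a chord that starts at \<open>f x\<close>. For the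
  rate functions this gives a threshold beyond the limit of the statistic with almost the same rate.\<close>

lemma ereal_convex_near:
  assumes conv: "ereal_convex f" and nn: "\<And>x. 0 \<le> f x"
    and fx: "f x < ereal q" and fz: "f z < \<infinity>"
    and ev: "\<forall>\<^sub>F y in nhds x. Pr y"
  shows "\<exists>t. 0 < t \<and> t < 1 \<and> f (x + t * (z - x)) < ereal q \<and> Pr (x + t * (z - x))"
proof -
  obtain p where p: "f x = ereal p"
    using fx nn[of x] by (cases "f x") auto
  obtain w where w: "f z = ereal w"
    using fz nn[of z] by (cases "f z") auto
  have "((\<lambda>t. (1 - t) * p + t * w) \<longlongrightarrow> (1 - 0) * p + 0 * w) (at_right 0)"
    by (intro tendsto_intros)
  then have "\<forall>\<^sub>F t in at_right 0. (1 - t) * p + t * w < q"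
    by (rule order_tendstoD) (use fx p in simp)
  moreover have "((\<lambda>t. x + t * (z - x)) \<longlongrightarrow> x + 0 * (z - x)) (at_right 0)"
    by (intro tendsto_intros)
  then have "\<forall>\<^sub>F t in at_right 0. Pr (x + t * (z - x))"
    using eventually_compose_filterlim[OF ev] by simp
  moreover have "\<forall>\<^sub>F t::real in at_right 0. t \<in> {0<..<1}"
    by (rule eventually_at_right_real) simp
  ultimately have "\<forall>\<^sub>F t in at_right 0. (1 - t) * p + t * w < q \<and> Pr (x + t * (z - x)) \<and> t \<in> {0<..<1}"
    by eventually_elim blast
  then obtain t where t: "(1 - t) * p + t * w < q" "Pr (x + t * (z - x))" "0 < t" "t < 1"
    using eventually_happens'[OF trivial_limit_at_right_real] by fastforce
  have "f ((1 - t) * x + t * z) \<le> ereal (1 - t) * f x + ereal t * f z"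
    using conv t unfolding ereal_convex_def by blast
  also have "\<dots> < ereal q"
    using t p w by simp
  also have "(1 - t) * x + t * z = x + t * (z - x)"
    by (simp add: algebra_simps)
  finally show ?thesis
    using t by blast
qed

lemma lower_semicont_eventually_gt:
  "lower_semicont f \<Longrightarrow> c < f x \<Longrightarrow> \<forall>\<^sub>F y in at x. c < f y"
  unfolding lower_semicont_def using less_LiminfD[of c "at x" f] order_less_le_trans by blast

section \<open>Log-likelihood ratios under the two hypotheses\<close>

context multistage_setting
begin

abbreviation \<F> :: "enat \<Rightarrow> 'w measure" where
  "\<F> \<equiv> obs_filt (space P0) S X"

lemma space_P1: "space P1 = space P0"
  using sets_eq by (rule sets_eq_imp_space_eq)

lemma sets_obs_filt_le: "sets (\<F> t) \<subseteq> sets P0"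
  unfolding obs_filt_def using X_measurable
  by (subst sets_measure_of) (auto intro!: sets.sigma_sets_subset measurable_sets)

lemma space_obs_filt: "space (\<F> t) = space P0"
  by (rule filtration.space_F[OF filtration_obs_filt])

lemma subalgebra_obs_filt: "subalgebra P0 (\<F> t)" "subalgebra P1 (\<F> t)"
  using sets_obs_filt_le[of t] by (auto simp: subalgebra_def space_obs_filt space_P1 sets_eq)

lemma LLR_measurable: "LLR P0 P1 S X n \<in> borel_measurable (\<F> (enat n))"
proof -
  have "RN_deriv (restr_to_subalg P0 (\<F> n)) (restr_to_subalg P1 (\<F> n)) \<in> borel_measurable (restr_to_subalg P0 (\<F> n))"
    by simp
  also have "borel_measurable (restr_to_subalg P0 (\<F> n)) = borel_measurable (\<F> (enat n))"
    by (rule measurable_cong_sets[OF sets_restr_to_subalg[OF subalgebra_obs_filt(1)] refl])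
  finally have [measurable]: "RN_deriv (restr_to_subalg P0 (\<F> n)) (restr_to_subalg P1 (\<F> n)) \<in> borel_measurable (\<F> (enat n))" .
  show ?thesis
    unfolding LLR_def Let_def by measurable
qed

lemma
  assumes n: "1 \<le> n" and A: "A \<in> sets (\<F> (enat n))"
  shows change_of_measure_le: "(\<And>\<omega>. \<omega> \<in> A \<Longrightarrow> LLR P0 P1 S X n \<omega> \<le> x) \<Longrightarrow> measure P1 A \<le> exp x * measure P0 A"
    and change_of_measure_ge: "(\<And>\<omega>. \<omega> \<in> A \<Longrightarrow> x \<le> LLR P0 P1 S X n \<omega>) \<Longrightarrow> measure P0 A \<le> exp (- x) * measure P1 A"
proof -
  define M where "M = restr_to_subalg P0 (\<F> (enat n))"
  define N where "N = restr_to_subalg P1 (\<F> (enat n))"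
  define f where "f = RN_deriv M N"
  have subM: "sets M = sets (\<F> n)" and subN: "sets N = sets (\<F> n)"
    unfolding M_def N_def by (rule sets_restr_to_subalg[OF subalgebra_obs_filt(1)], rule sets_restr_to_subalg[OF subalgebra_obs_filt(2)])
  interpret M: prob_space M
    unfolding M_def by (rule prob_space_restr_to_subalg[OF subalgebra_obs_filt(1) P0.prob_space_axioms])
  interpret N: prob_space N
    unfolding N_def by (rule prob_space_restr_to_subalg[OF subalgebra_obs_filt(2) P1.prob_space_axioms])
  have ac: "absolutely_continuous M N" "absolutely_continuous N M"
    using abs_cont[OF n] by (auto simp: M_def N_def)
  have sNM: "sets N = sets M" by (simp add: subM subN)
  have dens: "density M f = N"
    unfolding f_def by (rule M.density_RN_deriv[OF ac(1) sNM])
  have fm[measurable]: "f \<in> borel_measurable M"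
    unfolding f_def by simp
  have AM[measurable]: "A \<in> sets M" using A by (simp add: subM)
  have emM: "emeasure M B = emeasure P0 B" and emN: "emeasure N B = emeasure P1 B" if "B \<in> sets M" for B
    using emeasure_restr_to_subalg[OF subalgebra_obs_filt(1), of B "enat n"]
      emeasure_restr_to_subalg[OF subalgebra_obs_filt(2), of B "enat n"] that
    by (simp_all add: M_def[symmetric] N_def[symmetric] subM)
  have N: "emeasure P1 A = (\<integral>\<^sup>+\<omega>. f \<omega> * indicator A \<omega> \<partial>M)"
    using emN[OF AM] emeasure_density[OF fm AM] by (simp add: dens)
  have finf: "AE \<omega> in M. f \<omega> \<noteq> \<infinity>"
    unfolding f_def using N.sigma_finite_measure_axioms ac(1) sNM by (rule M.RN_deriv_finite)
  have LLR: "LLR P0 P1 S X n \<omega> = ln (enn2real (f \<omega>))" for \<omega>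
    by (simp add: LLR_def Let_def f_def M_def N_def)
  show "measure P1 A \<le> exp x * measure P0 A" if le: "\<And>\<omega>. \<omega> \<in> A \<Longrightarrow> LLR P0 P1 S X n \<omega> \<le> x"
  proof -
    have "emeasure P1 A \<le> (\<integral>\<^sup>+\<omega>. ennreal (exp x) * indicator A \<omega> \<partial>M)"
      unfolding N
    proof (rule nn_integral_mono_AE)
      show "AE \<omega> in M. f \<omega> * indicator A \<omega> \<le> ennreal (exp x) * indicator A \<omega>"
        using finf
      proof eventually_elim
        case (elim \<omega>)
        then obtain u where u: "f \<omega> = ennreal u" "0 \<le> u"
          by (cases "f \<omega>") auto
        have "u \<le> exp x" if "\<omega> \<in> A"
        proof (cases "u = 0")
          case False
          then have "ln u \<le> x"
            using le[OF that] u by (simp add: LLR)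
          then have "exp (ln u) \<le> exp x" by simp
          then show ?thesis using False u by simp
        qed simp
        then show ?case
          using u by (auto simp: indicator_def intro: ennreal_leI)
      qed
    qed
    also have "\<dots> = ennreal (exp x) * emeasure P0 A"
      by (simp add: nn_integral_cmult_indicator emM)
    finally show ?thesis
      by (simp add: P0.emeasure_eq_measure P1.emeasure_eq_measure ennreal_mult'[symmetric])
  qed
  show "measure P0 A \<le> exp (- x) * measure P1 A" if ge: "\<And>\<omega>. \<omega> \<in> A \<Longrightarrow> x \<le> LLR P0 P1 S X n \<omega>"
  proof -
    \<comment> \<open>The density is positive almost everywhere, because \<open>P0\<close> is absolutely continuous with respect to \<open>P1\<close>.\<close>
    have Z[measurable]: "{\<omega> \<in> space M. f \<omega> = 0} \<in> sets M"
      by measurable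
    have "emeasure N {\<omega> \<in> space M. f \<omega> = 0} = (\<integral>\<^sup>+\<omega>. f \<omega> * indicator {\<omega> \<in> space M. f \<omega> = 0} \<omega> \<partial>M)"
      using emeasure_density[OF fm Z] by (simp add: dens)
    also have "\<dots> = (\<integral>\<^sup>+\<omega>. 0 \<partial>M)"
      by (intro nn_integral_cong) (auto simp: indicator_def)
    finally have "{\<omega> \<in> space M. f \<omega> = 0} \<in> null_sets N"
      using Z sNM by (auto simp: null_sets_def)
    then have "{\<omega> \<in> space M. f \<omega> = 0} \<in> null_sets M"
      using ac(2) by (auto simp: absolutely_continuous_def)
    then have fpos: "AE \<omega> in M. f \<omega> \<noteq> 0"
      using AE_not_in by fastforce
    have "ennreal (exp x) * emeasure P0 A = (\<integral>\<^sup>+\<omega>. ennreal (exp x) * indicator A \<omega> \<partial>M)"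
      by (simp add: nn_integral_cmult_indicator emM)
    also have "\<dots> \<le> emeasure P1 A"
      unfolding N
    proof (rule nn_integral_mono_AE)
      show "AE \<omega> in M. ennreal (exp x) * indicator A \<omega> \<le> f \<omega> * indicator A \<omega>"
        using finf fpos
      proof eventually_elim
        case (elim \<omega>)
        then obtain u where u: "f \<omega> = ennreal u" "0 < u"
          by (cases "f \<omega>") (auto simp: less_le)
        have "exp x \<le> u" if "\<omega> \<in> A"
        proof -
          have "x \<le> ln u"
            using ge[OF that] u by (simp add: LLR)
          then have "exp x \<le> exp (ln u)" by simp
          then show ?thesis using u by simp
        qed
        then show ?case
          using u by (auto simp: indicator_def intro: ennreal_leI)
      qed
    qed
    finally have "exp x * measure P0 A \<le> measure P1 A"
      by (simp add: P0.emeasure_eq_measure P1.emeasure_eq_measure ennreal_mult'[symmetric])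
    then show ?thesis
      by (simp add: exp_minus field_simps)
  qed
qed

text \<open>The instance in which the time is averaged under \<open>P1\<close> and the right decision is to reject.\<close>

lemma likelihood_side1: "likelihood_side P1 P0 \<F> (LLR P0 P1 S X) I1"
proof (intro likelihood_side.intro likelihood_side_axioms.intro)
  show "AE \<omega> in P1. (\<lambda>n. LLR P0 P1 S X n \<omega> / real n) \<longlonglongrightarrow> I1"
    using LLR_lim1 by (simp add: avg_LLR_def)
  fix \<epsilon> :: real assume "0 < \<epsilon>"
  show "summable (\<lambda>n. measure P1 {\<omega> \<in> space P1. LLR P0 P1 S X (Suc n) \<omega> / real (Suc n) < I1 - \<epsilon>})"
  proof (rule summable_comparison_test'[OF LLR_summable1[OF \<open>0 < \<epsilon>\<close>], of 0])
    fix n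
    have "{\<omega> \<in> space P0. LLR P0 P1 S X (Suc n) \<omega> / real (Suc n) \<le> I1 - \<epsilon>} \<in> sets (\<F> (enat (Suc n)))"
      using borel_measurable_le[OF borel_measurable_divide[OF LLR_measurable borel_measurable_const] borel_measurable_const]
      by (simp add: space_obs_filt)
    then have "{\<omega> \<in> space P1. LLR P0 P1 S X (Suc n) \<omega> / real (Suc n) \<le> I1 - \<epsilon>} \<in> sets P1"
      using sets_obs_filt_le by (auto simp: space_P1 sets_eq)
    then show "norm (measure P1 {\<omega> \<in> space P1. LLR P0 P1 S X (Suc n) \<omega> / real (Suc n) < I1 - \<epsilon>}) \<le>
        measure P1 {\<omega> \<in> space P1. avg_LLR P0 P1 S X (Suc n) \<omega> \<le> I1 - \<epsilon>}"
      unfolding avg_LLR_def by (auto intro!: P1.finite_measure_mono)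
  qed
qed (use filtration_obs_filt sets_obs_filt_le LLR_measurable I_pos sets_eq
    in \<open>auto simp: space_P1 intro: change_of_measure_le change_of_measure_ge P0.prob_space_axioms P1.prob_space_axioms\<close>)

text \<open>The mirror image: the sign of the log-likelihood ratio changes, and the two change-of-measure
  inequalities exchange their roles.\<close>

lemma likelihood_side0: "likelihood_side P0 P1 \<F> (\<lambda>n \<omega>. - LLR P0 P1 S X n \<omega>) I0"
proof (intro likelihood_side.intro likelihood_side_axioms.intro)
  show "AE \<omega> in P0. (\<lambda>n. - LLR P0 P1 S X n \<omega> / real n) \<longlonglongrightarrow> I0"
    using LLR_lim0
  proof eventually_elim
    case (elim \<omega>)
    from tendsto_minus[OF this] show ?case by (simp add: avg_LLR_def)
  qed
  fix \<epsilon> :: real assume "0 < \<epsilon>"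
  have "{\<omega> \<in> space P0. - LLR P0 P1 S X (Suc n) \<omega> / real (Suc n) < I0 - \<epsilon>} =
      {\<omega> \<in> space P0. avg_LLR P0 P1 S X (Suc n) \<omega> > - I0 + \<epsilon>}" for n
    unfolding avg_LLR_def by (auto simp: minus_divide_left[symmetric])
  then show "summable (\<lambda>n. measure P0 {\<omega> \<in> space P0. - LLR P0 P1 S X (Suc n) \<omega> / real (Suc n) < I0 - \<epsilon>})"
    using LLR_summable0[OF \<open>0 < \<epsilon>\<close>] by simp
next
  fix n :: nat and A x
  assume *: "1 \<le> n" "A \<in> sets (\<F> (enat n))"
  show "measure P0 A \<le> exp x * measure P1 A" if "\<And>\<omega>. \<omega> \<in> A \<Longrightarrow> - LLR P0 P1 S X n \<omega> \<le> x"
    using change_of_measure_ge[OF *, of "- x"] that by (simp add: minus_le_iff)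
  show "measure P1 A \<le> exp (- x) * measure P0 A" if "\<And>\<omega>. \<omega> \<in> A \<Longrightarrow> x \<le> - LLR P0 P1 S X n \<omega>"
    using change_of_measure_le[OF *, of "- x"] that by (simp add: le_minus_iff)
qed (use filtration_obs_filt sets_obs_filt_le LLR_measurable I_pos sets_eq
    in \<open>auto intro: P0.prob_space_axioms P1.prob_space_axioms\<close>)

end

section \<open>Large deviations of the test statistic\<close>

locale multistage_setting_N = multistage_setting +
  assumes N: "condition_N P0 P1 T J0 J1 \<psi>0 \<psi>1"
begin

definition p0 :: real where "p0 = real_of_ereal (\<psi>0 J1)"
definition p1 :: real where "p1 = real_of_ereal (\<psi>1 J0)"

lemma p0: "\<psi>0 J1 = ereal p0" "0 < p0"
proof -
  have "\<psi>0 J0 < \<psi>0 J1"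
    using \<psi>0_mono(2) J_less by (auto simp: strict_mono_on_def)
  then show "\<psi>0 J1 = ereal p0" "0 < p0"
    using \<psi>_finite(1)[of J1] J_less \<psi>0_mono(1) by (cases "\<psi>0 J1"; simp add: p0_def)+
qed

lemma p1: "\<psi>1 J0 = ereal p1" "0 < p1"
proof -
  have "\<psi>1 J1 < \<psi>1 J0"
    using \<psi>1_mono(2) J_less by (auto simp: monotone_on_def)
  then show "\<psi>1 J0 = ereal p1" "0 < p1"
    using \<psi>_finite(2)[of J0] J_less \<psi>1_mono(1) by (cases "\<psi>1 J0"; simp add: p1_def)+
qed

lemma T_gt_sets: "1 \<le> n \<Longrightarrow> {\<omega> \<in> space P0. \<kappa> < T n \<omega>} \<in> sets (\<F> (enat n))"
  using borel_measurable_less[OF borel_measurable_const T_measurable, of n \<kappa>] by (simp add: space_obs_filt)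

lemma T_le_sets: "1 \<le> n \<Longrightarrow> {\<omega> \<in> space P0. T n \<omega> \<le> \<kappa>} \<in> sets (\<F> (enat n))"
  using borel_measurable_le[OF T_measurable borel_measurable_const, of n \<kappa>] by (simp add: space_obs_filt)

lemma T_gt_vanishes:
  assumes "J1 < y"
  shows "(\<lambda>n. measure P1 {\<omega> \<in> space P0. y < T n \<omega>}) \<longlonglongrightarrow> 0"
proof (rule LIMSEQ_imp_Suc, rule P1.prob_tendsto_zero_if_AE_escape)
  show "{\<omega> \<in> space P0. y < T (Suc n) \<omega>} \<in> P1.events" for n
    using T_gt_sets[of "Suc n" y] sets_obs_filt_le sets_eq by auto
  show "AE \<omega> in P1. \<forall>\<^sub>F n in sequentially. \<omega> \<notin> {\<omega> \<in> space P0. y < T (Suc n) \<omega>}"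
    using T_lim1
  proof eventually_elim
    case (elim \<omega>)
    then have "(\<lambda>n. T (Suc n) \<omega>) \<longlonglongrightarrow> J1" by (rule LIMSEQ_Suc)
    then have "\<forall>\<^sub>F n in sequentially. T (Suc n) \<omega> < y"
      using assms by (rule order_tendstoD(2))
    then show ?case by eventually_elim simp
  qed
qed

lemma T_le_vanishes:
  assumes "y < J0"
  shows "(\<lambda>n. measure P0 {\<omega> \<in> space P0. T n \<omega> \<le> y}) \<longlonglongrightarrow> 0"
proof (rule LIMSEQ_imp_Suc, rule P0.prob_tendsto_zero_if_AE_escape)
  show "{\<omega> \<in> space P0. T (Suc n) \<omega> \<le> y} \<in> P0.events" for n
    using T_le_sets[of "Suc n" y] sets_obs_filt_le by auto
  show "AE \<omega> in P0. \<forall>\<^sub>F n in sequentially. \<omega> \<notin> {\<omega> \<in> space P0. T (Suc n) \<omega> \<le> y}"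
    using T_lim0
  proof eventually_elim
    case (elim \<omega>)
    then have "(\<lambda>n. T (Suc n) \<omega>) \<longlonglongrightarrow> J0" by (rule LIMSEQ_Suc)
    then have "\<forall>\<^sub>F n in sequentially. y < T (Suc n) \<omega>"
      using assms by (rule order_tendstoD(1))
    then show ?case by eventually_elim simp
  qed
qed

lemma rates_between:
  assumes "\<kappa> \<in> {J0<..<J1}"
  shows "ereal r < \<psi>0 \<kappa> \<Longrightarrow>
      \<forall>\<^sub>F n in sequentially. measure P0 {\<omega> \<in> space P0. \<kappa> < T n \<omega>} \<le> exp (- (r * real n))"
    and "ereal s < \<psi>1 \<kappa> \<Longrightarrow>
      \<forall>\<^sub>F n in sequentially. measure P1 {\<omega> \<in> space P0. T n \<omega> \<le> \<kappa>} \<le> exp (- (s * real n))"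
  using elog_rate_upper[OF LD0[OF assms, unfolded LD0_def], of r]
    elog_rate_upper[OF LD1[OF assms, unfolded LD1_def], of s] by (simp_all add: space_P1)

text \<open>Lower semicontinuity makes the rate \<open>\<psi>0 \<kappa>\<close> almost \<open>\<psi>0 J1\<close> for \<open>\<kappa>\<close> slightly below \<open>J1\<close>, while strict
  monotonicity keeps \<open>\<psi>1 \<kappa>\<close> positive.\<close>

lemma ex_threshold_near_J1:
  assumes "r < p0"
  shows "\<exists>\<kappa> s. \<kappa> \<in> {J0<..<J1} \<and> ereal r < \<psi>0 \<kappa> \<and> 0 < s \<and> ereal s < \<psi>1 \<kappa>"
proof -
  have "\<forall>\<^sub>F \<kappa> in at J1. ereal r < \<psi>0 \<kappa>"
    using \<psi>_lsc(1) assms by (intro lower_semicont_eventually_gt) (simp_all add: p0)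
  then have "\<forall>\<^sub>F \<kappa> in at_left J1. ereal r < \<psi>0 \<kappa>"
    by (rule filter_leD[OF at_le, rotated]) simp
  moreover have "\<forall>\<^sub>F \<kappa> in at_left J1. \<kappa> \<in> {J0<..<J1}"
    using J_less by (rule eventually_at_left_real)
  ultimately have "\<forall>\<^sub>F \<kappa> in at_left J1. ereal r < \<psi>0 \<kappa> \<and> \<kappa> \<in> {J0<..<J1}"
    by (rule eventually_conj)
  then obtain \<kappa> where \<kappa>: "ereal r < \<psi>0 \<kappa>" "\<kappa> \<in> {J0<..<J1}"
    using eventually_happens'[OF trivial_limit_at_left_real] by blast
  have "\<psi>1 J1 < \<psi>1 \<kappa>"
    using \<psi>1_mono(2) \<kappa> by (auto simp: monotone_on_def)
  then obtain s where "\<psi>1 J1 < ereal s" "ereal s < \<psi>1 \<kappa>"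
    using ereal_dense2 by blast
  then show ?thesis
    using \<kappa> \<psi>1_mono(1) by auto
qed

lemma ex_threshold_near_J0:
  assumes "r < p1"
  shows "\<exists>\<kappa> s. \<kappa> \<in> {J0<..<J1} \<and> ereal r < \<psi>1 \<kappa> \<and> 0 < s \<and> ereal s < \<psi>0 \<kappa>"
proof -
  have "\<forall>\<^sub>F \<kappa> in at J0. ereal r < \<psi>1 \<kappa>"
    using \<psi>_lsc(2) assms by (intro lower_semicont_eventually_gt) (simp_all add: p1)
  then have "\<forall>\<^sub>F \<kappa> in at_right J0. ereal r < \<psi>1 \<kappa>"
    by (rule filter_leD[OF at_le, rotated]) simp
  moreover have "\<forall>\<^sub>F \<kappa> in at_right J0. \<kappa> \<in> {J0<..<J1}"
    using J_less by (rule eventually_at_right_real)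
  ultimately have "\<forall>\<^sub>F \<kappa> in at_right J0. ereal r < \<psi>1 \<kappa> \<and> \<kappa> \<in> {J0<..<J1}"
    by (rule eventually_conj)
  then obtain \<kappa> where \<kappa>: "ereal r < \<psi>1 \<kappa>" "\<kappa> \<in> {J0<..<J1}"
    using eventually_happens'[OF trivial_limit_at_right_real] by blast
  have "\<psi>0 J0 < \<psi>0 \<kappa>"
    using \<psi>0_mono(2) \<kappa> by (auto simp: strict_mono_on_def)
  then obtain s where "\<psi>0 J0 < ereal s" "ereal s < \<psi>0 \<kappa>"
    using ereal_dense2 by blast
  then show ?thesis
    using \<kappa> \<psi>0_mono(1) by auto
qed

text \<open>\<open>exp_lower\<close> is obtained by comparison with a threshold \<open>y\<close> slightly above \<open>J1\<close>. An event that is not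
  negligible under \<open>P1\<close> has its threshold below \<open>y\<close>, because \<open>T n\<close> converges to \<open>J1\<close>; hence it contains
  the event with threshold \<open>y\<close>, whose probability under \<open>P0\<close> decays at a rate close to \<open>\<psi>0 J1\<close>.\<close>

lemma design_side1: "design_side P1 P0 \<F> (LLR P0 P1 S X) I1 (\<lambda>n \<kappa>. {\<omega> \<in> space P0. \<kappa> < T n \<omega>}) p0"
proof (intro design_side.intro design_side_axioms.intro likelihood_side1 p0(2))
  show "{\<omega> \<in> space P0. \<kappa> < T n \<omega>} \<in> sets (\<F> (enat n))" if "1 \<le> n" for n \<kappa>
    by (rule T_gt_sets[OF that])
next
  fix r assume "r < p0"
  then obtain \<kappa> s where \<kappa>: "\<kappa> \<in> {J0<..<J1}" "ereal r < \<psi>0 \<kappa>" "0 < s" "ereal s < \<psi>1 \<kappa>"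
    using ex_threshold_near_J1 by blast
  have compl: "space P1 - {\<omega> \<in> space P0. \<kappa> < T n \<omega>} = {\<omega> \<in> space P0. T n \<omega> \<le> \<kappa>}" for n
    by (auto simp: space_P1)
  show "\<exists>\<kappa> s. 0 < s \<and> (\<forall>\<^sub>F n in sequentially. measure P0 {\<omega> \<in> space P0. \<kappa> < T n \<omega>} \<le> exp (- (r * real n)) \<and>
      measure P1 (space P1 - {\<omega> \<in> space P0. \<kappa> < T n \<omega>}) \<le> exp (- (s * real n)))"
    using rates_between(1)[OF \<kappa>(1,2)] rates_between(2)[OF \<kappa>(1,4)] \<kappa>(3)
    by (intro exI[of _ \<kappa>] exI[of _ s] conjI) (auto simp: compl intro: eventually_conj)
next
  fix q \<eta> :: real assume "p0 < q" "0 < \<eta>"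
  have nh: "\<forall>\<^sub>F \<kappa> in nhds J1. \<psi>0 \<kappa> < \<infinity> \<and> LD0 P0 T \<psi>0 \<kappa>"
    using N by (simp add: condition_N_def)
  then obtain e where e: "0 < e" "\<And>\<kappa>. dist \<kappa> J1 < e \<Longrightarrow> \<psi>0 \<kappa> < \<infinity>"
    unfolding eventually_nhds_metric by blast
  have "\<psi>0 (J1 + e / 2) < \<infinity>"
    using e(1) by (intro e(2)) (simp add: dist_real_def)
  then obtain t where t: "0 < t" "\<psi>0 (J1 + t * ((J1 + e / 2) - J1)) < ereal q"
      "LD0 P0 T \<psi>0 (J1 + t * ((J1 + e / 2) - J1))"
    using ereal_convex_near[OF \<psi>_convex(1) \<psi>_nonneg(1), of J1 q "J1 + e / 2", OF _ _ nh] \<open>p0 < q\<close>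
    by (auto simp: p0)
  define y where "y = J1 + t * ((J1 + e / 2) - J1)"
  have "J1 < y" using t(1) e(1) by (simp add: y_def)
  have "\<forall>\<^sub>F n in sequentially. exp (- (q * real n)) \<le> measure P0 {\<omega> \<in> space P0. y < T n \<omega>}"
    using elog_rate_lower[OF t(3)[folded y_def, unfolded LD0_def] t(2)[folded y_def]] by simp
  moreover have "\<forall>\<^sub>F n in sequentially. measure P1 {\<omega> \<in> space P0. y < T n \<omega>} < \<eta>"
    using T_gt_vanishes[OF \<open>J1 < y\<close>] \<open>0 < \<eta>\<close> by (rule order_tendstoD(2))
  ultimately show "\<forall>\<^sub>F n in sequentially. \<forall>\<kappa>. \<eta> < measure P1 {\<omega> \<in> space P0. \<kappa> < T n \<omega>} \<longrightarrow>
      exp (- (q * real n)) \<le> measure P0 {\<omega> \<in> space P0. \<kappa> < T n \<omega>}"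
    using eventually_ge_at_top[of 1]
  proof eventually_elim
    case (elim n)
    show ?case
    proof (intro allI impI)
      fix \<kappa> assume \<eta>: "\<eta> < measure P1 {\<omega> \<in> space P0. \<kappa> < T n \<omega>}"
      have sets: "{\<omega> \<in> space P0. z < T n \<omega>} \<in> sets P0" for z
        using T_gt_sets[OF elim(3), of z] sets_obs_filt_le by blast
      have "\<kappa> < y"
      proof (rule ccontr)
        assume "\<not> \<kappa> < y"
        then have "measure P1 {\<omega> \<in> space P0. \<kappa> < T n \<omega>} \<le> measure P1 {\<omega> \<in> space P0. y < T n \<omega>}"
          using sets by (intro P1.finite_measure_mono) (auto simp: sets_eq)
        then show False using \<eta> elim by simp
      qed
      then have "measure P0 {\<omega> \<in> space P0. y < T n \<omega>} \<le> measure P0 {\<omega> \<in> space P0. \<kappa> < T n \<omega>}"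
        using sets by (intro P0.finite_measure_mono) auto
      then show "exp (- (q * real n)) \<le> measure P0 {\<omega> \<in> space P0. \<kappa> < T n \<omega>}"
        using elim by simp
    qed
  qed
qed

lemma design_side0:
  "design_side P0 P1 \<F> (\<lambda>n \<omega>. - LLR P0 P1 S X n \<omega>) I0 (\<lambda>n \<kappa>. {\<omega> \<in> space P0. T n \<omega> \<le> \<kappa>}) p1"
proof (intro design_side.intro design_side_axioms.intro likelihood_side0 p1(2))
  show "{\<omega> \<in> space P0. T n \<omega> \<le> \<kappa>} \<in> sets (\<F> (enat n))" if "1 \<le> n" for n \<kappa>
    by (rule T_le_sets[OF that])
next
  fix r assume "r < p1"
  then obtain \<kappa> s where \<kappa>: "\<kappa> \<in> {J0<..<J1}" "ereal r < \<psi>1 \<kappa>" "0 < s" "ereal s < \<psi>0 \<kappa>"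
    using ex_threshold_near_J0 by blast
  have compl: "space P0 - {\<omega> \<in> space P0. T n \<omega> \<le> \<kappa>} = {\<omega> \<in> space P0. \<kappa> < T n \<omega>}" for n
    by auto
  show "\<exists>\<kappa> s. 0 < s \<and> (\<forall>\<^sub>F n in sequentially. measure P1 {\<omega> \<in> space P0. T n \<omega> \<le> \<kappa>} \<le> exp (- (r * real n)) \<and>
      measure P0 (space P0 - {\<omega> \<in> space P0. T n \<omega> \<le> \<kappa>}) \<le> exp (- (s * real n)))"
    using rates_between(2)[OF \<kappa>(1,2)] rates_between(1)[OF \<kappa>(1,4)] \<kappa>(3)
    by (intro exI[of _ \<kappa>] exI[of _ s] conjI) (auto simp: compl intro: eventually_conj)
next
  fix q \<eta> :: real assume "p1 < q" "0 < \<eta>"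
  have nh: "\<forall>\<^sub>F \<kappa> in nhds J0. \<psi>1 \<kappa> < \<infinity> \<and> LD1 P1 T \<psi>1 \<kappa>"
    using N by (simp add: condition_N_def)
  then obtain e where e: "0 < e" "\<And>\<kappa>. dist \<kappa> J0 < e \<Longrightarrow> \<psi>1 \<kappa> < \<infinity>"
    unfolding eventually_nhds_metric by blast
  have "\<psi>1 (J0 - e / 2) < \<infinity>"
    using e(1) by (intro e(2)) (simp add: dist_real_def)
  then obtain t where t: "0 < t" "\<psi>1 (J0 + t * ((J0 - e / 2) - J0)) < ereal q"
      "LD1 P1 T \<psi>1 (J0 + t * ((J0 - e / 2) - J0))"
    using ereal_convex_near[OF \<psi>_convex(2) \<psi>_nonneg(2), of J0 q "J0 - e / 2", OF _ _ nh] \<open>p1 < q\<close>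
    by (auto simp: p1)
  define y where "y = J0 + t * ((J0 - e / 2) - J0)"
  have "y < J0" using t(1) e(1) by (simp add: y_def)
  have "\<forall>\<^sub>F n in sequentially. exp (- (q * real n)) \<le> measure P1 {\<omega> \<in> space P0. T n \<omega> \<le> y}"
    using elog_rate_lower[OF t(3)[folded y_def, unfolded LD1_def] t(2)[folded y_def]] by (simp add: space_P1)
  moreover have "\<forall>\<^sub>F n in sequentially. measure P0 {\<omega> \<in> space P0. T n \<omega> \<le> y} < \<eta>"
    using T_le_vanishes[OF \<open>y < J0\<close>] \<open>0 < \<eta>\<close> by (rule order_tendstoD(2))
  ultimately show "\<forall>\<^sub>F n in sequentially. \<forall>\<kappa>. \<eta> < measure P0 {\<omega> \<in> space P0. T n \<omega> \<le> \<kappa>} \<longrightarrow>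
      exp (- (q * real n)) \<le> measure P1 {\<omega> \<in> space P0. T n \<omega> \<le> \<kappa>}"
    using eventually_ge_at_top[of 1]
  proof eventually_elim
    case (elim n)
    show ?case
    proof (intro allI impI)
      fix \<kappa> assume \<eta>: "\<eta> < measure P0 {\<omega> \<in> space P0. T n \<omega> \<le> \<kappa>}"
      have sets: "{\<omega> \<in> space P0. T n \<omega> \<le> z} \<in> sets P0" for z
        using T_le_sets[OF elim(3), of z] sets_obs_filt_le by blast
      have "y < \<kappa>"
      proof (rule ccontr)
        assume "\<not> y < \<kappa>"
        then have "measure P0 {\<omega> \<in> space P0. T n \<omega> \<le> \<kappa>} \<le> measure P0 {\<omega> \<in> space P0. T n \<omega> \<le> y}"
          using sets by (intro P0.finite_measure_mono) auto
        then show False using \<eta> elim by simp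
      qed
      then have "measure P1 {\<omega> \<in> space P0. T n \<omega> \<le> y} \<le> measure P1 {\<omega> \<in> space P0. T n \<omega> \<le> \<kappa>}"
        using sets by (intro P1.finite_measure_mono) (auto simp: sets_eq)
      then show "exp (- (q * real n)) \<le> measure P1 {\<omega> \<in> space P0. T n \<omega> \<le> \<kappa>}"
        using elim by simp
    qed
  qed
qed

sublocale side1: design_side P1 P0 \<F> "LLR P0 P1 S X" I1 "\<lambda>n \<kappa>. {\<omega> \<in> space P0. \<kappa> < T n \<omega>}" p0
  by (rule design_side1)

sublocale side0: design_side P0 P1 \<F> "\<lambda>n \<omega>. - LLR P0 P1 S X n \<omega>" I0 "\<lambda>n \<kappa>. {\<omega> \<in> space P0. T n \<omega> \<le> \<kappa>}" p1
  by (rule design_side0)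

section \<open>Tests as seen from either hypothesis\<close>

lemma feasible_side1: "side1.feasible a b n \<kappa> \<longleftrightarrow> fss_feasible P0 P1 T a b n \<kappa>"
proof -
  have "space P1 - {\<omega> \<in> space P0. \<kappa> < T n \<omega>} = {\<omega> \<in> space P1. T n \<omega> \<le> \<kappa>}"
    by (auto simp: space_P1)
  then show ?thesis
    by (simp add: side1.feasible_def fss_feasible_def)
qed

lemma feasible_side0: "side0.feasible b a n \<kappa> \<longleftrightarrow> fss_feasible P0 P1 T a b n \<kappa>"
proof -
  have "space P0 - {\<omega> \<in> space P0. T n \<omega> \<le> \<kappa>} = {\<omega> \<in> space P0. \<kappa> < T n \<omega>}"
    by auto
  then show ?thesis
    by (auto simp: side0.feasible_def fss_feasible_def space_P1)
qed

lemma min_size_side1: "side1.min_size a b = nstar P0 P1 T a b"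
  by (simp add: side1.min_size_def nstar_def feasible_side1)

lemma min_size_side0: "side0.min_size b a = nstar P0 P1 T a b"
  by (simp add: side0.min_size_def nstar_def feasible_side0)

lemma expected_time_side1:
  "expected_time P1 (ms_test T A R N K) =
    (\<integral>\<^sup>+\<omega>. ennreal (real (staged_time (\<lambda>n \<kappa>. {\<omega> \<in> space P0. \<kappa> < T n \<omega>}) R A N \<omega>)) \<partial>P1)"
  unfolding expected_time_def
proof (rule nn_integral_cong)
  fix \<omega> assume "\<omega> \<in> space P1"
  then have "ms_time T A R N \<omega> = staged_time (\<lambda>n \<kappa>. {\<omega> \<in> space P0. \<kappa> < T n \<omega>}) R A N \<omega>"
    unfolding ms_time_def staged_time_def accepts_def rejects_def
    by (intro arg_cong[where f = Least] ext) (auto simp: space_P1 not_less)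
  then show "ennreal_of_enat (fst (ms_test T A R N K) \<omega>) =
      ennreal (real (staged_time (\<lambda>n \<kappa>. {\<omega> \<in> space P0. \<kappa> < T n \<omega>}) R A N \<omega>))"
    by (simp add: ms_test_def ennreal_of_nat_eq_real_of_nat)
qed

lemma expected_time_side0:
  "expected_time P0 (ms_test T A R N K) =
    (\<integral>\<^sup>+\<omega>. ennreal (real (staged_time (\<lambda>n \<kappa>. {\<omega> \<in> space P0. T n \<omega> \<le> \<kappa>}) A R N \<omega>)) \<partial>P0)"
  unfolding expected_time_def
proof (rule nn_integral_cong)
  fix \<omega> assume "\<omega> \<in> space P0"
  then have "ms_time T A R N \<omega> = staged_time (\<lambda>n \<kappa>. {\<omega> \<in> space P0. T n \<omega> \<le> \<kappa>}) A R N \<omega>"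
    unfolding ms_time_def staged_time_def accepts_def rejects_def
    by (intro arg_cong[where f = Least] ext) (auto simp: not_le)
  then show "ennreal_of_enat (fst (ms_test T A R N K) \<omega>) =
      ennreal (real (staged_time (\<lambda>n \<kappa>. {\<omega> \<in> space P0. T n \<omega> \<le> \<kappa>}) A R N \<omega>))"
    by (simp add: ms_test_def ennreal_of_nat_eq_real_of_nat)
qed

text \<open>A test is determined, up to its values outside the space, by its stopping time and one decision event.
  This lemma and the next one pass between the two descriptions.\<close>

lemma is_test_decision_set:
  assumes "is_test (space P0) S X (\<tau>, d)"
  shows "stopping_time \<F> \<tau>" "\<forall>\<omega>\<in>space P0. 1 \<le> \<tau> \<omega>"
    "{\<omega> \<in> space P0. d \<omega> = i} \<in> sets (side0.pre_sigma \<tau>)" "\<And>\<omega>. \<omega> \<in> space P0 \<Longrightarrow> d \<omega> = 0 \<or> d \<omega> = 1"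
proof -
  show \<tau>: "stopping_time \<F> \<tau>" and "\<forall>\<omega>\<in>space P0. 1 \<le> \<tau> \<omega>"
    using assms by (auto simp: is_test_def)
  have d: "d \<in> side0.pre_sigma \<tau> \<rightarrow>\<^sub>M count_space {0, 1}"
    using assms by (simp add: is_test_def)
  have sp: "space (side0.pre_sigma \<tau>) = space P0"
    by (rule side0.space_pre_sigma)
  show "d \<omega> = 0 \<or> d \<omega> = 1" if "\<omega> \<in> space P0" for \<omega>
    using measurable_space[OF d, of \<omega>] that by (simp add: sp)
  have "d -` ({i} \<inter> {0, 1}) \<inter> space (side0.pre_sigma \<tau>) \<in> sets (side0.pre_sigma \<tau>)"
    using d by (rule measurable_sets) simp
  also have "d -` ({i} \<inter> {0, 1}) \<inter> space (side0.pre_sigma \<tau>) = {\<omega> \<in> space P0. d \<omega> = i}"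
    using measurable_space[OF d] by (auto simp: sp)
  finally show "{\<omega> \<in> space P0. d \<omega> = i} \<in> sets (side0.pre_sigma \<tau>)" .
qed

lemma is_test_of_set:
  assumes "stopping_time \<F> \<tau>" "\<forall>\<omega>\<in>space P0. 1 \<le> \<tau> \<omega>" "D \<in> sets (side0.pre_sigma \<tau>)"
  shows "is_test (space P0) S X (\<tau>, \<lambda>\<omega>. if \<omega> \<in> D then 1 else 0)"
    "is_test (space P0) S X (\<tau>, \<lambda>\<omega>. if \<omega> \<in> D then 0 else 1)"
  using assms unfolding is_test_def by (auto intro!: measurable_If_set)

lemma opt_time_side1: "opt_time P1 P0 P1 S X a b = side1.opt_mean a b"
  unfolding opt_time_def side1.opt_mean_def
proof (rule INF_eq)
  fix \<xi> assume "\<xi> \<in> test_class P0 P1 S X a b"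
  then obtain \<tau> d where \<xi>: "\<xi> = (\<tau>, d)" and t: "is_test (space P0) S X (\<tau>, d)"
    and e: "measure P0 {\<omega> \<in> space P0. d \<omega> = 1} \<le> a" "measure P1 {\<omega> \<in> space P1. d \<omega> = 0} \<le> b"
    by (auto simp: test_class_def)
  note D = is_test_decision_set[OF t]
  have "space P0 - {\<omega> \<in> space P0. d \<omega> = 1} = {\<omega> \<in> space P0. d \<omega> = 0}"
    using D(4) by fastforce
  then have "measure P1 (space P0 - {\<omega> \<in> space P0. d \<omega> = 1}) \<le> b"
    using e(2) by (simp add: space_P1)
  then show "\<exists>\<tau>\<in>{\<tau>. stopping_time \<F> \<tau> \<and> (\<forall>\<omega>\<in>space P1. 1 \<le> \<tau> \<omega>) \<and>
      (\<exists>D\<in>sets (filtration.pre_sigma (space P1) \<F> \<tau>). measure P0 D \<le> a \<and> measure P1 (space P1 - D) \<le> b)}.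
      (\<integral>\<^sup>+\<omega>. ennreal_of_enat (\<tau> \<omega>) \<partial>P1) \<le> expected_time P1 \<xi>"
    unfolding space_P1 using D(1,2) D(3)[of 1] e(1)
    by (intro bexI[of _ \<tau>]) (auto simp: \<xi> expected_time_def)
next
  fix \<tau> assume "\<tau> \<in> {\<tau>. stopping_time \<F> \<tau> \<and> (\<forall>\<omega>\<in>space P1. 1 \<le> \<tau> \<omega>) \<and>
      (\<exists>D\<in>sets (filtration.pre_sigma (space P1) \<F> \<tau>). measure P0 D \<le> a \<and> measure P1 (space P1 - D) \<le> b)}"
  then obtain D where t: "stopping_time \<F> \<tau>" "\<forall>\<omega>\<in>space P0. 1 \<le> \<tau> \<omega>" and D: "D \<in> sets (side0.pre_sigma \<tau>)"
    and e: "measure P0 D \<le> a" "measure P1 (space P0 - D) \<le> b"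
    by (auto simp: space_P1)
  have "D \<subseteq> space P0"
    using sets.sets_into_space[OF D] by (simp add: side0.space_pre_sigma)
  then have "{\<omega> \<in> space P0. (if \<omega> \<in> D then 1 else 0 :: nat) = 1} = D"
      "{\<omega> \<in> space P1. (if \<omega> \<in> D then 1 else 0 :: nat) = 0} = space P0 - D"
    by (auto simp: space_P1)
  then have "(\<tau>, \<lambda>\<omega>. if \<omega> \<in> D then 1 else 0) \<in> test_class P0 P1 S X a b"
    using is_test_of_set(1)[OF t D] e unfolding test_class_def by simp
  then show "\<exists>\<xi>\<in>test_class P0 P1 S X a b. expected_time P1 \<xi> \<le> (\<integral>\<^sup>+\<omega>. ennreal_of_enat (\<tau> \<omega>) \<partial>P1)"
    by (intro bexI[of _ "(\<tau>, \<lambda>\<omega>. if \<omega> \<in> D then 1 else 0)"]) (auto simp: expected_time_def)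
qed

lemma opt_time_side0: "opt_time P0 P0 P1 S X a b = side0.opt_mean b a"
  unfolding opt_time_def side0.opt_mean_def
proof (rule INF_eq)
  fix \<xi> assume "\<xi> \<in> test_class P0 P1 S X a b"
  then obtain \<tau> d where \<xi>: "\<xi> = (\<tau>, d)" and t: "is_test (space P0) S X (\<tau>, d)"
    and e: "measure P0 {\<omega> \<in> space P0. d \<omega> = 1} \<le> a" "measure P1 {\<omega> \<in> space P1. d \<omega> = 0} \<le> b"
    by (auto simp: test_class_def)
  note D = is_test_decision_set[OF t]
  have "space P0 - {\<omega> \<in> space P0. d \<omega> = 0} = {\<omega> \<in> space P0. d \<omega> = 1}"
    using D(4) by fastforce
  then have "measure P0 (space P0 - {\<omega> \<in> space P0. d \<omega> = 0}) \<le> a"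
    using e(1) by simp
  then show "\<exists>\<tau>\<in>{\<tau>. stopping_time \<F> \<tau> \<and> (\<forall>\<omega>\<in>space P0. 1 \<le> \<tau> \<omega>) \<and>
      (\<exists>D\<in>sets (side0.pre_sigma \<tau>). measure P1 D \<le> b \<and> measure P0 (space P0 - D) \<le> a)}.
      (\<integral>\<^sup>+\<omega>. ennreal_of_enat (\<tau> \<omega>) \<partial>P0) \<le> expected_time P0 \<xi>"
    using D(1,2) D(3)[of 0] e(2)
    by (intro bexI[of _ \<tau>]) (auto simp: \<xi> expected_time_def space_P1)
next
  fix \<tau> assume "\<tau> \<in> {\<tau>. stopping_time \<F> \<tau> \<and> (\<forall>\<omega>\<in>space P0. 1 \<le> \<tau> \<omega>) \<and>
      (\<exists>D\<in>sets (side0.pre_sigma \<tau>). measure P1 D \<le> b \<and> measure P0 (space P0 - D) \<le> a)}"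
  then obtain D where t: "stopping_time \<F> \<tau>" "\<forall>\<omega>\<in>space P0. 1 \<le> \<tau> \<omega>" and D: "D \<in> sets (side0.pre_sigma \<tau>)"
    and e: "measure P1 D \<le> b" "measure P0 (space P0 - D) \<le> a"
    by auto
  have "D \<subseteq> space P0"
    using sets.sets_into_space[OF D] by (simp add: side0.space_pre_sigma)
  then have "{\<omega> \<in> space P0. (if \<omega> \<in> D then 0 else 1 :: nat) = 1} = space P0 - D"
      "{\<omega> \<in> space P1. (if \<omega> \<in> D then 0 else 1 :: nat) = 0} = D"
    by (auto simp: space_P1)
  then have "(\<tau>, \<lambda>\<omega>. if \<omega> \<in> D then 0 else 1) \<in> test_class P0 P1 S X a b"
    using is_test_of_set(2)[OF t D] e unfolding test_class_def by simp
  then show "\<exists>\<xi>\<in>test_class P0 P1 S X a b. expected_time P0 \<xi> \<le> (\<integral>\<^sup>+\<omega>. ennreal_of_enat (\<tau> \<omega>) \<partial>P0)"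
    by (intro bexI[of _ "(\<tau>, \<lambda>\<omega>. if \<omega> \<in> D then 0 else 1)"]) (auto simp: expected_time_def)
qed

end

section \<open>Rescaled error levels\<close>

lemma abs_ln_div:
  fixes x c :: real
  assumes "0 < x" "x < 1" "1 \<le> c"
  shows "\<bar>ln (x / c)\<bar> = \<bar>ln x\<bar> + ln c"
  using assms by (simp add: ln_div)

lemma eventually_const_le_abs_ln:
  fixes x :: "nat \<Rightarrow> real"
  assumes "\<And>k. x k \<in> {0<..<1}" "x \<longlonglongrightarrow> 0"
  shows "\<forall>\<^sub>F k in sequentially. c \<le> \<bar>ln (x k)\<bar>"
proof -
  have "filterlim x (at_right 0) sequentially"
    using assms by (intro tendsto_imp_filterlim_at_right always_eventually) auto
  from filterlim_compose[OF filterlim_abs_ln_at_right_0 this] show ?thesis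
    by (simp add: filterlim_at_top)
qed

lemma abs_ln_div_asymp:
  fixes x :: "nat \<Rightarrow> real"
  assumes x: "\<And>k. x k \<in> {0<..<1}" "x \<longlonglongrightarrow> 0" and c: "1 \<le> c" and "0 < p"
  shows "(\<lambda>k. \<bar>ln (x k / c)\<bar> / p) \<sim>[sequentially] (\<lambda>k. \<bar>ln (x k)\<bar> / p)"
proof (rule asymp_equiv_if_squeezed)
  have eq: "\<bar>ln (x k / c)\<bar> = \<bar>ln (x k)\<bar> + ln c" for k
    using x(1)[of k] c by (intro abs_ln_div) auto
  show "\<forall>\<^sub>F k in sequentially. 0 < \<bar>ln (x k)\<bar> / p"
    using x \<open>0 < p\<close> by (intro always_eventually) (auto simp: less_imp_neq)
  fix \<epsilon> :: real assume \<epsilon>: "0 < \<epsilon>" "\<epsilon> < 1"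
  have "(1 - \<epsilon>) * (\<bar>ln (x k)\<bar> / p) \<le> \<bar>ln (x k / c)\<bar> / p" for k
  proof -
    have "(1 - \<epsilon>) * \<bar>ln (x k)\<bar> \<le> 1 * \<bar>ln (x k)\<bar>"
      using \<epsilon> by (intro mult_right_mono) auto
    also have "\<dots> \<le> \<bar>ln (x k / c)\<bar>"
      using c by (simp add: eq)
    finally show ?thesis
      using \<open>0 < p\<close> by (simp add: divide_right_mono)
  qed
  then show "\<forall>\<^sub>F k in sequentially. (1 - \<epsilon>) * (\<bar>ln (x k)\<bar> / p) \<le> \<bar>ln (x k / c)\<bar> / p"
    by simp
  have "\<forall>\<^sub>F k in sequentially. ln c / \<epsilon> \<le> \<bar>ln (x k)\<bar>"
    by (rule eventually_const_le_abs_ln[OF x])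
  then show "\<forall>\<^sub>F k in sequentially. \<bar>ln (x k / c)\<bar> / p \<le> (1 + \<epsilon>) * (\<bar>ln (x k)\<bar> / p)"
  proof eventually_elim
    case (elim k)
    then have "\<bar>ln (x k / c)\<bar> \<le> (1 + \<epsilon>) * \<bar>ln (x k)\<bar>"
      using \<epsilon> unfolding eq by (simp add: field_simps)
    then show ?case
      using \<open>0 < p\<close> by (simp add: divide_right_mono)
  qed
qed

lemma abs_ln_div_le_double:
  fixes x :: "nat \<Rightarrow> real"
  assumes x: "\<And>k. x k \<in> {0<..<1}" "x \<longlonglongrightarrow> 0" and c: "1 \<le> c"
  shows "\<forall>\<^sub>F k in sequentially. \<bar>ln (x k / c)\<bar> \<le> 2 * \<bar>ln (x k)\<bar>"
  using eventually_const_le_abs_ln[OF x, of "ln c"]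
proof eventually_elim
  case (elim k)
  then show ?case
    using abs_ln_div[of "x k" c] x(1)[of k] c by simp
qed

text \<open>The designs divide the error levels by 2 or 3. Up to the constant, the comparison of the two
  logarithms survives such a division, for the power condition here and for the ratio condition below.\<close>

lemma powr_comparison_rescale:
  fixes a b :: "nat \<Rightarrow> real"
  assumes a: "\<And>k. a k \<in> {0<..<1}" "a \<longlonglongrightarrow> 0" and b: "\<And>k. b k \<in> {0<..<1}" "b \<longlonglongrightarrow> 0"
    and c: "1 \<le> c" "1 \<le> c'" and r: "0 \<le> r"
    and le: "\<forall>\<^sub>F k in sequentially. \<bar>ln (b k)\<bar> \<le> 2 * \<bar>ln (a k)\<bar> powr r"
  shows "\<forall>\<^sub>F k in sequentially. \<bar>ln (b k / c')\<bar> \<le> 4 * \<bar>ln (a k / c)\<bar> powr r"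
  using abs_ln_div_le_double[OF b c(2)] le
proof eventually_elim
  case (elim k)
  have "\<bar>ln (a k)\<bar> powr r \<le> \<bar>ln (a k / c)\<bar> powr r"
    using abs_ln_div[of "a k" c] a(1)[of k] c r by (intro powr_mono2) auto
  then show ?case using elim by linarith
qed

lemma ratio_comparison_rescale:
  fixes a b :: "nat \<Rightarrow> real"
  assumes a: "\<And>k. a k \<in> {0<..<1}" "a \<longlonglongrightarrow> 0" and b: "\<And>k. b k \<in> {0<..<1}" "b \<longlonglongrightarrow> 0"
    and c: "1 \<le> c" "1 \<le> c'" and r: "0 \<le> r"
    and le: "\<forall>\<^sub>F k in sequentially. \<bar>ln (b k)\<bar> \<le> 2 * (\<bar>ln (a k)\<bar> / a k powr r)"
  shows "\<forall>\<^sub>F k in sequentially. \<bar>ln (b k / c')\<bar> \<le> 4 * (\<bar>ln (a k / c)\<bar> / (a k / c) powr r)"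
  using abs_ln_div_le_double[OF b c(2)] le
proof eventually_elim
  case (elim k)
  have a01: "0 < a k" "a k < 1" using a(1)[of k] by auto
  have "\<bar>ln (a k)\<bar> / a k powr r \<le> \<bar>ln (a k / c)\<bar> / (a k / c) powr r"
  proof (rule frac_le)
    show "\<bar>ln (a k)\<bar> \<le> \<bar>ln (a k / c)\<bar>"
      using abs_ln_div[of "a k" c] a01 c by simp
    show "(a k / c) powr r \<le> a k powr r"
      using a01 c r by (intro powr_mono2) (auto simp: field_simps)
  qed (use a01 c in auto)
  then show ?case using elim by linarith
qed

section \<open>Mean times of the multistage tests\<close>

context multistage_setting_N
begin

context
  fixes ks :: "real \<Rightarrow> real \<Rightarrow> real"
  assumes ks: "is_kstar P0 P1 T ks"
begin

lemma ks_feasible: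
  assumes "x \<in> {0<..<1}" "y \<in> {0<..<1}"
  shows "side1.feasible x y (side1.min_size x y) (ks x y)" "side0.feasible y x (side0.min_size y x) (ks x y)"
  using ks assms by (simp_all add: is_kstar_def feasible_side1 feasible_side0 min_size_side1 min_size_side0)

lemma ks_levels:
  assumes "x \<in> {0<..<1}" "y \<in> {0<..<1}"
  shows "1 \<le> nstar P0 P1 T x y"
    "measure P1 (space P1 - {\<omega> \<in> space P0. ks x y < T (nstar P0 P1 T x y) \<omega>}) \<le> y"
    "measure P0 (space P0 - {\<omega> \<in> space P0. T (nstar P0 P1 T x y) \<omega> \<le> ks x y}) \<le> x"
  using side1.min_size_feasible(1)[OF assms] ks_feasible[OF assms]
  by (simp_all add: side1.feasible_def side0.feasible_def min_size_side1 min_size_side0)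

context
  fixes a b :: "nat \<Rightarrow> real"
  assumes a: "\<And>k. a k \<in> {0<..<1}" "a \<longlonglongrightarrow> 0" and b: "\<And>k. b k \<in> {0<..<1}" "b \<longlonglongrightarrow> 0"
begin

lemma div01: "1 \<le> c \<Longrightarrow> a k / c \<in> {0<..<1}" "1 \<le> c \<Longrightarrow> b k / c \<in> {0<..<1}"
  using a(1)[of k] b(1)[of k] by (auto simp: divide_less_eq)

lemma div_tendsto: "(\<lambda>k. a k / c) \<longlonglongrightarrow> 0" "(\<lambda>k. b k / c) \<longlonglongrightarrow> 0"
  using tendsto_divide_zero[OF a(2)] tendsto_divide_zero[OF b(2)] by auto

text \<open>For \<open>chi_tilde\<close> and \<open>chi_hat\<close> under \<open>P1\<close>. An acceptance stage in \<open>A\<close> has an arbitrary level under \<open>P0\<close>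
  and, under \<open>P1\<close>, the level \<open>b k / c'\<close> of the final stage.\<close>

lemma one_rejection_stage_asymp:
  assumes c: "1 \<le> c" "1 \<le> c'"
    and le: "\<forall>\<^sub>F k in sequentially. \<bar>ln (b k)\<bar> \<le> 2 * \<bar>ln (a k)\<bar>"
    and sel: "\<And>k. is_arg_min (\<lambda>d. cost2 (nstar P0 P1 T (a k / c) d) (nstar P0 P1 T (a k / c) (b k / c')) d)
        (\<lambda>d. b k / c' < d \<and> d < 1) (d k)"
    and A: "\<And>k. finite (A k)" "\<And>k. card (A k) \<le> 2"
      "\<And>k n \<kappa>. (n, \<kappa>) \<in> A k \<Longrightarrow> \<exists>x\<in>{0<..<1}. n = nstar P0 P1 T x (b k / c') \<and> \<kappa> = ks x (b k / c')"
  shows "(\<lambda>k. enn2real (expected_time P1 (ms_test T (A k)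
      {(nstar P0 P1 T (a k / c) (d k), ks (a k / c) (d k))} (nstar P0 P1 T (a k / c) (b k / c')) (K k))))
    \<sim>[sequentially] (\<lambda>k. \<bar>ln (a k)\<bar> / p0)"
  unfolding expected_time_side1 min_size_side1[symmetric]
proof (rule asymp_equiv_trans)
  show "(\<lambda>k. \<bar>ln (a k / c)\<bar> / p0) \<sim>[sequentially] (\<lambda>k. \<bar>ln (a k)\<bar> / p0)"
    by (rule abs_ln_div_asymp[OF a c(1) p0(2)])
  have le': "\<forall>\<^sub>F k in sequentially. \<bar>ln (b k / c')\<bar> \<le> 4 * \<bar>ln (a k / c)\<bar> powr 1"
    by (rule powr_comparison_rescale[OF a b c]) (use le in simp_all)
  show "(\<lambda>k. enn2real (\<integral>\<^sup>+\<omega>. ennreal (real (staged_time (\<lambda>n \<kappa>. {\<omega> \<in> space P0. \<kappa> < T n \<omega>})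
      {(side1.min_size (a k / c) (d k), ks (a k / c) (d k))} (A k) (side1.min_size (a k / c) (b k / c')) \<omega>)) \<partial>P1))
    \<sim>[sequentially] (\<lambda>k. \<bar>ln (a k / c)\<bar> / p0)"
  proof (rule side1.one_right_stage_asymp[OF div01(1)[OF c(1)] div_tendsto(1) div01(2)[OF c(2)] div_tendsto(2)
        order_refl le' sel[folded min_size_side1] ks_feasible(1) A(1,2)])
    fix k n \<rho> assume "(n, \<rho>) \<in> A k"
    from A(3)[OF this] show "1 \<le> n \<and> measure P1 (space P1 - {\<omega> \<in> space P0. \<rho> < T n \<omega>}) \<le> b k / c'"
      using ks_levels(1,2)[OF _ div01(2)[OF c(2)]] by auto
  qed
qed

text \<open>For \<open>chi_check\<close> under \<open>P1\<close>.\<close>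

lemma two_rejection_stages_asymp:
  assumes c: "1 \<le> c" "1 \<le> c'" and r: "0 < r"
    and le: "\<forall>\<^sub>F k in sequentially. \<bar>ln (b k)\<bar> \<le> 2 * (\<bar>ln (a k)\<bar> / a k powr r)"
    and sel: "\<And>k. is_arg_min (\<lambda>(d, d'). cost3 (nstar P0 P1 T (a k / c) d) (nstar P0 P1 T (a k / c) d')
          (nstar P0 P1 T (a k / c) (b k / c')) d d')
        (\<lambda>(d, d'). b k / c' < d' \<and> d' < d \<and> d < 1) (d k, d' k)"
    and A: "\<And>k. finite (A k)" "\<And>k. card (A k) \<le> 2"
      "\<And>k n \<kappa>. (n, \<kappa>) \<in> A k \<Longrightarrow> \<exists>x\<in>{0<..<1}. n = nstar P0 P1 T x (b k / c') \<and> \<kappa> = ks x (b k / c')"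
  shows "(\<lambda>k. enn2real (expected_time P1 (ms_test T (A k)
      {(nstar P0 P1 T (a k / c) (d k), ks (a k / c) (d k)), (nstar P0 P1 T (a k / c) (d' k), ks (a k / c) (d' k))}
      (nstar P0 P1 T (a k / c) (b k / c')) (K k))))
    \<sim>[sequentially] (\<lambda>k. \<bar>ln (a k)\<bar> / p0)"
  unfolding expected_time_side1 min_size_side1[symmetric]
proof (rule asymp_equiv_trans)
  show "(\<lambda>k. \<bar>ln (a k / c)\<bar> / p0) \<sim>[sequentially] (\<lambda>k. \<bar>ln (a k)\<bar> / p0)"
    by (rule abs_ln_div_asymp[OF a c(1) p0(2)])
  have le': "\<forall>\<^sub>F k in sequentially. \<bar>ln (b k / c')\<bar> \<le> 4 * (\<bar>ln (a k / c)\<bar> / (a k / c) powr r)"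
    by (rule ratio_comparison_rescale[OF a b c]) (use le r in simp_all)
  show "(\<lambda>k. enn2real (\<integral>\<^sup>+\<omega>. ennreal (real (staged_time (\<lambda>n \<kappa>. {\<omega> \<in> space P0. \<kappa> < T n \<omega>})
      {(side1.min_size (a k / c) (d k), ks (a k / c) (d k)), (side1.min_size (a k / c) (d' k), ks (a k / c) (d' k))}
      (A k) (side1.min_size (a k / c) (b k / c')) \<omega>)) \<partial>P1))
    \<sim>[sequentially] (\<lambda>k. \<bar>ln (a k / c)\<bar> / p0)"
  proof (rule side1.two_right_stages_asymp[OF div01(1)[OF c(1)] div_tendsto(1) div01(2)[OF c(2)] div_tendsto(2)
        r le' _ sel[folded min_size_side1] ks_feasible(1) A(1,2)])
    fix k n \<rho> assume "(n, \<rho>) \<in> A k"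
    from A(3)[OF this] show "1 \<le> n \<and> measure P1 (space P1 - {\<omega> \<in> space P0. \<rho> < T n \<omega>}) \<le> b k / c'"
      using ks_levels(1,2)[OF _ div01(2)[OF c(2)]] by auto
  qed simp
qed

text \<open>For \<open>chi_tilde\<close> and \<open>chi_check\<close> under \<open>P0\<close>. Here the roles of \<open>a\<close> and \<open>b\<close> are exchanged, and the
  regime must bound \<open>\<bar>ln a\<bar>\<close> by a power of \<open>\<bar>ln b\<bar>\<close>.\<close>

lemma one_acceptance_stage_asymp:
  assumes c: "1 \<le> c" "1 \<le> c'" and r: "1 \<le> r"
    and le: "\<forall>\<^sub>F k in sequentially. \<bar>ln (a k)\<bar> \<le> 2 * \<bar>ln (b k)\<bar> powr r"
    and sel: "\<And>k. is_arg_min (\<lambda>g. cost2 (nstar P0 P1 T g (b k / c')) (nstar P0 P1 T (a k / c) (b k / c')) g)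
        (\<lambda>g. a k / c < g \<and> g < 1) (g k)"
    and R: "\<And>k. finite (R k)" "\<And>k. card (R k) \<le> 2"
      "\<And>k n \<kappa>. (n, \<kappa>) \<in> R k \<Longrightarrow> \<exists>y\<in>{0<..<1}. n = nstar P0 P1 T (a k / c) y \<and> \<kappa> = ks (a k / c) y"
  shows "(\<lambda>k. enn2real (expected_time P0 (ms_test T
      {(nstar P0 P1 T (g k) (b k / c'), ks (g k) (b k / c'))} (R k) (nstar P0 P1 T (a k / c) (b k / c')) (K k))))
    \<sim>[sequentially] (\<lambda>k. \<bar>ln (b k)\<bar> / p1)"
  unfolding expected_time_side0 min_size_side0[symmetric]
proof (rule asymp_equiv_trans)
  show "(\<lambda>k. \<bar>ln (b k / c')\<bar> / p1) \<sim>[sequentially] (\<lambda>k. \<bar>ln (b k)\<bar> / p1)"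
    by (rule abs_ln_div_asymp[OF b c(2) p1(2)])
  have le': "\<forall>\<^sub>F k in sequentially. \<bar>ln (a k / c)\<bar> \<le> 4 * \<bar>ln (b k / c')\<bar> powr r"
    by (rule powr_comparison_rescale[OF b a c(2,1)]) (use le r in simp_all)
  show "(\<lambda>k. enn2real (\<integral>\<^sup>+\<omega>. ennreal (real (staged_time (\<lambda>n \<kappa>. {\<omega> \<in> space P0. T n \<omega> \<le> \<kappa>})
      {(side0.min_size (b k / c') (g k), ks (g k) (b k / c'))} (R k) (side0.min_size (b k / c') (a k / c)) \<omega>)) \<partial>P0))
    \<sim>[sequentially] (\<lambda>k. \<bar>ln (b k / c')\<bar> / p1)"
  proof (rule side0.one_right_stage_asymp[where \<kappa> = "\<lambda>x y. ks y x", OF div01(2)[OF c(2)] div_tendsto(2) div01(1)[OF c(1)] div_tendsto(1)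
        r le' sel[folded min_size_side0] ks_feasible(2) R(1,2)])
    fix k n \<rho> assume "(n, \<rho>) \<in> R k"
    from R(3)[OF this] show "1 \<le> n \<and> measure P0 (space P0 - {\<omega> \<in> space P0. T n \<omega> \<le> \<rho>}) \<le> a k / c"
      using ks_levels(1,3)[OF div01(1)[OF c(1)]] by auto
  qed
qed

text \<open>For \<open>chi_hat\<close> under \<open>P0\<close>: the additional acceptance stage replaces the power condition by the
  much weaker ratio condition.\<close>

lemma two_acceptance_stages_asymp:
  assumes c: "1 \<le> c" "1 \<le> c'" and r: "0 < r"
    and le: "\<forall>\<^sub>F k in sequentially. \<bar>ln (a k)\<bar> \<le> 2 * (\<bar>ln (b k)\<bar> / b k powr r)"
    and sel: "\<And>k. is_arg_min (\<lambda>(g, g'). cost3 (nstar P0 P1 T g (b k / c')) (nstar P0 P1 T g' (b k / c'))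
          (nstar P0 P1 T (a k / c) (b k / c')) g g')
        (\<lambda>(g, g'). a k / c < g' \<and> g' < g \<and> g < 1) (g k, g' k)"
    and R: "\<And>k. finite (R k)" "\<And>k. card (R k) \<le> 2"
      "\<And>k n \<kappa>. (n, \<kappa>) \<in> R k \<Longrightarrow> \<exists>y\<in>{0<..<1}. n = nstar P0 P1 T (a k / c) y \<and> \<kappa> = ks (a k / c) y"
  shows "(\<lambda>k. enn2real (expected_time P0 (ms_test T
      {(nstar P0 P1 T (g k) (b k / c'), ks (g k) (b k / c')), (nstar P0 P1 T (g' k) (b k / c'), ks (g' k) (b k / c'))}
      (R k) (nstar P0 P1 T (a k / c) (b k / c')) (K k))))
    \<sim>[sequentially] (\<lambda>k. \<bar>ln (b k)\<bar> / p1)"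
  unfolding expected_time_side0 min_size_side0[symmetric]
proof (rule asymp_equiv_trans)
  show "(\<lambda>k. \<bar>ln (b k / c')\<bar> / p1) \<sim>[sequentially] (\<lambda>k. \<bar>ln (b k)\<bar> / p1)"
    by (rule abs_ln_div_asymp[OF b c(2) p1(2)])
  have le': "\<forall>\<^sub>F k in sequentially. \<bar>ln (a k / c)\<bar> \<le> 4 * (\<bar>ln (b k / c')\<bar> / (b k / c') powr r)"
    by (rule ratio_comparison_rescale[OF b a c(2,1)]) (use le r in simp_all)
  show "(\<lambda>k. enn2real (\<integral>\<^sup>+\<omega>. ennreal (real (staged_time (\<lambda>n \<kappa>. {\<omega> \<in> space P0. T n \<omega> \<le> \<kappa>})
      {(side0.min_size (b k / c') (g k), ks (g k) (b k / c')), (side0.min_size (b k / c') (g' k), ks (g' k) (b k / c'))}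
      (R k) (side0.min_size (b k / c') (a k / c)) \<omega>)) \<partial>P0))
    \<sim>[sequentially] (\<lambda>k. \<bar>ln (b k / c')\<bar> / p1)"
  proof (rule side0.two_right_stages_asymp[where \<kappa> = "\<lambda>x y. ks y x", OF div01(2)[OF c(2)] div_tendsto(2) div01(1)[OF c(1)] div_tendsto(1)
        r le' _ sel[folded min_size_side0] ks_feasible(2) R(1,2)])
    fix k n \<rho> assume "(n, \<rho>) \<in> R k"
    from R(3)[OF this] show "1 \<le> n \<and> measure P0 (space P0 - {\<omega> \<in> space P0. T n \<omega> \<le> \<rho>}) \<le> a k / c"
      using ks_levels(1,3)[OF div01(1)[OF c(1)]] by auto
  qed simp
qed

lemma opt_time_asymp1:
  "(\<lambda>k. \<bar>ln (a k)\<bar> / p0) \<sim>[sequentially] (\<lambda>k. I1 / p0 * enn2real (opt_time P1 P0 P1 S X (a k) (b k)))"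
proof -
  have "(\<lambda>k. I1 / p0 * enn2real (opt_time P1 P0 P1 S X (a k) (b k))) \<sim>[sequentially] (\<lambda>k. I1 / p0 * (\<bar>ln (a k)\<bar> / I1))"
    unfolding opt_time_side1 by (intro asymp_equiv_mult asymp_equiv_refl side1.opt_mean_asymp a b)
  also have "(\<lambda>k. I1 / p0 * (\<bar>ln (a k)\<bar> / I1)) = (\<lambda>k. \<bar>ln (a k)\<bar> / p0)"
    using I_pos by auto
  finally show ?thesis
    by (rule asymp_equiv_symI)
qed

lemma opt_time_asymp0:
  "(\<lambda>k. \<bar>ln (b k)\<bar> / p1) \<sim>[sequentially] (\<lambda>k. I0 / p1 * enn2real (opt_time P0 P0 P1 S X (a k) (b k)))"
proof -
  have "(\<lambda>k. I0 / p1 * enn2real (opt_time P0 P0 P1 S X (a k) (b k))) \<sim>[sequentially] (\<lambda>k. I0 / p1 * (\<bar>ln (b k)\<bar> / I0))"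
    unfolding opt_time_side0 by (intro asymp_equiv_mult asymp_equiv_refl side0.opt_mean_asymp a b)
  also have "(\<lambda>k. I0 / p1 * (\<bar>ln (b k)\<bar> / I0)) = (\<lambda>k. \<bar>ln (b k)\<bar> / p1)"
    using I_pos by auto
  finally show ?thesis
    by (rule asymp_equiv_symI)
qed

end

end

end

lemma gtrsim_imp_le_double:
  assumes "x \<greatersim> y" "\<And>k. 0 < y k"
  shows "\<forall>\<^sub>F k in sequentially. y k \<le> 2 * x k"
proof -
  have "ereal (1 / 2) < Liminf sequentially (\<lambda>k. ereal (x k / y k))"
    using assms(1) unfolding asymp_gtrsim_def by (rule order_less_le_trans[rotated]) simp
  then have "\<forall>\<^sub>F k in sequentially. ereal (1 / 2) < ereal (x k / y k)"
    by (rule less_LiminfD)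
  then show ?thesis
    by eventually_elim (use assms(2) in \<open>simp add: field_simps less_imp_le\<close>)
qed

lemma lesssim_imp_le_double:
  fixes x y :: "nat \<Rightarrow> real"
  assumes "x \<lesssim> y" "\<And>k. 0 < y k"
  shows "\<forall>\<^sub>F k in sequentially. x k \<le> 2 * y k"
proof -
  have "Limsup sequentially (\<lambda>k. ereal (x k / y k)) < ereal 2"
    using assms(1) unfolding asymp_lesssim_def by (rule order_le_less_trans) simp
  then have "\<forall>\<^sub>F k in sequentially. ereal (x k / y k) < ereal 2"
    by (rule Limsup_lessD)
  then show ?thesis
    by eventually_elim (use assms(2) in \<open>simp add: field_simps less_imp_le\<close>)
qed

theorem theorem4p4:
  fixes P0 P1 :: "'w measure" and S :: "'s measure" and X :: "nat \<Rightarrow> 'w \<Rightarrow> 's"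
    and fam fam0 fam1 :: "(nat \<Rightarrow> 's) measure set"
    and T :: "nat \<Rightarrow> 'w \<Rightarrow> real"
    and I0 I1 J0 J1 :: real
    and \<psi>0 \<psi>1 :: "real \<Rightarrow> ereal"
    and ks :: "real \<Rightarrow> real \<Rightarrow> real"
    and g_tilde d_tilde g_hat g_hat' d_hat g_check d_check d_check' :: "real \<Rightarrow> real \<Rightarrow> real"
  assumes "multistage_setting P0 P1 S X fam fam0 fam1 T I0 I1 J0 J1 \<psi>0 \<psi>1"
    and "\<exists>n\<ge>1. \<not> (AE \<omega> in P0. T n \<omega> = avg_LLR P0 P1 S X n \<omega>)"
    and "condition_N P0 P1 T J0 J1 \<psi>0 \<psi>1"
    and "is_kstar P0 P1 T ks"
    and "\<And>\<alpha> \<beta>. \<alpha> \<in> {0<..<1} \<Longrightarrow> \<beta> \<in> {0<..<1} \<Longrightarrow>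
           selected_tilde (nstar P0 P1 T) (g_tilde \<alpha> \<beta>) (d_tilde \<alpha> \<beta>) \<alpha> \<beta>"
    and "\<And>\<alpha> \<beta>. \<alpha> \<in> {0<..<1} \<Longrightarrow> \<beta> \<in> {0<..<1} \<Longrightarrow>
           selected_hat (nstar P0 P1 T) (g_hat \<alpha> \<beta>) (g_hat' \<alpha> \<beta>) (d_hat \<alpha> \<beta>) \<alpha> \<beta>"
    and "\<And>\<alpha> \<beta>. \<alpha> \<in> {0<..<1} \<Longrightarrow> \<beta> \<in> {0<..<1} \<Longrightarrow>
           selected_check (nstar P0 P1 T) (g_check \<alpha> \<beta>) (d_check \<alpha> \<beta>) (d_check' \<alpha> \<beta>) \<alpha> \<beta>"
  shows
    "\<forall>a b :: nat \<Rightarrow> real.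
       (\<forall>k. a k \<in> {0<..<1} \<and> b k \<in> {0<..<1}) \<and> a \<longlonglongrightarrow> 0 \<and> b \<longlonglongrightarrow> 0 \<and>
       (\<lambda>k. \<bar>ln (a k)\<bar>) \<greatersim> (\<lambda>k. \<bar>ln (b k)\<bar>) \<longrightarrow>
       (let ns = nstar P0 P1 T;
            tilde = (\<lambda>\<alpha> \<beta>. chi_tilde T ns ks (g_tilde \<alpha> \<beta>) (d_tilde \<alpha> \<beta>) \<alpha> \<beta>);
            hat = (\<lambda>\<alpha> \<beta>. chi_hat T ns ks (g_hat \<alpha> \<beta>) (g_hat' \<alpha> \<beta>) (d_hat \<alpha> \<beta>) \<alpha> \<beta>);
            check = (\<lambda>\<alpha> \<beta>. chi_check T ns ks (g_check \<alpha> \<beta>) (d_check \<alpha> \<beta>) (d_check' \<alpha> \<beta>) \<alpha> \<beta>);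
            E0 = (\<lambda>\<xi> k. enn2real (expected_time P0 (\<xi> (a k) (b k))));
            E1 = (\<lambda>\<xi> k. enn2real (expected_time P1 (\<xi> (a k) (b k))));
            L0 = (\<lambda>k. enn2real (opt_time P0 P0 P1 S X (a k) (b k)));
            L1 = (\<lambda>k. enn2real (opt_time P1 P0 P1 S X (a k) (b k)));
            p0 = real_of_ereal (\<psi>0 J1);
            p1 = real_of_ereal (\<psi>1 J0)
        in
          (E1 tilde \<sim>[sequentially] E1 hat \<and>
           E1 hat \<sim>[sequentially] E1 check \<and>
           E1 check \<sim>[sequentially] (\<lambda>k. \<bar>ln (a k)\<bar> / p0) \<and>
           (\<lambda>k. \<bar>ln (a k)\<bar> / p0) \<sim>[sequentially] (\<lambda>k. I1 / p0 * L1 k)) \<and>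
          ((\<exists>r>0. (\<lambda>k. \<bar>ln (a k)\<bar>) \<lesssim> (\<lambda>k. \<bar>ln (b k)\<bar> / b k powr r)) \<longrightarrow>
             E0 hat \<sim>[sequentially] (\<lambda>k. \<bar>ln (b k)\<bar> / p1) \<and>
             (\<lambda>k. \<bar>ln (b k)\<bar> / p1) \<sim>[sequentially] (\<lambda>k. I0 / p1 * L0 k)) \<and>
          ((\<exists>r\<ge>1. (\<lambda>k. \<bar>ln (a k)\<bar>) \<lesssim> (\<lambda>k. \<bar>ln (b k)\<bar> powr r)) \<longrightarrow>
             E0 tilde \<sim>[sequentially] E0 check \<and>
             E0 check \<sim>[sequentially] (\<lambda>k. \<bar>ln (b k)\<bar> / p1) \<and>
             (\<lambda>k. \<bar>ln (b k)\<bar> / p1) \<sim>[sequentially] (\<lambda>k. I0 / p1 * L0 k)))"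
proof (intro allI impI, elim conjE)
  fix a b :: "nat \<Rightarrow> real"
  assume ab01: "\<forall>k. a k \<in> {0<..<1} \<and> b k \<in> {0<..<1}" and a0: "a \<longlonglongrightarrow> 0" and b0: "b \<longlonglongrightarrow> 0"
    and gtr: "(\<lambda>k. \<bar>ln (a k)\<bar>) \<greatersim> (\<lambda>k. \<bar>ln (b k)\<bar>)"
  interpret multistage_setting_N P0 P1 S X fam fam0 fam1 T I0 I1 J0 J1 \<psi>0 \<psi>1
    using assms(1,3) by (intro multistage_setting_N.intro multistage_setting_N_axioms.intro)
  have a: "a k \<in> {0<..<1}" and b: "b k \<in> {0<..<1}" for k
    using ab01 by auto
  have lnb: "0 < \<bar>ln (b k)\<bar>" and lna: "0 < \<bar>ln (a k)\<bar>" for k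
    using a[of k] b[of k] by (auto simp: less_imp_neq)
  note seqs = assms(4) a a0 b b0
  let ?n = "nstar P0 P1 T"
  define tilde where "tilde k = chi_tilde T ?n ks (g_tilde (a k) (b k)) (d_tilde (a k) (b k)) (a k) (b k)" for k
  define hat where "hat k = chi_hat T ?n ks (g_hat (a k) (b k)) (g_hat' (a k) (b k)) (d_hat (a k) (b k)) (a k) (b k)" for k
  define check where "check k = chi_check T ?n ks (g_check (a k) (b k)) (d_check (a k) (b k)) (d_check' (a k) (b k)) (a k) (b k)" for k
  note sel_tilde = assms(5)[OF a b, unfolded selected_tilde_def]
  note sel_hat = assms(6)[OF a b, unfolded selected_hat_def]
  note sel_check = assms(7)[OF a b, unfolded selected_check_def]
  have range_tilde: "g_tilde (a k) (b k) \<in> {0<..<1}" "d_tilde (a k) (b k) \<in> {0<..<1}" for k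
    using sel_tilde[of k k] a[of k] b[of k] by (auto simp: is_arg_min_def)
  have range_hat: "g_hat (a k) (b k) \<in> {0<..<1}" "g_hat' (a k) (b k) \<in> {0<..<1}" "d_hat (a k) (b k) \<in> {0<..<1}" for k
    using sel_hat[of k k] a[of k] b[of k] by (auto simp: is_arg_min_def)
  have range_check: "g_check (a k) (b k) \<in> {0<..<1}" "d_check (a k) (b k) \<in> {0<..<1}" "d_check' (a k) (b k) \<in> {0<..<1}" for k
    using sel_check[of k k] a[of k] b[of k] by (auto simp: is_arg_min_def)
  have le1: "\<forall>\<^sub>F k in sequentially. \<bar>ln (b k)\<bar> \<le> 2 * \<bar>ln (a k)\<bar>"
    by (rule gtrsim_imp_le_double[OF gtr lnb])
  \<comment> \<open>The regime \<open>\<bar>ln \<alpha>\<bar> \<greatersim> \<bar>ln \<beta>\<bar>\<close> implies the ratio condition for \<open>chi_check\<close> with \<open>r = 1\<close>.\<close>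
  have le1': "\<forall>\<^sub>F k in sequentially. \<bar>ln (b k)\<bar> \<le> 2 * (\<bar>ln (a k)\<bar> / a k powr 1)"
    using le1
  proof eventually_elim
    case (elim k)
    have "\<bar>ln (a k)\<bar> / 1 \<le> \<bar>ln (a k)\<bar> / a k powr 1"
      using a[of k] by (intro frac_le) auto
    then show ?case using elim by simp
  qed
  have E1: "(\<lambda>k. enn2real (expected_time P1 (tilde k))) \<sim>[sequentially] (\<lambda>k. \<bar>ln (a k)\<bar> / p0)"
    "(\<lambda>k. enn2real (expected_time P1 (hat k))) \<sim>[sequentially] (\<lambda>k. \<bar>ln (a k)\<bar> / p0)"
    "(\<lambda>k. enn2real (expected_time P1 (check k))) \<sim>[sequentially] (\<lambda>k. \<bar>ln (a k)\<bar> / p0)"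
  proof -
    show "(\<lambda>k. enn2real (expected_time P1 (tilde k))) \<sim>[sequentially] (\<lambda>k. \<bar>ln (a k)\<bar> / p0)"
      unfolding tilde_def chi_tilde_def
      by (rule one_rejection_stage_asymp[OF seqs _ _ le1])
        (use sel_tilde range_tilde in auto)
    show "(\<lambda>k. enn2real (expected_time P1 (hat k))) \<sim>[sequentially] (\<lambda>k. \<bar>ln (a k)\<bar> / p0)"
      unfolding hat_def chi_hat_def
      by (rule one_rejection_stage_asymp[OF seqs _ _ le1])
        (use sel_hat range_hat in \<open>auto simp: card_insert_if\<close>)
    show "(\<lambda>k. enn2real (expected_time P1 (check k))) \<sim>[sequentially] (\<lambda>k. \<bar>ln (a k)\<bar> / p0)"
      unfolding check_def chi_check_def
      by (rule two_rejection_stages_asymp[OF seqs _ _ _ le1'])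
        (use sel_check range_check in auto)
  qed
  have E0_hat: "(\<lambda>k. enn2real (expected_time P0 (hat k))) \<sim>[sequentially] (\<lambda>k. \<bar>ln (b k)\<bar> / p1)"
    if r: "0 < r" "(\<lambda>k. \<bar>ln (a k)\<bar>) \<lesssim> (\<lambda>k. \<bar>ln (b k)\<bar> / b k powr r)" for r
  proof -
    have "0 < \<bar>ln (b k)\<bar> / b k powr r" for k
      using lnb[of k] b[of k] by (intro divide_pos_pos) auto
    note le = lesssim_imp_le_double[OF r(2) this]
    show ?thesis
      unfolding hat_def chi_hat_def
      by (rule two_acceptance_stages_asymp[OF seqs _ _ r(1) le])
        (use sel_hat range_hat in auto)
  qed
  have E0: "(\<lambda>k. enn2real (expected_time P0 (tilde k))) \<sim>[sequentially] (\<lambda>k. \<bar>ln (b k)\<bar> / p1)"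
    "(\<lambda>k. enn2real (expected_time P0 (check k))) \<sim>[sequentially] (\<lambda>k. \<bar>ln (b k)\<bar> / p1)"
    if r: "1 \<le> r" "(\<lambda>k. \<bar>ln (a k)\<bar>) \<lesssim> (\<lambda>k. \<bar>ln (b k)\<bar> powr r)" for r
  proof -
    have "0 < \<bar>ln (b k)\<bar> powr r" for k
      using lnb[of k] by simp
    note le = lesssim_imp_le_double[OF r(2) this]
    show "(\<lambda>k. enn2real (expected_time P0 (tilde k))) \<sim>[sequentially] (\<lambda>k. \<bar>ln (b k)\<bar> / p1)"
      unfolding tilde_def chi_tilde_def
      by (rule one_acceptance_stage_asymp[OF seqs _ _ r(1) le])
        (use sel_tilde range_tilde in auto)
    show "(\<lambda>k. enn2real (expected_time P0 (check k))) \<sim>[sequentially] (\<lambda>k. \<bar>ln (b k)\<bar> / p1)"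
      unfolding check_def chi_check_def
      by (rule one_acceptance_stage_asymp[OF seqs _ _ r(1) le])
        (use sel_check range_check in \<open>auto simp: card_insert_if\<close>)
  qed
  note L = opt_time_asymp1[OF seqs] opt_time_asymp0[OF seqs]
  have T1: "(\<lambda>k. enn2real (expected_time P1 (tilde k))) \<sim>[sequentially] (\<lambda>k. enn2real (expected_time P1 (hat k)))"
    "(\<lambda>k. enn2real (expected_time P1 (hat k))) \<sim>[sequentially] (\<lambda>k. enn2real (expected_time P1 (check k)))"
    using E1 asymp_equiv_symI asymp_equiv_trans by blast+
  have T0: "(\<lambda>k. enn2real (expected_time P0 (tilde k))) \<sim>[sequentially] (\<lambda>k. enn2real (expected_time P0 (check k)))"
    if "1 \<le> r" "(\<lambda>k. \<bar>ln (a k)\<bar>) \<lesssim> (\<lambda>k. \<bar>ln (b k)\<bar> powr r)" for r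
    using E0[OF that] asymp_equiv_symI asymp_equiv_trans by blast
  show "(let ns = nstar P0 P1 T;
            tilde = (\<lambda>\<alpha> \<beta>. chi_tilde T ns ks (g_tilde \<alpha> \<beta>) (d_tilde \<alpha> \<beta>) \<alpha> \<beta>);
            hat = (\<lambda>\<alpha> \<beta>. chi_hat T ns ks (g_hat \<alpha> \<beta>) (g_hat' \<alpha> \<beta>) (d_hat \<alpha> \<beta>) \<alpha> \<beta>);
            check = (\<lambda>\<alpha> \<beta>. chi_check T ns ks (g_check \<alpha> \<beta>) (d_check \<alpha> \<beta>) (d_check' \<alpha> \<beta>) \<alpha> \<beta>);
            E0 = (\<lambda>\<xi> k. enn2real (expected_time P0 (\<xi> (a k) (b k))));
            E1 = (\<lambda>\<xi> k. enn2real (expected_time P1 (\<xi> (a k) (b k))));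
            L0 = (\<lambda>k. enn2real (opt_time P0 P0 P1 S X (a k) (b k)));
            L1 = (\<lambda>k. enn2real (opt_time P1 P0 P1 S X (a k) (b k)));
            p0 = real_of_ereal (\<psi>0 J1);
            p1 = real_of_ereal (\<psi>1 J0)
        in
          (E1 tilde \<sim>[sequentially] E1 hat \<and>
           E1 hat \<sim>[sequentially] E1 check \<and>
           E1 check \<sim>[sequentially] (\<lambda>k. \<bar>ln (a k)\<bar> / p0) \<and>
           (\<lambda>k. \<bar>ln (a k)\<bar> / p0) \<sim>[sequentially] (\<lambda>k. I1 / p0 * L1 k)) \<and>
          ((\<exists>r>0. (\<lambda>k. \<bar>ln (a k)\<bar>) \<lesssim> (\<lambda>k. \<bar>ln (b k)\<bar> / b k powr r)) \<longrightarrow>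
             E0 hat \<sim>[sequentially] (\<lambda>k. \<bar>ln (b k)\<bar> / p1) \<and>
             (\<lambda>k. \<bar>ln (b k)\<bar> / p1) \<sim>[sequentially] (\<lambda>k. I0 / p1 * L0 k)) \<and>
          ((\<exists>r\<ge>1. (\<lambda>k. \<bar>ln (a k)\<bar>) \<lesssim> (\<lambda>k. \<bar>ln (b k)\<bar> powr r)) \<longrightarrow>
             E0 tilde \<sim>[sequentially] E0 check \<and>
             E0 check \<sim>[sequentially] (\<lambda>k. \<bar>ln (b k)\<bar> / p1) \<and>
             (\<lambda>k. \<bar>ln (b k)\<bar> / p1) \<sim>[sequentially] (\<lambda>k. I0 / p1 * L0 k)))"
    unfolding Let_def tilde_def[symmetric] hat_def[symmetric] check_def[symmetric] p0_def[symmetric] p1_def[symmetric]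
    using T1 E1(3) L E0_hat E0(2) T0 by blast
qed

end
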